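(* Let $n\ge 1$, fix $I\subseteq\{1,\ldots,n\}$ and set $\xi_I=\sum_{i\in I}H_i$. (1) If $\sum_{i\in I} i$ is even, then $\xi_I$ is the unique $I$-canonical element of $Spin(2n+1)$, and $$r_{\rho_k}(\xi_I)=2|I|+2|I\cap\{2,\ldots,n\}|+\ldots+2|I\cap\{k,\ldots,n\}|\qquad\text{for } k<n. \quad ( * )$$ (2) If $\sum_{i\in I} i$ is odd, then the $I$-canonical elements of $Spin(2n+1)$ are precisely the elements of the form $\xi_I^j=H_j+\xi_I$ with $j\in I$ odd, and $$r_{\rho_k}(\xi_I^j)=r_{\rho_k}(\xi_I)+2\min\{j,k\}\qquad\text{for } k<n,$$ where $r_{\rho_k}(\xi_I)$ denotes the right-hand side of $( * )$. (3) When $k=n$, the uniton numbers are $r_{\rho_n}(\xi_I)=\sum_{l=1}^n|I\cap\{l,\ldots,n\}|$ if $\sum_{i\in I} i$ is even, and $r_{\rho_n}(\xi_I^j)=\sum_{l=1}^n|I\cap\{l,\ldots,n\}|+j$ for each odd $j\in I$ if $\sum_{i\in I} i$ is odd.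
   Context: General setting. Let $G$ be a compact connected Lie group with Lie algebra $\mathfrak g$, $\mathfrak t\subset\mathfrak g$ a maximal torus (maximal abelian subalgebra), $\alpha_1,\ldots,\alpha_n\in\sqrt{-1}\,\mathfrak t^*$ the positive simple roots for a chosen set of positive roots $\Delta^+$, and $H_1,\ldots,H_n\in\mathfrak t$ the dual basis: $\alpha_i(H_j)=\sqrt{-1}\,\delta_{ij}$. Put $\mathfrak I(G)=\{\xi\in\mathfrak t:\exp_G(2\pi\xi)=e\}$ and $\mathfrak I'(G)=\{\xi\in\mathfrak I(G): \alpha(\xi)/\sqrt{-1}\ge 0 \text{ for all }\alpha\in\Delta^+\}$. For $\xi\in\mathfrak I'(G)$ let $\mathfrak g^\xi_j$ ($j\in\mathbb Z$) be the $\sqrt{-1}\,j$-eigenspace of $\mathrm{ad}\,\xi$ on $\mathfrak g^{\mathbb C}$ and $\mathfrak p_i^\xi=\bigoplus_{j\le i}\mathfrak g_j^\xi$. Define a partial order on $\mathfrak I'(G)$ by: $\xi\preceq\xi'$ iff $\mathfrak p^\xi_i\subseteq\mathfrak p^{\xi'}_i$ for all $i\ge 0$ (writing $\xi=\sum n_iH_i$, $\xi'=\sum n_i'H_i$, this is equivalent to $n_i'\le n_i$ for all $i$). For $I\subseteq\{1,\ldots,n\}$ let $\mathfrak C_I=\{\sum_i n_iH_i : n_i\ge 0,\ n_j=0 \text{ iff } j\notin I\}$. An $I$-canonical element of $G$ is a maximal element of $(\mathfrak I'(G)\cap\mathfrak C_I,\preceq)$. Uniton number. If $\rho$ is an irreducible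 representation of $\mathfrak g^{\mathbb C}$ with highest weight $\omega^*$ and lowest weight $\varpi^*$, then $r_\rho(\xi):=\frac{1}{\sqrt{-1}}\big(\omega^*(\xi)-\varpi^*(\xi)\big)$. The case $(B_n)$. $\mathfrak g=\mathfrak{so}(2n+1)$, with simply connected group $Spin(2n+1)$. With respect to a basis $e_1,\ldots,e_{2n+1}$ of $\mathbb C^{2n+1}$ with $Q(e_i,e_{n+i})=1$ $(1\le i\le n)$, $Q(e_{2n+1},e_{2n+1})=1$ and all other pairings zero, where $Q$ is the complex-bilinear extension of the standard inner product of $\mathbb R^{2n+1}$, and with $e_{n+i}=\overline{e_i}$ and $e_{2n+1}$ real, $E_i$ is the diagonal matrix with $E_ie_i=\sqrt{-1}e_i$, $E_ie_{n+i}=-\sqrt{-1}e_{n+i}$, and zero on the other basis vectors. $\mathfrak t=\{\sum a_iE_i: a_i\in\mathbb R\}$, and $L_1,\ldots,L_n\in\sqrt{-1}\,\mathfrak t^*$ are given by $L_i(E_j)=\sqrt{-1}\,\delta_{ij}$. The positive roots are $\Delta^+=\{L_i\pm L_j\}_{i<j}\cup\{L_i\}_i$, with simple roots $\alpha_i=L_i-L_{i+1}$ for $1\le i\le n-1$ and $\alpha_n=L_n$, so that $H_i=E_1+\ldots+E_i$. The fundamental weights are $\omega_i=L_1+\ldots+L_i$ for $1\le i\le n-1$ and $\omega_n=\frac12(L_1+\ldots+L_n)$; $\rho_k$ is the irreducible representation with highest weight $\omega_k$. *)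

theory Defs
  imports
    Complex_Main
    "HOL-Library.FuncSet"
    "HOL-Library.Nonpos_Ints"
    "Jordan_Normal_Form.VS_Connect"
begin

section \<open>The Lie algebra and its maximal torus\<close>

text \<open>
  Everything is written in the standard basis \<open>u\<^sub>1, \<dots>, u\<^sub>N\<close> of \<open>\<real>\<^sup>N\<close>, \<open>N = 2n+1\<close>, so that the
  Lie algebra of the group consists of the real skew-symmetric matrices and its
  complexification of the complex ones. Matrix indices start at 0, so \<open>u\<^sub>i\<close> has index \<open>i - 1\<close>;
  the indices of \<open>E\<^sub>i\<close>, \<open>H\<^sub>i\<close>, \<open>L\<^sub>i\<close> and of the weights run through \<open>1, \<dots>, n\<close>.
\<close>

definition so :: "nat \<Rightarrow> 'a::comm_ring_1 mat set" where
  "so N = {X \<in> carrier_mat N N. transpose_mat X = - X}"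

definition bracket :: "'a::comm_ring_1 mat \<Rightarrow> 'a mat \<Rightarrow> 'a mat" where
  "bracket X Y = X * Y - Y * X"

abbreviation cplx :: "real mat \<Rightarrow> complex mat" where
  "cplx \<equiv> map_mat complex_of_real"

text \<open>
  The isotropic basis is \<open>e\<^sub>i = (u\<^sub>i - \<i> u\<^sub>n\<^sub>+\<^sub>i) / \<surd>2\<close>, \<open>e\<^sub>n\<^sub>+\<^sub>i\<close> its conjugate, and
  \<open>e\<^sub>2\<^sub>n\<^sub>+\<^sub>1 = u\<^sub>2\<^sub>n\<^sub>+\<^sub>1\<close>. In the basis \<open>u\<close> the matrix \<open>E\<^sub>i\<close>, which is diagonal in the basis \<open>e\<close>,
  generates the rotations of the plane spanned by \<open>u\<^sub>i\<close> and \<open>u\<^sub>n\<^sub>+\<^sub>i\<close>.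
\<close>

definition isotropic_basis :: "nat \<Rightarrow> nat \<Rightarrow> complex vec" where
  "isotropic_basis n k =
    (let u = (\<lambda>i. unit_vec (2 * n + 1) (i - 1)); c = complex_of_real (1 / sqrt 2) in
     if k \<le> n then c \<cdot>\<^sub>v (u k - \<i> \<cdot>\<^sub>v u (n + k))
     else if k \<le> 2 * n then c \<cdot>\<^sub>v (u (k - n) + \<i> \<cdot>\<^sub>v u k)
     else u (2 * n + 1))"

definition E :: "nat \<Rightarrow> nat \<Rightarrow> real mat" where
  "E n i = mat (2 * n + 1) (2 * n + 1) (\<lambda>(r, c).
     if r = n + i - 1 \<and> c = i - 1 then 1
     else if r = i - 1 \<and> c = n + i - 1 then - 1
     else 0)"

abbreviation mat_sum :: "nat \<Rightarrow> ('i \<Rightarrow> 'a::comm_ring_1 mat) \<Rightarrow> 'i set \<Rightarrow> 'a mat" where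
  "mat_sum N \<equiv> finsum (module_mat TYPE('a) N N)"

definition torus :: "nat \<Rightarrow> real mat set" where
  "torus n = {mat_sum (2 * n + 1) (\<lambda>i. a i \<cdot>\<^sub>m E n i) {1..n} | a. True}"

definition H :: "nat \<Rightarrow> nat \<Rightarrow> real mat" where
  "H n i = mat_sum (2 * n + 1) (E n) {1..i}"

text \<open>\<open>L\<^sub>i\<close> reads off the coefficient of \<open>E\<^sub>i\<close>, see \<open>L_E\<close> at the end.\<close>

definition L :: "nat \<Rightarrow> nat \<Rightarrow> real mat \<Rightarrow> complex" where
  "L n i \<xi> = \<i> * complex_of_real (\<xi> $$ (n + i - 1, i - 1))"

definition positive_roots :: "nat \<Rightarrow> (real mat \<Rightarrow> complex) set" where
  "positive_roots n =
     {(\<lambda>\<xi>. L n i \<xi> - L n j \<xi>) | i j. 1 \<le> i \<and> i < j \<and> j \<le> n} \<union>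
     {(\<lambda>\<xi>. L n i \<xi> + L n j \<xi>) | i j. 1 \<le> i \<and> i < j \<and> j \<le> n} \<union>
     {L n i | i. 1 \<le> i \<and> i \<le> n}"

definition simple_root :: "nat \<Rightarrow> nat \<Rightarrow> real mat \<Rightarrow> complex" where
  "simple_root n i = (if i < n then (\<lambda>\<xi>. L n i \<xi> - L n (i + 1) \<xi>) else L n n)"

section \<open>The spin group and its exponential map\<close>

text \<open>
  The Clifford algebra of \<open>\<real>\<^sup>N\<close> with \<open>v \<cdot> v = - |v|\<^sup>2\<close>: an element is its coefficient function on
  the basis \<open>u\<^sub>A\<close>, the increasing product of the \<open>u\<^sub>i\<close> with \<open>i \<in> A\<close>, for \<open>A \<subseteq> {0, \<dots>, N - 1}\<close>.
  One has \<open>u\<^sub>A u\<^sub>B = cl_sign A B u\<^sub>C\<close> for the symmetric difference \<open>C\<close> of \<open>A\<close> and \<open>B\<close>: each pair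
  \<open>i > j\<close> costs a transposition, each pair \<open>i = j\<close> a square.
\<close>

type_synonym clifford = "nat set \<Rightarrow> real"

definition cl_sign :: "nat set \<Rightarrow> nat set \<Rightarrow> real" where
  "cl_sign A B = (\<Prod>i\<in>A. \<Prod>j\<in>B. if j \<le> i then - 1 else 1)"

definition cl_mult :: "nat \<Rightarrow> clifford \<Rightarrow> clifford \<Rightarrow> clifford" where
  "cl_mult N x y = (\<lambda>C. if C \<subseteq> {..<N}
     then \<Sum>A\<in>Pow {..<N}. cl_sign A (sym_diff A C) * x A * y (sym_diff A C) else 0)"

definition cl_basis :: "nat set \<Rightarrow> clifford" where
  "cl_basis A = (\<lambda>B. if B = A then 1 else 0)"

definition cl_exp :: "nat \<Rightarrow> clifford \<Rightarrow> clifford" where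
  "cl_exp N x = (\<lambda>A. \<Sum>m. (cl_mult N x ^^ m) (cl_basis {}) A / fact m)"

definition cl_grade :: "nat \<Rightarrow> nat \<Rightarrow> clifford set" where
  "cl_grade N k = {x. \<forall>A. x A \<noteq> 0 \<longrightarrow> A \<subseteq> {..<N} \<and> card A = k}"

definition Spin :: "nat \<Rightarrow> clifford monoid" where
  "Spin N = \<lparr>carrier = {foldr (cl_mult N) vs (cl_basis {}) | vs. even (length vs) \<and>
                 (\<forall>v\<in>set vs. v \<in> cl_grade N 1 \<and> (\<Sum>i<N. (v {i})\<^sup>2) = 1)},
              mult = cl_mult N, one = cl_basis {}\<rparr>"

text \<open>
  The Lie algebra of \<open>Spin N\<close> is \<open>cl_grade N 2\<close> with the commutator. The differential of the
  covering \<open>Spin N \<rightarrow> SO(N)\<close>, \<open>g \<mapsto> (v \<mapsto> g v g\<^sup>-\<^sup>1)\<close>, identifies it with \<open>so N\<close>; it sends \<open>b\<close> to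
  \<open>v \<mapsto> b v - v b\<close>.
\<close>

definition spin_diff :: "nat \<Rightarrow> clifford \<Rightarrow> real mat" where
  "spin_diff N b = mat N N (\<lambda>(r, c).
     cl_mult N b (cl_basis {c}) {r} - cl_mult N (cl_basis {c}) b {r})"

definition exp_Spin :: "nat \<Rightarrow> real mat \<Rightarrow> clifford" where
  "exp_Spin N \<xi> = cl_exp N (the_inv_into (cl_grade N 2) (spin_diff N) \<xi>)"

section \<open>Canonical elements\<close>

definition unit_lattice :: "nat \<Rightarrow> real mat set" where
  "unit_lattice n = {\<xi> \<in> torus n. exp_Spin (2 * n + 1) ((2 * pi) \<cdot>\<^sub>m \<xi>) = \<one>\<^bsub>Spin (2 * n + 1)\<^esub>}"

definition dominant_unit_lattice :: "nat \<Rightarrow> real mat set" where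
  "dominant_unit_lattice n =
     {\<xi> \<in> unit_lattice n. \<forall>\<alpha>\<in>positive_roots n. \<alpha> \<xi> / \<i> \<in> \<real>\<^sub>\<ge>\<^sub>0}"

definition eigenspace_ad :: "nat \<Rightarrow> real mat \<Rightarrow> int \<Rightarrow> complex mat set" where
  "eigenspace_ad n \<xi> j =
     {X \<in> so (2 * n + 1). bracket (cplx \<xi>) X = (\<i> * of_int j) \<cdot>\<^sub>m X}"

text \<open>
  Eigenspaces for distinct eigenvalues are independent, so the direct sum is the set of finite
  sums of eigenvectors.
\<close>

definition parabolic :: "nat \<Rightarrow> real mat \<Rightarrow> int \<Rightarrow> complex mat set" where
  "parabolic n \<xi> i =
     {mat_sum (2 * n + 1) X J | X J. finite J \<and> J \<subseteq> {..i} \<and> (\<forall>j\<in>J. X j \<in> eigenspace_ad n \<xi> j)}"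

definition lattice_le :: "nat \<Rightarrow> real mat \<Rightarrow> real mat \<Rightarrow> bool" where
  "lattice_le n \<xi> \<xi>' \<longleftrightarrow> (\<forall>i\<ge>0. parabolic n \<xi> i \<subseteq> parabolic n \<xi>' i)"

definition cone :: "nat \<Rightarrow> nat set \<Rightarrow> real mat set" where
  "cone n I = {mat_sum (2 * n + 1) (\<lambda>i. a i \<cdot>\<^sub>m H n i) {1..n} | a.
     \<forall>i\<in>{1..n}. 0 \<le> a i \<and> (a i = 0 \<longleftrightarrow> i \<notin> I)}"

definition canonical :: "nat \<Rightarrow> nat set \<Rightarrow> real mat \<Rightarrow> bool" where
  "canonical n I \<xi> \<longleftrightarrow> \<xi> \<in> dominant_unit_lattice n \<inter> cone n I \<and>
     (\<forall>\<xi>' \<in> dominant_unit_lattice n \<inter> cone n I. lattice_le n \<xi> \<xi>' \<longrightarrow> \<xi>' = \<xi>)"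

definition xi :: "nat \<Rightarrow> nat set \<Rightarrow> real mat" where
  "xi n I = mat_sum (2 * n + 1) (H n) I"

section \<open>Representations and the uniton number\<close>

text \<open>A representation of the complexified Lie algebra on \<open>\<complex>\<^sup>d\<close>.\<close>

definition lie_rep :: "nat \<Rightarrow> nat \<Rightarrow> (complex mat \<Rightarrow> complex mat) \<Rightarrow> bool" where
  "lie_rep n d \<rho> \<longleftrightarrow>
     (\<forall>X\<in>so (2 * n + 1). \<rho> X \<in> carrier_mat d d) \<and>
     (\<forall>X\<in>so (2 * n + 1). \<forall>Y\<in>so (2 * n + 1). \<rho> (X + Y) = \<rho> X + \<rho> Y) \<and>
     (\<forall>X\<in>so (2 * n + 1). \<forall>c. \<rho> (c \<cdot>\<^sub>m X) = c \<cdot>\<^sub>m \<rho> X) \<and>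
     (\<forall>X\<in>so (2 * n + 1). \<forall>Y\<in>so (2 * n + 1). \<rho> (bracket X Y) = bracket (\<rho> X) (\<rho> Y))"

definition irreducible_rep :: "nat \<Rightarrow> nat \<Rightarrow> (complex mat \<Rightarrow> complex mat) \<Rightarrow> bool" where
  "irreducible_rep n d \<rho> \<longleftrightarrow> lie_rep n d \<rho> \<and> d \<noteq> 0 \<and>
     (\<forall>W. subspace class_ring W (module_vec TYPE(complex) d) \<and>
          (\<forall>X\<in>so (2 * n + 1). \<forall>w\<in>W. \<rho> X *\<^sub>v w \<in> W) \<longrightarrow>
          W = {0\<^sub>v d} \<or> W = carrier_vec d)"

definition root_space :: "nat \<Rightarrow> (real mat \<Rightarrow> complex) \<Rightarrow> complex mat set" where
  "root_space n \<alpha> = {X \<in> so (2 * n + 1). \<forall>\<xi>\<in>torus n. bracket (cplx \<xi>) X = \<alpha> \<xi> \<cdot>\<^sub>m X}"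

definition weight_vector ::
  "nat \<Rightarrow> nat \<Rightarrow> (complex mat \<Rightarrow> complex mat) \<Rightarrow> (real mat \<Rightarrow> complex) \<Rightarrow> complex vec \<Rightarrow> bool" where
  "weight_vector n d \<rho> \<mu> v \<longleftrightarrow> v \<in> carrier_vec d \<and> v \<noteq> 0\<^sub>v d \<and>
     (\<forall>\<xi>\<in>torus n. \<rho> (cplx \<xi>) *\<^sub>v v = \<mu> \<xi> \<cdot>\<^sub>v v)"

text \<open>
  Weights are functionals on the torus; as functions of a matrix they are made unique by requiring
  them to be \<open>extensional\<close>.
\<close>

definition highest_weight ::
  "nat \<Rightarrow> nat \<Rightarrow> (complex mat \<Rightarrow> complex mat) \<Rightarrow> (real mat \<Rightarrow> complex) \<Rightarrow> bool" where
  "highest_weight n d \<rho> \<mu> \<longleftrightarrow> \<mu> \<in> extensional (torus n) \<and>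
     (\<exists>v. weight_vector n d \<rho> \<mu> v \<and>
          (\<forall>\<alpha>\<in>positive_roots n. \<forall>X\<in>root_space n \<alpha>. \<rho> X *\<^sub>v v = 0\<^sub>v d))"

definition lowest_weight ::
  "nat \<Rightarrow> nat \<Rightarrow> (complex mat \<Rightarrow> complex mat) \<Rightarrow> (real mat \<Rightarrow> complex) \<Rightarrow> bool" where
  "lowest_weight n d \<rho> \<mu> \<longleftrightarrow> \<mu> \<in> extensional (torus n) \<and>
     (\<exists>v. weight_vector n d \<rho> \<mu> v \<and>
          (\<forall>\<alpha>\<in>positive_roots n. \<forall>X\<in>root_space n (\<lambda>\<xi>. - \<alpha> \<xi>). \<rho> X *\<^sub>v v = 0\<^sub>v d))"

definition uniton_number :: "nat \<Rightarrow> nat \<Rightarrow> (complex mat \<Rightarrow> complex mat) \<Rightarrow> real mat \<Rightarrow> complex" where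
  "uniton_number n d \<rho> \<xi> =
     1 / \<i> * ((THE \<omega>. highest_weight n d \<rho> \<omega>) \<xi> - (THE \<omega>. lowest_weight n d \<rho> \<omega>) \<xi>)"

definition fundamental_weight :: "nat \<Rightarrow> nat \<Rightarrow> real mat \<Rightarrow> complex" where
  "fundamental_weight n k = (\<lambda>\<xi>\<in>torus n.
     if k < n then \<Sum>i=1..k. L n i \<xi> else 1 / 2 * (\<Sum>i=1..n. L n i \<xi>))"

text \<open>Being (isomorphic to) the representation \<open>\<rho>\<^sub>k\<close>.\<close>

definition fundamental_rep :: "nat \<Rightarrow> nat \<Rightarrow> nat \<Rightarrow> (complex mat \<Rightarrow> complex mat) \<Rightarrow> bool" where
  "fundamental_rep n k d \<rho> \<longleftrightarrow>
     irreducible_rep n d \<rho> \<and> highest_weight n d \<rho> (fundamental_weight n k)"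

section \<open>Consistency of the encoding\<close>

lemma L_E: "\<lbrakk>i \<in> {1..n}; j \<in> {1..n}\<rbrakk> \<Longrightarrow> L n i (E n j) = (if i = j then \<i> else 0)"
  by (auto simp: L_def E_def)

lemma mat_sum_index:
  fixes f :: "'i \<Rightarrow> 'a::comm_ring_1 mat"
  assumes "finite S" "\<And>i. i \<in> S \<Longrightarrow> f i \<in> carrier_mat N N"
  shows "mat_sum N f S \<in> carrier_mat N N"
    "r < N \<Longrightarrow> c < N \<Longrightarrow> mat_sum N f S $$ (r, c) = (\<Sum>i\<in>S. f i $$ (r, c))"
proof -
  interpret abelian_group "module_mat TYPE('a) N N" by (rule abelian_group_mat)
  have "mat_sum N f S \<in> carrier_mat N N \<and>
    (\<forall>r<N. \<forall>c<N. mat_sum N f S $$ (r, c) = (\<Sum>i\<in>S. f i $$ (r, c)))"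
    using assms
  proof (induction S rule: finite_induct)
    case empty
    then show ?case by (simp add: module_mat_simps)
  next
    case (insert i S)
    then have "mat_sum N f (insert i S) = f i + mat_sum N f S"
      by (subst finsum_insert) (auto simp: module_mat_simps)
    with insert show ?case by auto
  qed
  then show "mat_sum N f S \<in> carrier_mat N N"
    "r < N \<Longrightarrow> c < N \<Longrightarrow> mat_sum N f S $$ (r, c) = (\<Sum>i\<in>S. f i $$ (r, c))" by auto
qed

lemma L_H: "\<lbrakk>i \<in> {1..n}; j \<in> {1..n}\<rbrakk> \<Longrightarrow> L n i (H n j) = (if i \<le> j then \<i> else 0)"
proof -
  assume a: "i \<in> {1..n}" "j \<in> {1..n}"
  then have "H n j $$ (n + i - 1, i - 1) = (\<Sum>l=1..j. E n l $$ (n + i - 1, i - 1))"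
    unfolding H_def by (intro mat_sum_index(2)) (auto simp: E_def)
  also have "\<dots> = (\<Sum>l=1..j. if l = i then 1 else 0)"
    using a by (intro sum.cong) (auto simp: E_def)
  also have "\<dots> = (if i \<le> j then 1 else 0)" using a by auto
  finally show ?thesis by (simp add: L_def)
qed

lemma simple_root_H: "\<lbrakk>i \<in> {1..n}; j \<in> {1..n}\<rbrakk> \<Longrightarrow> simple_root n i (H n j) = (if i = j then \<i> else 0)"
  by (auto simp: simple_root_def L_H)

lemma E_isotropic_basis:
  assumes "i \<in> {1..n}" "k \<in> {1..2 * n + 1}"
  shows "cplx (E n i) *\<^sub>v isotropic_basis n k =
    (if k = i then \<i> else if k = n + i then - \<i> else 0) \<cdot>\<^sub>v isotropic_basis n k"
proof -
  define N where "N = 2 * n + 1"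
  define \<nu> where "\<nu> = (if k = i then \<i> else if k = n + i then - \<i> else 0)"
  define s where "s = complex_of_real (1 / sqrt 2)"
  define e where "e = isotropic_basis n k"
  obtain m where m: "i = Suc m" "m < n" using assms by (cases i) auto
  have eN: "e \<in> carrier_vec N"
    by (simp add: e_def isotropic_basis_def Let_def N_def)
  have dims: "dim_row (E n i) = N" "dim_col (E n i) = N" by (simp_all add: E_def N_def)
  have entry: "E n i $$ (r, c) = (if r = n + m \<and> c = m then 1 else if r = m \<and> c = n + m then - 1 else 0)"
    if "r < N" "c < N" for r c
    using that by (simp add: E_def N_def m(1))
  have Eu: "(cplx (E n i) *\<^sub>v e) $ r = (if r = n + m then e $ m else 0) - (if r = m then e $ (n + m) else 0)"
    if r: "r < N" for r
  proof -
    have "(cplx (E n i) *\<^sub>v e) $ r = (\<Sum>c\<in>{0..<N}. complex_of_real (E n i $$ (r, c)) * e $ c)"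
      using r eN dims by (simp add: scalar_prod_def row_def)
    also have "\<dots> = complex_of_real (E n i $$ (r, m)) * e $ m +
        complex_of_real (E n i $$ (r, n + m)) * e $ (n + m)"
    proof -
      have "n + m < N" "m < N" "m \<noteq> n + m" using m by (simp_all add: N_def)
      then have "(\<Sum>c\<in>{0..<N}. complex_of_real (E n i $$ (r, c)) * e $ c) =
          (\<Sum>c\<in>{m, n + m}. complex_of_real (E n i $$ (r, c)) * e $ c)"
        by (intro sum.mono_neutral_right) (auto simp: entry[OF r])
      then show ?thesis using \<open>m \<noteq> n + m\<close> by simp
    qed
    finally show ?thesis using m(2) by (simp add: entry[OF r] N_def)
  qed
  consider l where "k = Suc l" "l < n" | l where "k = Suc (n + l)" "l < n" | "k = 2 * n + 1"
  proof (cases "k \<le> n")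
    case True
    then show thesis using assms that(1)[of "k - 1"] by simp
  next
    case False
    then show thesis using assms that(2)[of "k - n - 1"] that(3) by (cases "k = 2 * n + 1") auto
  qed
  then have "(cplx (E n i) *\<^sub>v e) $ r = \<nu> * e $ r" if r: "r < N" for r
  proof cases
    case 1
    then have e: "e $ a = s * ((if a = l then 1 else 0) - \<i> * (if a = n + l then 1 else 0))" if "a < N" for a
      using that by (simp add: e_def isotropic_basis_def Let_def s_def unit_vec_def N_def)
    have "\<nu> = (if l = m then \<i> else 0)" using 1 m by (simp add: \<nu>_def)
    then show ?thesis unfolding Eu[OF r] using 1 m(2) r by (cases "l = m") (simp_all add: e N_def mult.left_commute[of "\<i>" s])
  next
    case 2
    then have e: "e $ a = s * ((if a = l then 1 else 0) + \<i> * (if a = n + l then 1 else 0))" if "a < N" for a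
      using that by (simp add: e_def isotropic_basis_def Let_def s_def unit_vec_def N_def)
    have "\<nu> = (if l = m then - \<i> else 0)" using 2 m by (simp add: \<nu>_def)
    then show ?thesis unfolding Eu[OF r] using 2 m(2) r by (cases "l = m") (simp_all add: e N_def mult.left_commute[of "\<i>" s])
  next
    case 3
    then have e: "e $ a = (if a = 2 * n then 1 else 0)" if "a < N" for a
      using that by (simp add: e_def isotropic_basis_def Let_def unit_vec_def N_def)
    have "\<nu> = 0" using 3 m by (simp add: \<nu>_def)
    then show ?thesis unfolding Eu[OF r] using m(2) r by (simp add: e N_def)
  qed
  then have "cplx (E n i) *\<^sub>v e = \<nu> \<cdot>\<^sub>v e"
    using eN dims by (intro eq_vecI) simp_all
  then show ?thesis by (simp only: e_def \<nu>_def)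
qed

lemma isotropic_basis_form:
  assumes "i \<in> {1..2 * n + 1}" "j \<in> {1..2 * n + 1}" "i \<le> j"
  shows "isotropic_basis n i \<bullet> isotropic_basis n j =
    (if i \<le> n \<and> j = n + i \<or> i = 2 * n + 1 then 1 else 0)"
proof -
  define N where "N = 2 * n + 1"
  define w :: "complex \<Rightarrow> nat \<Rightarrow> nat \<Rightarrow> complex vec" where
    "w y a b = complex_of_real (1 / sqrt 2) \<cdot>\<^sub>v (unit_vec N a + y \<cdot>\<^sub>v unit_vec N b)" for y a b
  have w_car: "w y a b \<in> carrier_vec N" for y a b by (simp add: w_def)
  have s: "complex_of_real (1 / sqrt 2) * complex_of_real (1 / sqrt 2) = 1/2"
    by (simp flip: of_real_mult)
  have wi: "w y a b $ c = complex_of_real (1 / sqrt 2) * ((if a = c then 1 else 0) + y * (if b = c then 1 else 0))"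
    if "c < N" for y a b c using that by (auto simp: w_def unit_vec_def)
  have wv: "w y a b \<bullet> v = complex_of_real (1 / sqrt 2) * (v $ a + y * v $ b)"
    if "v \<in> carrier_vec N" "a < N" "b < N" for y a b v
    using that by (simp add: w_def add_scalar_prod_distrib[of _ N])
  have ww: "w y a b \<bullet> w z c d = 1/2 * ((if a = c then 1 else 0) + z * (if a = d then 1 else 0)
      + y * ((if b = c then 1 else 0) + z * (if b = d then 1 else 0)))"
    if "a < N" "b < N" "c < N" "d < N" for a b c d y z
    unfolding wv[OF w_car that(1,2)] wi[OF that(1)] wi[OF that(2)] s[symmetric]
    by (simp add: algebra_simps del: of_real_divide)
  have u: "isotropic_basis n k = (if k \<le> n then w (- \<i>) (k - 1) (n + k - 1)
      else if k \<le> 2 * n then w \<i> (k - n - 1) (k - 1) else unit_vec N (2 * n))" for k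
    by (auto simp: isotropic_basis_def Let_def w_def N_def)
  have l: "isotropic_basis n (2 * n + 1) = unit_vec N (2 * n)" by (simp add: u)
  consider "j \<le> 2 * n" | "j = 2 * n + 1" "i \<le> 2 * n" | "j = 2 * n + 1" "i = 2 * n + 1"
    using assms by force
  then show ?thesis
  proof cases
    case 1
    have lt: "i \<le> n \<Longrightarrow> i - 1 < N" "i \<le> n \<Longrightarrow> n + i - 1 < N" "j \<le> n \<Longrightarrow> j - 1 < N" "j \<le> n \<Longrightarrow> n + j - 1 < N"
      "i - n - 1 < N" "i - 1 < N" "j - n - 1 < N" "j - 1 < N"
      using assms 1 by (auto simp: N_def)
    consider "j \<le> n" | "i \<le> n" "n < j" | "n < i" using assms by linarith
    then show ?thesis
    proof cases
      case a: 1
      then have "i \<le> n" using assms by simp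
      moreover have "i - 1 \<noteq> n + j - 1" "n + i - 1 \<noteq> j - 1" "n + i - 1 = n + j - 1 \<longleftrightarrow> i - 1 = j - 1"
        using a assms by auto
      moreover have "j \<noteq> n + i" "i \<noteq> 2 * n + 1" using a assms by auto
      ultimately show ?thesis using a lt unfolding u by (simp add: ww lt del: One_nat_def)
    next
      case a: 2
      have "i - 1 = j - n - 1 \<longleftrightarrow> j = n + i" "n + i - 1 = j - 1 \<longleftrightarrow> j = n + i"
         "i - 1 \<noteq> j - 1" "n + i - 1 \<noteq> j - n - 1" using a 1 assms by auto
      with a 1 assms lt show ?thesis unfolding u by (simp add: ww lt del: One_nat_def)
    next
      case a: 3
      have "i - 1 \<noteq> j - n - 1" "j - 1 \<noteq> i - n - 1"  "i - n - 1 = j - n - 1 \<longleftrightarrow> i = j" "i - 1 = j - 1 \<longleftrightarrow> i = j"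
        using a 1 assms by auto
      with a 1 assms lt show ?thesis unfolding u by (simp add: ww lt del: One_nat_def)
    qed
  next
    case 2
    have "isotropic_basis n i \<bullet> unit_vec N (2 * n) = 0"
    proof (cases "i \<le> n")
      case True
      have "i - 1 < N" "n + i - 1 < N" "2 * n < N" "i - 1 \<noteq> 2 * n" "n + i - 1 \<noteq> 2 * n"
        using True assms by (auto simp: N_def)
      with True show ?thesis by (simp add: u wv unit_vec_def del: One_nat_def)
    next
      case False
      have "i - n - 1 < N" "i - 1 < N" "2 * n < N" "i - 1 \<noteq> 2 * n" "i - n - 1 \<noteq> 2 * n"
        using False 2 assms by (auto simp: N_def)
      with False 2 show ?thesis by (simp add: u wv unit_vec_def del: One_nat_def)
    qed
    with 2 assms show ?thesis unfolding 2 l by auto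
  next
    case 3
    then show ?thesis unfolding 3 l by (simp add: N_def)
  qed
qed

lemma sign_prod_sym_diff:
  fixes f :: "'a \<Rightarrow> real"
  assumes "finite A" "finite B" "\<And>i. f i * f i = 1"
  shows "prod f (sym_diff A B) = prod f A * prod f B"
proof -
  have sq: "prod f (A \<inter> B) * prod f (A \<inter> B) = 1"
    by (simp add: assms(3) flip: prod.distrib)
  have "prod f A = prod f (A - B) * prod f (A \<inter> B)" "prod f B = prod f (B - A) * prod f (A \<inter> B)"
    using assms by (metis prod.Int_Diff mult.commute inf_commute)+
  moreover have "prod f (sym_diff A B) = prod f (A - B) * prod f (B - A)"
    using assms by (intro prod.union_disjoint) auto
  ultimately show ?thesis using sq by (simp add: mult.assoc mult.left_commute)
qed

lemma cl_sign_sym_diff: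
  assumes "finite A" "finite B" "finite C"
  shows "cl_sign (sym_diff A B) C = cl_sign A C * cl_sign B C"
    and "cl_sign C (sym_diff A B) = cl_sign C A * cl_sign C B"
proof -
  define s :: "nat \<Rightarrow> nat \<Rightarrow> real" where "s i j = (if j \<le> i then - 1 else 1)" for i j
  have s: "s i j * s i j = 1" for i j by (simp add: s_def)
  have s2: "(\<Prod>j\<in>B. s i j) * (\<Prod>j\<in>B. s i j) = 1" for i B
    by (simp only: s prod.neutral_const flip: prod.distrib)
  have sign: "cl_sign A B = (\<Prod>i\<in>A. \<Prod>j\<in>B. s i j)" for A B
    by (simp add: cl_sign_def s_def)
  show "cl_sign (sym_diff A B) C = cl_sign A C * cl_sign B C"
    unfolding sign by (rule sign_prod_sym_diff[OF assms(1,2) s2])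
  show "cl_sign C (sym_diff A B) = cl_sign C A * cl_sign C B"
    unfolding sign sign_prod_sym_diff[OF assms(1,2) s] by (rule prod.distrib)
qed

lemma cl_mult_assoc: "cl_mult N (cl_mult N x y) z = cl_mult N x (cl_mult N y z)"
proof
  fix C
  show "cl_mult N (cl_mult N x y) z C = cl_mult N x (cl_mult N y z) C"
  proof (cases "C \<subseteq> {..<N}")
    case C: True
    let ?P = "Pow {..<N}"
    have "cl_mult N (cl_mult N x y) z C = (\<Sum>A\<in>?P. \<Sum>B\<in>?P. cl_sign A (sym_diff A C) *
        cl_sign B (sym_diff B A) * x B * y (sym_diff B A) * z (sym_diff A C))"
      using C by (simp add: cl_mult_def sum_distrib_left sum_distrib_right mult_ac)
    also have "\<dots> = (\<Sum>B\<in>?P. \<Sum>A\<in>?P. cl_sign A (sym_diff A C) *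
        cl_sign B (sym_diff B A) * x B * y (sym_diff B A) * z (sym_diff A C))"
      by (rule sum.swap)
    also have "\<dots> = (\<Sum>B\<in>?P. \<Sum>D\<in>?P. cl_sign B (sym_diff B C) * x B *
        (cl_sign D (sym_diff D (sym_diff B C)) * y D * z (sym_diff D (sym_diff B C))))"
    proof (rule sum.cong[OF refl])
      fix B assume B: "B \<in> ?P"
      show "(\<Sum>A\<in>?P. cl_sign A (sym_diff A C) *
        cl_sign B (sym_diff B A) * x B * y (sym_diff B A) * z (sym_diff A C)) =
       (\<Sum>D\<in>?P. cl_sign B (sym_diff B C) * x B *
        (cl_sign D (sym_diff D (sym_diff B C)) * y D * z (sym_diff D (sym_diff B C))))"
      proof (rule sum.reindex_bij_witness[where i = "\<lambda>D. sym_diff B D" and j = "\<lambda>A. sym_diff B A"])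
        fix A assume A: "A \<in> ?P"
        define D where "D = sym_diff B A"
        define R where "R = sym_diff A C"
        have DR: "A = sym_diff B D" "sym_diff B C = sym_diff D R"
          "sym_diff D (sym_diff D R) = R" "sym_diff B (sym_diff B D) = D"
          unfolding D_def R_def by blast+
        have f: "finite B" "finite D" "finite R" using A B C by (auto simp: D_def R_def intro: finite_subset)
        have "cl_sign A R * cl_sign B D = cl_sign B (sym_diff D R) * cl_sign D R"
          unfolding DR(1) using f by (simp add: cl_sign_sym_diff)
        then show "cl_sign B (sym_diff B C) * x B *
          (cl_sign (sym_diff B A) (sym_diff (sym_diff B A) (sym_diff B C)) * y (sym_diff B A) *
             z (sym_diff (sym_diff B A) (sym_diff B C))) =
          cl_sign A (sym_diff A C) * cl_sign B (sym_diff B A) * x B * y (sym_diff B A) * z (sym_diff A C)"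
          unfolding D_def[symmetric] R_def[symmetric] DR(2,3) by (simp add: mult_ac)
      qed (use B in blast)+
    qed
    also have "\<dots> = cl_mult N x (cl_mult N y z) C"
      unfolding cl_mult_def using C
      by (auto simp: sum_distrib_left intro!: sum.cong)
    finally show ?thesis .
  qed (simp add: cl_mult_def)
qed

lemma cl_mult_basis:
  assumes "B \<subseteq> {..<N}" "C \<subseteq> {..<N}"
  shows "cl_mult N x (cl_basis B) C = cl_sign (sym_diff C B) B * x (sym_diff C B)"
    and "cl_mult N (cl_basis B) x C = cl_sign B (sym_diff B C) * x (sym_diff B C)"
proof -
  have *: "sym_diff A C = B \<longleftrightarrow> A = sym_diff C B" for A by blast
  have B: "sym_diff (sym_diff C B) C = B" by blast
  have "cl_mult N x (cl_basis B) C =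
    (\<Sum>A\<in>Pow {..<N}. if A = sym_diff C B then cl_sign A B * x A else 0)"
    unfolding cl_mult_def cl_basis_def * using assms B
    by (simp add: if_distrib[of "\<lambda>t. _ * t"] cong: if_cong)
  also have "\<dots> = cl_sign (sym_diff C B) B * x (sym_diff C B)"
    using assms by (subst sum.delta) auto
  finally show "cl_mult N x (cl_basis B) C = cl_sign (sym_diff C B) B * x (sym_diff C B)" .
  have "cl_mult N (cl_basis B) x C =
    (\<Sum>A\<in>Pow {..<N}. if A = B then cl_sign A (sym_diff A C) * x (sym_diff A C) else 0)"
    unfolding cl_mult_def cl_basis_def using assms
    by (simp only: if_True) (intro sum.cong refl, simp)
  also have "\<dots> = cl_sign B (sym_diff B C) * x (sym_diff B C)"
    using assms by (subst sum.delta) auto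
  finally show "cl_mult N (cl_basis B) x C = cl_sign B (sym_diff B C) * x (sym_diff B C)" .
qed

lemma cl_basis_relation:
  assumes "i < N" "j < N"
  shows "cl_mult N (cl_basis {i}) (cl_basis {j}) A + cl_mult N (cl_basis {j}) (cl_basis {i}) A
    = (if i = j then - 2 * cl_basis {} A else 0)"
proof (cases "A \<subseteq> {..<N}")
  case True
  have *: "cl_mult N (cl_basis {a}) (cl_basis {b}) A =
      (if A = sym_diff {a} {b} then cl_sign {a} {b} else 0)" if "a < N" "b < N" for a b
  proof -
    have "sym_diff A {b} = {a} \<longleftrightarrow> A = sym_diff {a} {b}" by blast
    then have "cl_basis {a} (sym_diff A {b}) = (if A = sym_diff {a} {b} then 1 else 0)"
      by (simp only: cl_basis_def)
    moreover have "sym_diff (sym_diff {a} {b}) {b} = {a}" by blast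
    ultimately show ?thesis
      using that True cl_mult_basis(1)[of "{b}" N A "cl_basis {a}"]
      by (cases "A = sym_diff {a} {b}") (simp_all only: if_True if_False mult_1_right mult_zero_right, auto)
  qed
  have "sym_diff {i} {j} = sym_diff {j} {i}" by blast
  with assms show ?thesis unfolding *[OF assms] *[OF assms(2,1)]
    by (cases "i = j") (auto simp: cl_sign_def cl_basis_def)
next
  case False
  then have "A \<noteq> {}" by auto
  with False show ?thesis by (simp add: cl_mult_def cl_basis_def)
qed

lemma spin_diff_index:
  assumes "b \<in> cl_grade N 2" "r < N" "c < N"
  shows "spin_diff N b $$ (r, c) =
    (if r = c then 0 else if c < r then 2 * b {r, c} else - 2 * b {r, c})"
proof -
  have *: "spin_diff N b $$ (r, c) = cl_sign (sym_diff {r} {c}) {c} * b (sym_diff {r} {c})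
      - cl_sign {c} (sym_diff {c} {r}) * b (sym_diff {c} {r})"
    unfolding spin_diff_def using assms by (simp add: cl_mult_basis)
  show ?thesis
  proof (cases "r = c")
    case True
    moreover have "b {} = 0" using assms by (auto simp: cl_grade_def)
    ultimately show ?thesis using * by simp
  next
    case False
    then have "sym_diff {r} {c} = {r, c}" "sym_diff {c} {r} = {r, c}" by blast+
    with False show ?thesis unfolding * by (simp add: cl_sign_def)
  qed
qed

lemma spin_diff_bij: "bij_betw (spin_diff N) (cl_grade N 2) (so N)"
proof (intro bij_betw_imageI)
  show "inj_on (spin_diff N) (cl_grade N 2)"
  proof (intro inj_onI ext)
    fix b b' A
    assume b: "b \<in> cl_grade N 2" "b' \<in> cl_grade N 2" and eq: "spin_diff N b = spin_diff N b'"
    show "b A = b' A"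
    proof (cases "A \<subseteq> {..<N} \<and> card A = 2")
      case True
      then obtain r c where "A = {r, c}" "c < r"
        by (metis card_2_iff insert_commute linorder_neqE_nat)
      with True show ?thesis
        using spin_diff_index[OF b(1), of r c] spin_diff_index[OF b(2), of r c] eq by simp
    next
      case False
      then have "b A = 0" "b' A = 0" using b unfolding cl_grade_def by blast+
      then show ?thesis by simp
    qed
  qed
  show "spin_diff N ` cl_grade N 2 = so N"
  proof (intro equalityI subsetI)
    fix X :: "real mat" assume "X \<in> spin_diff N ` cl_grade N 2"
    then obtain b where b: "b \<in> cl_grade N 2" "X = spin_diff N b" by auto
    then have car: "X \<in> carrier_mat N N" by (simp add: spin_diff_def)
    have "transpose_mat X = - X"
    proof (rule eq_matI)
      fix r c assume "r < dim_row (- X)" "c < dim_col (- X)"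
      with car have rc: "r < N" "c < N" by auto
      have "{r, c} = {c, r}" by blast
      then show "transpose_mat X $$ (r, c) = (- X) $$ (r, c)"
        using rc car b(2) spin_diff_index[OF b(1) rc] spin_diff_index[OF b(1) rc(2,1)] by simp
    qed (use car in simp_all)
    with car show "X \<in> so N" by (simp add: so_def)
  next
    fix X :: "real mat" assume X: "X \<in> so N"
    then have car: "X \<in> carrier_mat N N" and t: "transpose_mat X = - X" by (auto simp: so_def)
    have skew: "X $$ (c, r) = - X $$ (r, c)" if "r < N" "c < N" for r c
      using arg_cong[OF t, of "\<lambda>M. M $$ (r, c)"] that car by auto
    define b where "b A = (if A \<subseteq> {..<N} \<and> card A = 2 then X $$ (Max A, Min A) / 2 else 0)" for A
    have b: "b \<in> cl_grade N 2" by (auto simp: cl_grade_def b_def)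
    have "spin_diff N b = X"
    proof (intro eq_matI)
      fix r c assume "r < dim_row X" "c < dim_col X"
      with car have rc: "r < N" "c < N" by auto
      show "spin_diff N b $$ (r, c) = X $$ (r, c)"
        using skew[OF rc] skew[of r r] rc unfolding spin_diff_index[OF b rc] by (auto simp: b_def)
    qed (use car in \<open>auto simp: spin_diff_def\<close>)
    with b show "X \<in> spin_diff N ` cl_grade N 2" by blast
  qed
qed

end

theory Submission
  imports Defs "Jordan_Normal_Form.Char_Poly"
begin

text \<open>
  Write \<open>\<xi> = \<Sum> m\<^sub>i H\<^sub>i = \<Sum> a\<^sub>i E\<^sub>i\<close>, so that \<open>a\<^sub>i = m\<^sub>i + \<dots> + m\<^sub>n\<close>. Both halves of the theorem are read off
  from these coordinates.

  Canonical elements. In the Clifford algebra, \<open>2 \<pi> \<xi>\<close> lifts to the sum of the \<open>\<pi> a\<^sub>i u\<^sub>i u\<^sub>n\<^sub>+\<^sub>i\<close>. The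
  bivectors \<open>u\<^sub>i u\<^sub>n\<^sub>+\<^sub>i\<close> commute and have square \<open>- 1\<close>, so the exponential is the product of the factors
  \<open>cos (\<pi> a\<^sub>i) + sin (\<pi> a\<^sub>i) u\<^sub>i u\<^sub>n\<^sub>+\<^sub>i\<close>. It is \<open>1\<close> iff all \<open>a\<^sub>i\<close> are integers and their sum, which is
  \<open>\<Sum> i m\<^sub>i\<close>, is even (\<open>tor_in_unit_lattice_iff\<close>). Hence the dominant lattice points in the cone of \<open>I\<close>
  are the vectors \<open>m\<close> of natural numbers with support \<open>I\<close> and \<open>\<Sum> i m\<^sub>i\<close> even. The Lie algebra is
  spanned by the torus and the root vectors, and the eigenvalue of \<open>ad \<xi>\<close> on the root space of \<open>\<alpha>\<close> is
  \<open>\<i>\<close> times a combination of the \<open>m\<^sub>i\<close> whose coefficients all have the sign of \<open>\<alpha>\<close>; therefore \<open>\<xi>\<close> lies below \<open>\<xi>'\<close> 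
  iff \<open>m' \<le> m\<close> coordinatewise (\<open>lattice_le_simple_coords_iff\<close>), and canonical elements are minimal vectors
  \<open>m\<close>. The smallest vector with support \<open>I\<close> is the indicator of \<open>I\<close>, which wins if it is admissible. If
  it is not, every admissible \<open>m\<close> exceeds it at some odd \<open>j\<close> in \<open>I\<close>, by parity, and adding \<open>1\<close> at one
  odd \<open>j\<close> is enough.

  Uniton numbers. The Weyl group of \<open>B\<^sub>n\<close> contains \<open>- 1\<close>, so the lowest weight of an irreducible
  representation with highest weight \<open>\<omega>\<close> is \<open>- \<omega>\<close> and its uniton number is \<open>2 \<omega>(\<xi>) / \<i>\<close>
  (\<open>uniton_number_eq\<close>). The part of the Weyl group that is needed acts by changing the sign of one
  coordinate of a weight. That this preserves the set of weights follows from the representation theory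
  of the \<open>sl(2)\<close> attached to the short root \<open>L\<^sub>i\<close> (\<open>sl2_reflection\<close>). So \<open>- \<omega>\<close> is a weight. If a vector
  of this weight were not killed by a root vector of a negative root \<open>- \<alpha>\<close>, then \<open>- \<omega> - \<alpha>\<close>, hence also
  \<open>\<omega> + \<alpha>\<close>, would be a weight. But an irreducible representation is generated from its highest weight
  vector by the root vectors of negative roots alone, so no weight lies above \<open>\<omega>\<close>
  (\<open>extremal_weight_bound\<close>). The same bound shows that highest and lowest weights are unique. It remains
  to evaluate \<open>\<omega>\<close>, where \<open>a\<^sub>i\<close> is the number of elements of \<open>I\<close> that are at least \<open>i\<close>, plus \<open>1\<close> if
  \<open>H\<^sub>j\<close> is added and \<open>i \<le> j\<close>.
\<close>

text \<open>Keeps the dimension \<open>2 * n + 1\<close> from being rewritten to a successor.\<close>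

declare One_nat_def [simp del]

section \<open>Coordinates on the torus\<close>

definition tor :: "nat \<Rightarrow> (nat \<Rightarrow> real) \<Rightarrow> real mat" where
  "tor n a = mat_sum (2 * n + 1) (\<lambda>i. a i \<cdot>\<^sub>m E n i) {1..n}"

lemma torus_eq_range_tor: "torus n = range (tor n)"
  by (auto simp: torus_def tor_def)

lemma tor_carrier [simp]: "tor n a \<in> carrier_mat (2 * n + 1) (2 * n + 1)"
  unfolding tor_def by (intro mat_sum_index(1)) (auto simp: E_def)

lemma tor_index:
  assumes "r < 2 * n + 1" "c < 2 * n + 1"
  shows "tor n a $$ (r, c) =
    (if c < n \<and> r = n + c then a (Suc c) else if r < n \<and> c = n + r then - a (Suc r) else 0)"
proof -
  have "tor n a $$ (r, c) = (\<Sum>i=1..n. (a i \<cdot>\<^sub>m E n i) $$ (r, c))"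
    unfolding tor_def using assms by (intro mat_sum_index(2)) (auto simp: E_def)
  also have "\<dots> = (\<Sum>i=1..n. (if i = Suc c then (if r = n + c then a i else 0) else 0) +
      (if i = Suc r then (if c = n + r then - a i else 0) else 0))"
  proof (rule sum.cong[OF refl])
    fix i assume i: "i \<in> {1..n}"
    then have "r = n + i - 1 \<and> c = i - 1 \<longleftrightarrow> i = Suc c \<and> r = n + c"
       "r = i - 1 \<and> c = n + i - 1 \<longleftrightarrow> i = Suc r \<and> c = n + r" by auto
    moreover have "\<not> (i = Suc c \<and> r = n + c \<and> i = Suc r \<and> c = n + r)" using i by auto
    ultimately show "(a i \<cdot>\<^sub>m E n i) $$ (r, c) =
        (if i = Suc c then (if r = n + c then a i else 0) else 0) +
        (if i = Suc r then (if c = n + r then - a i else 0) else 0)"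
      using assms i by (simp add: E_def)
  qed
  also have "\<dots> = (if c < n \<and> r = n + c then a (Suc c) else if r < n \<and> c = n + r then - a (Suc r) else 0)"
    using assms by (simp add: sum.distrib Suc_le_eq)
  finally show ?thesis .
qed

lemma tor_cong: "(\<And>i. i \<in> {1..n} \<Longrightarrow> a i = b i) \<Longrightarrow> tor n a = tor n b"
  using carrier_matD[OF tor_carrier[of n a]] carrier_matD[OF tor_carrier[of n b]]
  by (intro eq_matI) (auto simp: tor_index)

lemma smult_tor: "c \<cdot>\<^sub>m tor n a = tor n (\<lambda>i. c * a i)"
  using carrier_matD[OF tor_carrier[of n a]] carrier_matD[OF tor_carrier[of n "\<lambda>i. c * a i"]]
  by (intro eq_matI) (auto simp: tor_index)

lemma tor_add: "tor n a + tor n b = tor n (\<lambda>i. a i + b i)"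
  using carrier_matD[OF tor_carrier[of n a]] carrier_matD[OF tor_carrier[of n b]]
    carrier_matD[OF tor_carrier[of n "\<lambda>i. a i + b i"]]
  by (intro eq_matI) (auto simp: tor_index)

lemma mat_sum_tor:
  assumes "finite S" "\<And>s. s \<in> S \<Longrightarrow> X s = tor n (f s)"
  shows "mat_sum (2 * n + 1) X S = tor n (\<lambda>i. \<Sum>s\<in>S. f s i)"
proof (rule eq_matI)
  have car: "X s \<in> carrier_mat (2 * n + 1) (2 * n + 1)" if "s \<in> S" for s using assms that by simp
  fix r c assume "r < dim_row (tor n (\<lambda>i. \<Sum>s\<in>S. f s i))" "c < dim_col (tor n (\<lambda>i. \<Sum>s\<in>S. f s i))"
  then have rc: "r < 2 * n + 1" "c < 2 * n + 1" using carrier_matD[OF tor_carrier[of n "\<lambda>i. \<Sum>s\<in>S. f s i"]] by auto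
  have "mat_sum (2 * n + 1) X S $$ (r, c) = (\<Sum>s\<in>S. tor n (f s) $$ (r, c))"
    using mat_sum_index(2)[OF assms(1) car rc] assms(2) by simp
  also have "\<dots> = tor n (\<lambda>i. \<Sum>s\<in>S. f s i) $$ (r, c)"
    using rc by (auto simp: tor_index sum_negf)
  finally show "mat_sum (2 * n + 1) X S $$ (r, c) = tor n (\<lambda>i. \<Sum>s\<in>S. f s i) $$ (r, c)" .
next
  have car: "X s \<in> carrier_mat (2 * n + 1) (2 * n + 1)" if "s \<in> S" for s using assms that by simp
  note S = carrier_matD[OF mat_sum_index(1)[OF assms(1) car]]
  note t = carrier_matD[OF tor_carrier[of n "\<lambda>i. \<Sum>s\<in>S. f s i"]]
  show "dim_row (mat_sum (2 * n + 1) X S) = dim_row (tor n (\<lambda>i. \<Sum>s\<in>S. f s i))"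
    "dim_col (mat_sum (2 * n + 1) X S) = dim_col (tor n (\<lambda>i. \<Sum>s\<in>S. f s i))"
    using S t by auto
qed

lemma E_eq_tor: "i \<in> {1..n} \<Longrightarrow> E n i = tor n (\<lambda>j. if j = i then 1 else 0)"
proof (rule eq_matI)
  let ?t = "tor n (\<lambda>j. if j = i then 1 else 0)"
  note t = carrier_matD[OF tor_carrier[of n "\<lambda>j. if j = i then 1 else 0"]]
  assume "i \<in> {1..n}"
  then obtain m where m: "i = Suc m" "m < n" by (cases i) auto
  fix r c assume "r < dim_row ?t" "c < dim_col ?t"
  with t have rc: "r < 2 * n + 1" "c < 2 * n + 1" by auto
  show "E n i $$ (r, c) = ?t $$ (r, c)"
    unfolding tor_index[OF rc] unfolding E_def m(1) using rc m(2) by simp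
qed (use carrier_matD[OF tor_carrier[of n "\<lambda>j. if j = i then 1 else 0"]] in \<open>auto simp: E_def\<close>)

lemma H_eq_tor: "j \<in> {1..n} \<Longrightarrow> H n j = tor n (\<lambda>i. if i \<le> j then 1 else 0)"
proof -
  assume j: "j \<in> {1..n}"
  have "H n j = tor n (\<lambda>i. \<Sum>s=1..j. if i = s then 1 else 0)"
    unfolding H_def using j by (intro mat_sum_tor) (auto simp: E_eq_tor)
  also have "\<dots> = tor n (\<lambda>i. if i \<le> j then 1 else 0)"
    by (intro tor_cong) auto
  finally show ?thesis .
qed

lemma L_tor: "i \<in> {1..n} \<Longrightarrow> L n i (tor n a) = \<i> * of_real (a i)"
  by (auto simp: L_def tor_index)

lemma positive_root_cases:
  assumes "\<alpha> \<in> positive_roots n"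
  obtains i j where "i \<in> {1..n}" "j \<in> {1..n}" "i < j" "\<alpha> = (\<lambda>\<xi>. L n i \<xi> - L n j \<xi>)"
  | i j where "i \<in> {1..n}" "j \<in> {1..n}" "i < j" "\<alpha> = (\<lambda>\<xi>. L n i \<xi> + L n j \<xi>)"
  | i where "i \<in> {1..n}" "\<alpha> = L n i"
proof -
  from assms consider
      i j where "1 \<le> i" "i < j" "j \<le> n" "\<alpha> = (\<lambda>\<xi>. L n i \<xi> - L n j \<xi>)"
    | i j where "1 \<le> i" "i < j" "j \<le> n" "\<alpha> = (\<lambda>\<xi>. L n i \<xi> + L n j \<xi>)"
    | i where "1 \<le> i" "i \<le> n" "\<alpha> = L n i"
    unfolding positive_roots_def by blast
  then show thesis by cases (rule that; auto)+
qed

lemma positive_rootI: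
  "\<lbrakk>1 \<le> i; i < j; j \<le> n\<rbrakk> \<Longrightarrow> (\<lambda>\<xi>. L n i \<xi> - L n j \<xi>) \<in> positive_roots n"
  "\<lbrakk>1 \<le> i; i < j; j \<le> n\<rbrakk> \<Longrightarrow> (\<lambda>\<xi>. L n i \<xi> + L n j \<xi>) \<in> positive_roots n"
  "\<lbrakk>1 \<le> i; i \<le> n\<rbrakk> \<Longrightarrow> L n i \<in> positive_roots n"
  unfolding positive_roots_def by blast+

lemma positive_root_tor:
  assumes "\<alpha> \<in> positive_roots n"
  shows "\<alpha> (tor n a) = (\<Sum>j=1..n. of_real (a j) * \<alpha> (E n j))"
proof -
  have L: "L n i (tor n a) = (\<Sum>j=1..n. of_real (a j) * L n i (E n j))" if "i \<in> {1..n}" for i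
  proof -
    have "(\<Sum>j=1..n. of_real (a j) * L n i (E n j)) = (\<Sum>j=1..n. if j = i then \<i> * of_real (a i) else 0)"
      using that by (intro sum.cong) (auto simp: L_E)
    with that show ?thesis by (simp add: L_tor)
  qed
  from assms show ?thesis
    by (cases rule: positive_root_cases) (simp_all add: L algebra_simps sum.distrib sum_subtractf)
qed

text \<open>
  The element \<open>\<Sum> m\<^sub>j H\<^sub>j\<close>: the coordinate at \<open>E\<^sub>i\<close> collects the \<open>m\<^sub>j\<close> with \<open>i \<le> j\<close>.
\<close>

definition simple_coords :: "nat \<Rightarrow> (nat \<Rightarrow> real) \<Rightarrow> real mat" where
  "simple_coords n m = tor n (\<lambda>i. \<Sum>j=i..n. m j)"

lemma simple_coords_torus: "simple_coords n a \<in> torus n"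
  by (simp add: simple_coords_def torus_eq_range_tor)

lemma mat_sum_H:
  "mat_sum (2 * n + 1) (\<lambda>i. a i \<cdot>\<^sub>m H n i) {1..n} = simple_coords n a"
proof -
  have "mat_sum (2 * n + 1) (\<lambda>i. a i \<cdot>\<^sub>m H n i) {1..n} = tor n (\<lambda>i. \<Sum>j=1..n. a j * (if i \<le> j then 1 else 0))"
    by (intro mat_sum_tor) (auto simp: H_eq_tor smult_tor)
  also have "\<dots> = simple_coords n a"
    unfolding simple_coords_def
  proof (intro tor_cong)
    fix i assume "i \<in> {1..n}"
    have "(\<Sum>j=1..n. a j * (if i \<le> j then 1 else 0)) = (\<Sum>j=1..n. if i \<le> j then a j else 0)"
      by (intro sum.cong) auto
    also have "\<dots> = (\<Sum>j\<in>{j \<in> {1..n}. i \<le> j}. a j)" by (rule sum.inter_filter[symmetric]) simp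
    also have "{j \<in> {1..n}. i \<le> j} = {i..n}" using \<open>i \<in> {1..n}\<close> by auto
    finally show "(\<Sum>j=1..n. a j * (if i \<le> j then 1 else 0)) = (\<Sum>j=i..n. a j)" .
  qed
  finally show ?thesis .
qed

text \<open>
  A positive root is a combination of simple roots with natural coefficients. This positivity drives
  both the dominance of the lattice points in a cone and the comparison of eigenvalues of \<open>ad\<close>.
\<close>

lemma positive_root_simple_coords:
  assumes "\<alpha> \<in> positive_roots n"
  shows "\<exists>c :: nat \<Rightarrow> nat. \<forall>a. \<alpha> (simple_coords n a) = \<i> * of_real (\<Sum>l=1..n. real (c l) * a l)"
proof -
  let ?c = "\<lambda>i l. if i \<le> l then 1 else 0 :: nat"
  have L: "L n i (simple_coords n a) = \<i> * of_real (\<Sum>l=1..n. real (?c i l) * a l)" if "i \<in> {1..n}" for i a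
  proof -
    have "(\<Sum>l=i..n. a l) = (\<Sum>l\<in>{l \<in> {1..n}. i \<le> l}. a l)" using that by (intro sum.cong) auto
    also have "\<dots> = (\<Sum>l=1..n. if i \<le> l then a l else 0)" by (rule sum.inter_filter) simp
    also have "\<dots> = (\<Sum>l=1..n. real (?c i l) * a l)" by (intro sum.cong) auto
    finally show ?thesis using that by (simp add: simple_coords_def L_tor)
  qed
  from assms show ?thesis
  proof (cases rule: positive_root_cases)
    case (1 i j)
    have "(\<Sum>l=1..n. real (?c i l) * a l) - (\<Sum>l=1..n. real (?c j l) * a l) = (\<Sum>l=1..n. real (?c i l - ?c j l) * a l)" for a
      unfolding sum_subtractf[symmetric] using 1 by (intro sum.cong) auto
    with 1 show ?thesis by (intro exI[of _ "\<lambda>l. ?c i l - ?c j l"]) (simp only: L of_real_diff[symmetric] right_diff_distrib[symmetric] simp_thms)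
  next
    case (2 i j)
    have "(\<Sum>l=1..n. real (?c i l) * a l) + (\<Sum>l=1..n. real (?c j l) * a l) = (\<Sum>l=1..n. real (?c i l + ?c j l) * a l)" for a
      unfolding sum.distrib[symmetric] by (intro sum.cong) (auto simp: algebra_simps)
    with 2 show ?thesis by (intro exI[of _ "\<lambda>l. ?c i l + ?c j l"]) (simp only: L of_real_add[symmetric] distrib_left[symmetric] simp_thms)
  next
    case (3 i)
    then show ?thesis by (intro exI[of _ "?c i"]) (simp only: L simp_thms)
  qed
qed

lemma simple_root_simple_coords:
  assumes "k \<in> {1..n}"
  shows "simple_root n k (simple_coords n a) = \<i> * of_real (a k)"
proof (cases "k < n")
  case True
  then have "{k..n} = insert k {k + 1..n}" using assms by auto
  then have "(\<Sum>l=k..n. a l) = a k + (\<Sum>l=k + 1..n. a l)" by (simp del: Suc_eq_plus1)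
  then show ?thesis using True assms
    by (simp add: simple_root_def simple_coords_def L_tor algebra_simps)
next
  case False
  then show ?thesis using assms by (simp add: simple_root_def simple_coords_def L_tor)
qed

lemma simple_coords_eq_iff: "simple_coords n a = simple_coords n b \<longleftrightarrow> (\<forall>k\<in>{1..n}. a k = b k)"
proof
  assume eq: "simple_coords n a = simple_coords n b"
  show "\<forall>k\<in>{1..n}. a k = b k"
  proof
    fix k assume "k \<in> {1..n}"
    then show "a k = b k"
      using arg_cong[OF eq, of "simple_root n k"] by (simp add: simple_root_simple_coords)
  qed
next
  assume "\<forall>k\<in>{1..n}. a k = b k"
  then show "simple_coords n a = simple_coords n b"
    unfolding simple_coords_def by (intro tor_cong sum.cong) auto
qed

lemma xi_eq_simple_coords:
  assumes "I \<subseteq> {1..n}"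
  shows "xi n I = simple_coords n (\<lambda>k. real (of_bool (k \<in> I)))"
proof -
  have fin: "finite I" using assms finite_subset by blast
  have "xi n I = tor n (\<lambda>i. \<Sum>j\<in>I. if i \<le> j then 1 else 0)"
    unfolding xi_def using assms by (intro mat_sum_tor fin) (auto simp: H_eq_tor)
  also have "\<dots> = simple_coords n (\<lambda>k. real (of_bool (k \<in> I)))"
    unfolding simple_coords_def
  proof (intro tor_cong)
    fix i assume "i \<in> {1..n}"
    have "(\<Sum>j\<in>I. if i \<le> j then 1 else 0) = (\<Sum>j\<in>{j \<in> I. i \<le> j}. 1 :: real)"
      by (rule sum.inter_filter[symmetric, OF fin])
    also have "{j \<in> I. i \<le> j} = {j \<in> {i..n}. j \<in> I}" using assms by auto
    also have "(\<Sum>j\<in>{j \<in> {i..n}. j \<in> I}. 1 :: real) = (\<Sum>j=i..n. if j \<in> I then 1 else 0)"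
      by (rule sum.inter_filter) simp
    also have "\<dots> = (\<Sum>j=i..n. real (of_bool (j \<in> I)))" by (intro sum.cong) auto
    finally show "(\<Sum>j\<in>I. if i \<le> j then 1 else 0) = (\<Sum>j=i..n. real (of_bool (j \<in> I)))" .
  qed
  finally show ?thesis .
qed

lemma H_add_xi_eq_simple_coords:
  assumes "I \<subseteq> {1..n}" "j \<in> {1..n}"
  shows "H n j + xi n I = simple_coords n (\<lambda>k. real (of_bool (k = j) + of_bool (k \<in> I)))"
proof -
  have "H n j = simple_coords n (\<lambda>k. real (of_bool (k = j)))"
    unfolding simple_coords_def H_eq_tor[OF assms(2)] using assms(2) by (intro tor_cong) auto
  then show ?thesis
    unfolding xi_eq_simple_coords[OF assms(1)] simple_coords_def by (simp add: tor_add sum.distrib)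
qed

section \<open>The kernel of the exponential map of the spin group\<close>

text \<open>
  The index sets of products of the bivectors \<open>u\<^sub>i u\<^sub>n\<^sub>+\<^sub>i\<close>, with indices counted from 0. Multiplication by
  a combination of these bivectors stays within the span of the basis elements indexed by such sets, and
  there it can be diagonalised.
\<close>

definition planes :: "nat \<Rightarrow> nat set \<Rightarrow> nat set" where
  "planes n S = S \<union> (\<lambda>i. n + i) ` S"

definition bivector :: "nat \<Rightarrow> (nat \<Rightarrow> real) \<Rightarrow> clifford" where
  "bivector n c A = (\<Sum>i<n. if A = planes n {i} then c i else 0)"

lemma planes_sym_diff:
  assumes "S \<subseteq> {..<n}" "T \<subseteq> {..<n}"
  shows "sym_diff (planes n S) (planes n T) = planes n (sym_diff S T)"
proof -
  have "S \<inter> (\<lambda>i. n + i) ` T = {}" "T \<inter> (\<lambda>i. n + i) ` S = {}" using assms by auto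
  then show ?thesis unfolding planes_def by auto
qed

lemma planes_subset: "S \<subseteq> {..<n} \<Longrightarrow> planes n S \<subseteq> {..<2 * n + 1}"
  unfolding planes_def by auto

lemma planes_singleton: "planes n {i} = {i, n + i}"
  by (auto simp: planes_def)

lemma planes_eq_empty_iff: "planes n S = {} \<longleftrightarrow> S = {}"
  by (auto simp: planes_def)

text \<open>
  An index \<open>j\<close> contributes a sign iff \<open>i < j \<le> n + i\<close>, and for each \<open>l\<close> in \<open>T\<close> this holds for exactly
  one of \<open>l\<close> and \<open>n + l\<close>.
\<close>

lemma cl_sign_planes:
  assumes i: "i < n" and T: "T \<subseteq> {..<n}"
  shows "cl_sign (planes n {i}) (planes n T) = (- 1) ^ card T"
proof -
  have fin: "finite T" using T finite_subset by blast
  have dis: "T \<inter> (\<lambda>i. n + i) ` T = {}" using T by auto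
  have "cl_sign (planes n {i}) (planes n T) = (\<Prod>x\<in>{i, n + i}. \<Prod>j\<in>planes n T. if j \<le> x then - 1 else 1)"
    by (simp only: cl_sign_def planes_singleton)
  also have "\<dots> = (\<Prod>x\<in>{i, n + i}. \<Prod>l\<in>T. (if l \<le> x then - 1 else 1) * (if n + l \<le> x then - 1 else 1))"
    unfolding planes_def using fin dis
    by (subst prod.union_disjoint) (simp_all add: prod.reindex prod.distrib)
  also have "\<dots> = (\<Prod>l\<in>T. (if l \<le> i then - 1 else 1) * (if n + l \<le> i then - 1 else 1) *
      ((if l \<le> n + i then - 1 else 1) * (if n + l \<le> n + i then - 1 else 1)))"
    using i by (simp add: prod.distrib)
  also have "\<dots> = (\<Prod>l\<in>T. - 1)" using i T by (intro prod.cong) auto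
  finally show ?thesis by simp
qed

lemma cl_mult_bivector:
  assumes "C \<subseteq> {..<2 * n + 1}"
  shows "cl_mult (2 * n + 1) (bivector n c) y C =
    (\<Sum>i<n. c i * (cl_sign (planes n {i}) (sym_diff (planes n {i}) C) * y (sym_diff (planes n {i}) C)))"
proof -
  let ?g = "\<lambda>A. cl_sign A (sym_diff A C) * y (sym_diff A C)"
  have "cl_mult (2 * n + 1) (bivector n c) y C = (\<Sum>A\<in>Pow {..<2 * n + 1}. bivector n c A * ?g A)"
    using assms by (simp add: cl_mult_def mult_ac)
  also have "\<dots> = (\<Sum>A\<in>Pow {..<2 * n + 1}. \<Sum>i<n. if A = planes n {i} then c i * ?g A else 0)"
    by (simp add: bivector_def sum_distrib_right if_distrib[of "\<lambda>t. t * _"] cong: if_cong)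
  also have "\<dots> = (\<Sum>i<n. \<Sum>A\<in>Pow {..<2 * n + 1}. if A = planes n {i} then c i * ?g A else 0)"
    by (rule sum.swap)
  also have "\<dots> = (\<Sum>i<n. c i * ?g (planes n {i}))"
    using planes_subset by (intro sum.cong refl) (subst sum.delta, auto)
  finally show ?thesis .
qed

text \<open>
  This is \<open>(- 1)\<close> to the power \<open>s (s + 1) / 2\<close>. Up to a factor \<open>(- 1)\<^sup>s\<close> it is the sign by which the
  product of \<open>s\<close> of the bivectors \<open>u\<^sub>i u\<^sub>n\<^sub>+\<^sub>i\<close> differs from the increasing product of the same basis
  vectors.
\<close>

definition plane_sign :: "nat \<Rightarrow> real" where
  "plane_sign s = (\<Prod>k=1..s. (- 1) ^ k)"

text \<open>
  The commuting bivectors have eigenvalues \<open>\<i>\<close> and \<open>- \<i>\<close>; a set \<open>Z\<close> records one choice of signs, and so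
  one joint eigenvector.
\<close>

definition unit_root :: "nat set \<Rightarrow> nat \<Rightarrow> complex" where
  "unit_root Z j = (if j \<in> Z then \<i> else - \<i>)"

lemma funpow_bivector_outside:
  assumes "\<And>S. S \<subseteq> {..<n} \<Longrightarrow> C \<noteq> planes n S"
  shows "(cl_mult (2 * n + 1) (bivector n c) ^^ m) (cl_basis {}) C = 0"
  using assms
proof (induction m arbitrary: C)
  case 0
  from 0[of "{}"] show ?case by (simp add: cl_basis_def planes_def)
next
  case (Suc m)
  show ?case
  proof (cases "C \<subseteq> {..<2 * n + 1}")
    case True
    have "sym_diff (planes n {i}) C \<noteq> planes n S" if "i < n" "S \<subseteq> {..<n}" for i S
    proof
      assume "sym_diff (planes n {i}) C = planes n S"
      then have "C = sym_diff (planes n {i}) (planes n S)" by blast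
      with Suc.prems[of "sym_diff {i} S"] that show False
        by (subst (asm) planes_sym_diff) auto
    qed
    then have "(cl_mult (2 * n + 1) (bivector n c) ^^ m) (cl_basis {}) (sym_diff (planes n {i}) C) = 0"
      if "i < n" for i by (intro Suc.IH) (use that in blast)
    then show ?thesis unfolding funpow.simps o_apply cl_mult_bivector[OF True]
      by (intro sum.neutral) simp
  qed (simp add: cl_mult_def)
qed

text \<open>
  The vector whose coefficient at \<open>planes n S\<close> is \<open>plane_sign (card S)\<close> times the product of the
  chosen eigenvalues over \<open>S\<close> is an eigenvector of left multiplication by each bivector.
\<close>

lemma eigenvector_step:
  assumes "finite S"
  shows "(- 1) ^ card (sym_diff {i} S) * of_real (plane_sign (card (sym_diff {i} S))) *
      (\<Prod>j\<in>sym_diff {i} S. unit_root Z j) =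
    unit_root Z i * (of_real (plane_sign (card S)) * (\<Prod>j\<in>S. unit_root Z j))"
proof -
  have sq: "unit_root Z i * (x * (unit_root Z i * y)) = - (x * y)" for x y
    by (simp add: unit_root_def mult.left_commute[of x])
  have pm: "(- 1 :: complex) ^ k * (- 1) ^ k = 1" for k by (simp flip: power_add)
  show ?thesis
  proof (cases "i \<in> S")
    case True
    then have S: "sym_diff {i} S = S - {i}" by auto
    obtain T where T: "S = insert i T" "i \<notin> T" using True by (meson Set.set_insert)
    with assms have "finite T" by simp
    then show ?thesis unfolding S T(1) using T(2) sq
      by (simp add: plane_sign_def)
  next
    case False
    then have S: "sym_diff {i} S = insert i S" by auto
    show ?thesis unfolding S using False assms pm[of "card S"]
      by (simp add: plane_sign_def mult_ac)
  qed
qed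

text \<open>
  A sum over all sign choices factors over the coordinates, and each factor is \<open>2 cos\<close> or \<open>- 2 sin\<close> by
  Euler's formula.
\<close>

lemma sum_eigenvectors:
  assumes "S \<subseteq> {..<n}"
  shows "(\<Sum>Z\<in>Pow {..<n}. exp (\<Sum>j<n. of_real (c j) * unit_root Z j) * (\<Prod>j\<in>S. unit_root Z j)) =
    2 ^ n * of_real (\<Prod>j<n. if j \<in> S then - sin (c j) else cos (c j))"
proof -
  define f where "f j = exp (\<i> * of_real (c j)) * (if j \<in> S then \<i> else 1)" for j
  define g where "g j = exp (- \<i> * of_real (c j)) * (if j \<in> S then - \<i> else 1)" for j
  have "exp (\<Sum>j<n. of_real (c j) * unit_root Z j) * (\<Prod>j\<in>S. unit_root Z j) = prod f Z * prod g ({..<n} - Z)"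
    if Z: "Z \<in> Pow {..<n}" for Z
  proof -
    have "(\<Prod>j\<in>S. unit_root Z j) = (\<Prod>j<n. if j \<in> S then unit_root Z j else 1)"
      using assms by (subst prod.If_cases) (auto simp: Int_absorb1)
    then have "exp (\<Sum>j<n. of_real (c j) * unit_root Z j) * (\<Prod>j\<in>S. unit_root Z j) =
        (\<Prod>j<n. exp (of_real (c j) * unit_root Z j) * (if j \<in> S then unit_root Z j else 1))"
      by (simp add: exp_sum prod.distrib)
    also have "\<dots> = (\<Prod>j<n. if j \<in> Z then f j else g j)"
      by (intro prod.cong) (auto simp: f_def g_def unit_root_def mult_ac)
    also have "\<dots> = prod f Z * prod g ({..<n} - Z)"
      using Z by (subst prod.If_cases) (auto simp: Int_absorb1 Diff_eq)
    finally show ?thesis .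
  qed
  then have "(\<Sum>Z\<in>Pow {..<n}. exp (\<Sum>j<n. of_real (c j) * unit_root Z j) * (\<Prod>j\<in>S. unit_root Z j)) =
      (\<Prod>j<n. f j + g j)"
    by (simp add: prod_add)
  also have "\<dots> = (\<Prod>j<n. 2 * of_real (if j \<in> S then - sin (c j) else cos (c j)))"
  proof (intro prod.cong refl)
    fix j
    have "exp (\<i> * of_real (c j)) = cis (c j)" "exp (- \<i> * of_real (c j)) = cis (- c j)"
      by (simp_all add: cis_conv_exp)
    then show "f j + g j = 2 * of_real (if j \<in> S then - sin (c j) else cos (c j))"
      unfolding f_def g_def by (auto simp: complex_eq_iff)
  qed
  also have "\<dots> = 2 ^ n * of_real (\<Prod>j<n. if j \<in> S then - sin (c j) else cos (c j))"
    unfolding prod.distrib of_real_prod by simp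
  finally show ?thesis .
qed

text \<open>
  The unit is \<open>2\<^sup>-\<^sup>n\<close> times the sum of all joint eigenvectors, so powers of the bivector act on it through
  powers of the eigenvalues.
\<close>

lemma funpow_bivector:
  assumes "S \<subseteq> {..<n}"
  shows "complex_of_real ((cl_mult (2 * n + 1) (bivector n c) ^^ m) (cl_basis {}) (planes n S)) =
    (\<Sum>Z\<in>Pow {..<n}. (\<Sum>j<n. of_real (c j) * unit_root Z j) ^ m *
       (of_real (plane_sign (card S)) * (\<Prod>j\<in>S. unit_root Z j))) / 2 ^ n"
  using assms
proof (induction m arbitrary: S)
  case 0
  \<comment> \<open>the coefficients of the unit: \<open>c = 0\<close> turns all exponentials into 1\<close>
  have "(\<Sum>Z\<in>Pow {..<n}. \<Prod>j\<in>S. unit_root Z j) = (if S = {} then 2 ^ n else 0)"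
    using sum_eigenvectors[OF 0, of "\<lambda>_. 0"] 0
    by (auto simp: prod_eq_1_iff intro!: prod_zero)
  then show ?case
    by (simp add: cl_basis_def planes_eq_empty_iff plane_sign_def flip: sum_distrib_left)
next
  case (Suc m)
  let ?x' = "(cl_mult (2 * n + 1) (bivector n c) ^^ m) (cl_basis {})"
  let ?x = "\<lambda>S. ?x' (planes n S)"
  let ?l = "\<lambda>Z. \<Sum>j<n. of_real (c j) * unit_root Z j"
  let ?y = "\<lambda>Z S. of_real (plane_sign (card S)) * (\<Prod>j\<in>S. unit_root Z j)"
  have fin: "finite S" using Suc.prems finite_subset by blast
  have "(cl_mult (2 * n + 1) (bivector n c) ^^ Suc m) (cl_basis {}) (planes n S) =
     (\<Sum>i<n. c i * ((- 1) ^ card (sym_diff {i} S) * ?x (sym_diff {i} S)))"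
    unfolding funpow.simps o_apply cl_mult_bivector[OF planes_subset[OF Suc.prems]]
  proof (intro sum.cong refl arg_cong2[where f = "(*)"])
    fix i assume "i \<in> {..<n}"
    with Suc.prems have *: "i < n" "sym_diff {i} S \<subseteq> {..<n}"
      "sym_diff (planes n {i}) (planes n S) = planes n (sym_diff {i} S)"
      by (auto intro!: planes_sym_diff)
    show "cl_sign (planes n {i}) (sym_diff (planes n {i}) (planes n S)) = (- 1) ^ card (sym_diff {i} S)"
      "?x' (sym_diff (planes n {i}) (planes n S)) = ?x (sym_diff {i} S)"
      unfolding *(3) by (simp_all add: cl_sign_planes[OF *(1,2)])
  qed
  then have "complex_of_real ((cl_mult (2 * n + 1) (bivector n c) ^^ Suc m) (cl_basis {}) (planes n S)) =
     (\<Sum>i<n. of_real (c i) * ((- 1) ^ card (sym_diff {i} S) * of_real (?x (sym_diff {i} S))))"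
    by simp
  also have "\<dots> = (\<Sum>i<n. of_real (c i) * ((- 1) ^ card (sym_diff {i} S) *
      ((\<Sum>Z\<in>Pow {..<n}. ?l Z ^ m * ?y Z (sym_diff {i} S)) / 2 ^ n)))"
    using Suc.prems by (intro sum.cong refl arg_cong2[where f = "(*)"] Suc.IH) auto
  also have "\<dots> = (\<Sum>i<n. \<Sum>Z\<in>Pow {..<n}. of_real (c i) * (?l Z ^ m *
      ((- 1) ^ card (sym_diff {i} S) * ?y Z (sym_diff {i} S)))) / 2 ^ n"
    by (simp add: sum_divide_distrib sum_distrib_left mult_ac)
  also have "\<dots> = (\<Sum>i<n. \<Sum>Z\<in>Pow {..<n}. of_real (c i) * (?l Z ^ m * (unit_root Z i * ?y Z S))) / 2 ^ n"
    by (simp only: mult.assoc[symmetric] eigenvector_step[OF fin, unfolded mult.assoc[symmetric]])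
  also have "\<dots> = (\<Sum>Z\<in>Pow {..<n}. \<Sum>i<n. of_real (c i) * (?l Z ^ m * (unit_root Z i * ?y Z S))) / 2 ^ n"
    by (subst sum.swap) simp
  also have "\<dots> = (\<Sum>Z\<in>Pow {..<n}. ?l Z ^ Suc m * ?y Z S) / 2 ^ n"
    by (simp add: sum_distrib_left sum_distrib_right mult_ac)
  finally show ?case .
qed

text \<open>
  The expansion of the product of the \<open>cos (c\<^sub>i) + sin (c\<^sub>i) u\<^sub>i u\<^sub>n\<^sub>+\<^sub>i\<close>, obtained by summing the
  exponential series in each joint eigenvector.
\<close>

lemma cl_exp_bivector:
  assumes "S \<subseteq> {..<n}"
  shows "cl_exp (2 * n + 1) (bivector n c) (planes n S) =
    plane_sign (card S) * (\<Prod>j<n. if j \<in> S then - sin (c j) else cos (c j))"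
proof -
  let ?x = "\<lambda>m. (cl_mult (2 * n + 1) (bivector n c) ^^ m) (cl_basis {}) (planes n S)"
  let ?l = "\<lambda>Z. \<Sum>j<n. of_real (c j) * unit_root Z j"
  let ?y = "\<lambda>Z. of_real (plane_sign (card S)) * (\<Prod>j\<in>S. unit_root Z j)"
  have "(\<lambda>m. (\<Sum>Z\<in>Pow {..<n}. (?l Z ^ m /\<^sub>R fact m) * ?y Z) / 2 ^ n) sums
      ((\<Sum>Z\<in>Pow {..<n}. exp (?l Z) * ?y Z) / 2 ^ n)"
    by (intro sums_divide sums_sum sums_mult2 exp_converges)
  moreover have "(\<Sum>Z\<in>Pow {..<n}. (?l Z ^ m /\<^sub>R fact m) * ?y Z) / 2 ^ n = complex_of_real (?x m / fact m)" for m
    unfolding of_real_divide funpow_bivector[OF assms]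
    by (simp add: sum_divide_distrib sum_distrib_left scaleR_conv_of_real divide_inverse mult_ac)
  moreover have "(\<Sum>Z\<in>Pow {..<n}. exp (?l Z) * ?y Z) / 2 ^ n =
      of_real (plane_sign (card S) * (\<Prod>j<n. if j \<in> S then - sin (c j) else cos (c j)))"
  proof -
    have "(\<Sum>Z\<in>Pow {..<n}. exp (?l Z) * ?y Z) =
       of_real (plane_sign (card S)) * (\<Sum>Z\<in>Pow {..<n}. exp (?l Z) * (\<Prod>j\<in>S. unit_root Z j))"
      by (simp add: sum_distrib_left mult_ac)
    then show ?thesis unfolding sum_eigenvectors[OF assms]
      by simp
  qed
  ultimately have "(\<lambda>m. complex_of_real (?x m / fact m)) sums
      of_real (plane_sign (card S) * (\<Prod>j<n. if j \<in> S then - sin (c j) else cos (c j)))"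
    by simp
  then have "(\<lambda>m. ?x m / fact m) sums
      (plane_sign (card S) * (\<Prod>j<n. if j \<in> S then - sin (c j) else cos (c j)))"
    by (simp only: sums_of_real_iff)
  then show ?thesis by (simp add: cl_exp_def sums_iff)
qed

lemma cl_exp_bivector_outside:
  assumes "\<And>S. S \<subseteq> {..<n} \<Longrightarrow> C \<noteq> planes n S"
  shows "cl_exp (2 * n + 1) (bivector n c) C = 0"
  using funpow_bivector_outside[OF assms] by (simp add: cl_exp_def)

lemma bivector_index: "i < n \<Longrightarrow> bivector n c {i, n + i} = c i"
proof -
  assume i: "i < n"
  have "{i, n + i} = planes n {j} \<longleftrightarrow> j = i" if "j < n" for j
    using that i by (auto simp: planes_singleton doubleton_eq_iff)
  then have "bivector n c {i, n + i} = (\<Sum>j<n. if j = i then c j else 0)"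
    unfolding bivector_def by (intro sum.cong) auto
  with i show ?thesis by simp
qed

lemma bivector_grade: "bivector n c \<in> cl_grade (2 * n + 1) 2"
proof -
  have "A \<subseteq> {..<2 * n + 1} \<and> card A = 2" if "bivector n c A \<noteq> 0" for A
  proof -
    have "\<exists>i<n. A = planes n {i}"
      using that unfolding bivector_def by (rule contrapos_np) (auto intro!: sum.neutral)
    then show ?thesis by (auto simp: planes_singleton card_insert_if)
  qed
  then show ?thesis by (auto simp: cl_grade_def)
qed

lemma bivector_eq_0: "(\<And>i. i < n \<Longrightarrow> A \<noteq> {i, n + i}) \<Longrightarrow> bivector n c A = 0"
  by (auto simp: bivector_def planes_singleton intro!: sum.neutral)

lemma spin_diff_bivector: "spin_diff (2 * n + 1) (bivector n (\<lambda>i. a (Suc i) / 2)) = tor n a"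
proof (rule eq_matI)
  let ?b = "bivector n (\<lambda>i. a (Suc i) / 2)"
  fix r c assume "r < dim_row (tor n a)" "c < dim_col (tor n a)"
  then have rc: "r < 2 * n + 1" "c < 2 * n + 1" using tor_carrier[of n a] by auto
  consider "c < n" "r = n + c" | "r < n" "c = n + r" | "\<not> (c < n \<and> r = n + c)" "\<not> (r < n \<and> c = n + r)"
    by blast
  then show "spin_diff (2 * n + 1) ?b $$ (r, c) = tor n a $$ (r, c)"
  proof cases
    case 1
    then show ?thesis using rc bivector_index[of c n] by (simp add: spin_diff_index[OF bivector_grade] tor_index insert_commute)
  next
    case 2
    then show ?thesis using rc bivector_index[of r n] by (simp add: spin_diff_index[OF bivector_grade] tor_index)
  next
    case 3
    then have "?b {r, c} = 0" by (intro bivector_eq_0) (auto simp: doubleton_eq_iff)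
    moreover have "tor n a $$ (r, c) = 0" using 3 tor_index[OF rc] by auto
    ultimately show ?thesis using rc by (simp add: spin_diff_index[OF bivector_grade])
  qed
qed (use carrier_matD[OF tor_carrier[of n a]] in \<open>auto simp: spin_diff_def\<close>)

lemma exp_Spin_tor: "exp_Spin (2 * n + 1) (tor n a) = cl_exp (2 * n + 1) (bivector n (\<lambda>i. a (Suc i) / 2))"
proof -
  have "the_inv_into (cl_grade (2 * n + 1) 2) (spin_diff (2 * n + 1)) (tor n a) = bivector n (\<lambda>i. a (Suc i) / 2)"
    using spin_diff_bij by (intro the_inv_into_f_eq spin_diff_bivector bivector_grade) (auto simp: bij_betw_def)
  then show ?thesis by (simp add: exp_Spin_def)
qed

text \<open>
  All factors have absolute value at most 1, so each of them must have absolute value 1.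
\<close>

lemma prod_cos_eq_1_imp:
  assumes "finite A" "(\<Prod>i\<in>A. cos (x i)) = (1::real)" "i \<in> A"
  shows "sin (x i) = 0"
proof -
  have le: "\<bar>\<Prod>i\<in>B. cos (x i)\<bar> \<le> 1" for B
    unfolding abs_prod by (intro prod_le_1) auto
  have "1 = \<bar>cos (x i)\<bar> * \<bar>\<Prod>i\<in>A - {i}. cos (x i)\<bar>"
    using assms by (simp add: prod.remove flip: abs_mult)
  also have "\<dots> \<le> \<bar>cos (x i)\<bar> * 1" by (intro mult_left_mono le) auto
  finally have "(cos (x i))\<^sup>2 \<ge> 1" by (simp add: abs_square_le_1[symmetric] one_le_power abs_le_square_iff[of 1, simplified])
  then show ?thesis using sin_cos_squared_add[of "x i"] by (metis add_le_same_cancel2 power2_less_eq_zero_iff)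
qed

lemma prod_cos_eq_cos_sum:
  assumes "finite A" "\<And>i. i \<in> A \<Longrightarrow> sin (x i) = (0::real)"
  shows "(\<Prod>i\<in>A. cos (x i)) = cos (\<Sum>i\<in>A. x i) \<and> sin (\<Sum>i\<in>A. x i) = 0"
  using assms by (induction A rule: finite_induct) (auto simp: cos_add sin_add)

lemma tor_in_unit_lattice_iff:
  "tor n a \<in> unit_lattice n \<longleftrightarrow> (\<forall>i\<in>{1..n}. a i \<in> \<int>) \<and> (\<exists>k::int. (\<Sum>i=1..n. a i) = 2 * of_int k)"
proof -
  define x where "x i = pi * a (Suc i)" for i
  define g where "g = cl_exp (2 * n + 1) (bivector n x)"
  have "tor n a \<in> unit_lattice n \<longleftrightarrow> g = cl_basis {}"
    unfolding unit_lattice_def torus_eq_range_tor smult_tor exp_Spin_tor g_def x_def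
    by (auto simp: smult_tor exp_Spin_tor Spin_def)
  also have "\<dots> \<longleftrightarrow> (\<forall>i<n. sin (x i) = 0) \<and> cos (\<Sum>i<n. x i) = 1"
  proof
    assume "g = cl_basis {}"
    then have "g (planes n {}) = 1" by (simp add: planes_def cl_basis_def)
    then have 1: "(\<Prod>i<n. cos (x i)) = 1" by (simp add: g_def cl_exp_bivector plane_sign_def)
    have "sin (x i) = 0" if "i < n" for i using prod_cos_eq_1_imp[OF _ 1] that by auto
    with prod_cos_eq_cos_sum[of "{..<n}" x] 1 show "(\<forall>i<n. sin (x i) = 0) \<and> cos (\<Sum>i<n. x i) = 1" by auto
  next
    assume r: "(\<forall>i<n. sin (x i) = 0) \<and> cos (\<Sum>i<n. x i) = 1"
    then have 1: "(\<Prod>i<n. cos (x i)) = 1" using prod_cos_eq_cos_sum[of "{..<n}" x] by auto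
    show "g = cl_basis {}"
    proof
      fix C
      show "g C = cl_basis {} C"
      proof (cases "\<exists>S. S \<subseteq> {..<n} \<and> C = planes n S")
        case True
        then obtain S where S: "S \<subseteq> {..<n}" "C = planes n S" by blast
        show ?thesis
        proof (cases "S = {}")
          case True
          then show ?thesis using S 1 by (simp add: g_def cl_exp_bivector plane_sign_def cl_basis_def planes_eq_empty_iff)
        next
          case False
          then obtain j where "j \<in> S" by auto
          then have "(\<Prod>j<n. if j \<in> S then - sin (x j) else cos (x j)) = 0"
            using S r by (intro prod_zero bexI[of _ j]) auto
          with S False show ?thesis by (simp add: g_def cl_exp_bivector cl_basis_def planes_eq_empty_iff)
        qed
      next
        case False
        then show ?thesis unfolding g_def
          by (subst cl_exp_bivector_outside) (auto simp: cl_basis_def planes_def)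
      qed
    qed
  qed
  also have "(\<forall>i<n. sin (x i) = 0) \<longleftrightarrow> (\<forall>i\<in>{1..n}. a i \<in> \<int>)"
  proof -
    have "sin (x i) = 0 \<longleftrightarrow> a (Suc i) \<in> \<int>" for i
      by (auto simp: sin_zero_iff_int2 x_def Ints_def)
    moreover have "{1..n} = Suc ` {..<n}" by (simp add: image_Suc_lessThan)
    ultimately show ?thesis by auto
  qed
  also have "cos (\<Sum>i<n. x i) = 1 \<longleftrightarrow> (\<exists>k::int. (\<Sum>i=1..n. a i) = 2 * of_int k)"
  proof -
    have "(\<Sum>i<n. x i) = pi * (\<Sum>i=1..n. a i)"
      by (simp add: x_def sum_distrib_left sum.reindex flip: image_Suc_lessThan)
    then show ?thesis by (auto simp: cos_one_2pi_int)
  qed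
  finally show ?thesis .
qed

section \<open>Sums of eigenvectors\<close>

text \<open>
  \<open>D c\<close> stands for \<open>T - c\<close>, where \<open>T\<close> is a linear operator on the complex vector space \<open>V\<close>. The axioms
  are the facts about these shifts from which eigenvectors for different eigenvalues are seen to be
  independent. They will be used for \<open>ad \<xi>\<close> on matrices and for the action of \<open>\<xi>\<close> in a representation.
\<close>

locale shifted_operator =
  fixes V :: "'a set" and add :: "'a \<Rightarrow> 'a \<Rightarrow> 'a" and scale :: "complex \<Rightarrow> 'a \<Rightarrow> 'a"
    and zero :: 'a and D :: "complex \<Rightarrow> 'a \<Rightarrow> 'a"
  assumes zero_closed: "zero \<in> V"
    and add_closed: "\<lbrakk>x \<in> V; y \<in> V\<rbrakk> \<Longrightarrow> add x y \<in> V"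
    and scale_closed: "x \<in> V \<Longrightarrow> scale c x \<in> V"
    and D_closed: "x \<in> V \<Longrightarrow> D l x \<in> V"
    and D_zero: "D l zero = zero"
    and D_add: "\<lbrakk>x \<in> V; y \<in> V\<rbrakk> \<Longrightarrow> D l (add x y) = add (D l x) (D l y)"
    and D_scale: "x \<in> V \<Longrightarrow> D l (scale c x) = scale c (D l x)"
    and D_commute: "x \<in> V \<Longrightarrow> D l (D k x) = D k (D l x)"
    and D_eigenvector: "\<lbrakk>x \<in> V; D c x = zero\<rbrakk> \<Longrightarrow> D l x = scale (c - l) x"
    and zero_add: "x \<in> V \<Longrightarrow> add zero x = x"
    and scale_zero: "scale c zero = zero"
    and scale_eq_zero: "\<lbrakk>x \<in> V; scale c x = zero; c \<noteq> 0\<rbrakk> \<Longrightarrow> x = zero"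
begin

text \<open>
  The vectors annihilated by a product of operators \<open>T - l\<close> with \<open>l \<in> \<Lambda>\<close>. This contains all sums of
  eigenvectors with eigenvalues in \<open>\<Lambda>\<close>, and the inductive form gives closure properties and
  independence without handling the summands.
\<close>

inductive_set eigensum :: "complex set \<Rightarrow> 'a set" for \<Lambda> where
  zero: "zero \<in> eigensum \<Lambda>"
| shift: "\<lbrakk>x \<in> V; l \<in> \<Lambda>; D l x \<in> eigensum \<Lambda>\<rbrakk> \<Longrightarrow> x \<in> eigensum \<Lambda>"

lemma eigensum_closed: "x \<in> eigensum \<Lambda> \<Longrightarrow> x \<in> V"
  by (induction rule: eigensum.induct) (auto simp: zero_closed)

lemma eigensum_D: "x \<in> eigensum \<Lambda> \<Longrightarrow> D k x \<in> eigensum \<Lambda>"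
proof (induction rule: eigensum.induct)
  case (shift x l)
  then show ?case by (metis D_closed D_commute eigensum.shift)
qed (simp add: D_zero eigensum.zero)

lemma eigensum_add: "\<lbrakk>x \<in> eigensum \<Lambda>; y \<in> eigensum \<Lambda>\<rbrakk> \<Longrightarrow> add x y \<in> eigensum \<Lambda>"
proof (induction arbitrary: y rule: eigensum.induct)
  case zero
  then show ?case by (simp add: zero_add eigensum_closed)
next
  case (shift x l)
  then have "D l (add x y) \<in> eigensum \<Lambda>" by (simp add: D_add eigensum_closed eigensum_D)
  with shift show ?case by (meson add_closed eigensum.shift eigensum_closed)
qed

lemma eigensum_scale: "x \<in> eigensum \<Lambda> \<Longrightarrow> scale c x \<in> eigensum \<Lambda>"
proof (induction rule: eigensum.induct)
  case (shift x l)
  then show ?case by (metis D_scale scale_closed eigensum.shift)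
qed (simp add: scale_zero eigensum.zero)

lemma eigensumI: "\<lbrakk>x \<in> V; D c x = zero; c \<in> \<Lambda>\<rbrakk> \<Longrightarrow> x \<in> eigensum \<Lambda>"
  by (metis eigensum.zero eigensum.shift)

lemma eigenvalue_of_eigensum:
  assumes "x \<in> eigensum \<Lambda>" "D c x = zero" "x \<noteq> zero"
  shows "c \<in> \<Lambda>"
  using assms
proof (induction rule: eigensum.induct)
  case (shift x l)
  show ?case
  proof (cases "c = l")
    case False
    have "D l x = scale (c - l) x" using D_eigenvector shift by simp
    moreover have "scale (c - l) x \<noteq> zero" using scale_eq_zero[of x "c - l"] False shift by auto
    moreover have "D c (scale (c - l) x) = zero" using shift by (simp add: D_scale scale_zero)
    ultimately show ?thesis using shift by simp
  qed (use shift in simp)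
qed simp

text \<open>
  Independence of eigenspaces: peeling off one factor \<open>T - l\<close> leaves an eigenvector for \<open>l\<close>, and \<open>l\<close>
  would have to lie in both sets.
\<close>

lemma eigensum_disjoint:
  assumes "x \<in> eigensum \<Lambda>" "x \<in> eigensum \<Lambda>'" "\<Lambda> \<inter> \<Lambda>' = {}"
  shows "x = zero"
  using assms
proof (induction rule: eigensum.induct)
  case (shift x l)
  then have "D l x = zero" by (simp add: eigensum_D)
  with shift eigenvalue_of_eigensum[of x \<Lambda>' l] show ?case by blast
qed simp

text \<open>
  An operator that raises eigenvalues by \<open>t\<close>, such as a root vector.
\<close>

lemma eigensum_shifting:
  assumes "x \<in> eigensum \<Lambda>" "\<And>x. x \<in> V \<Longrightarrow> Y x \<in> V" "Y zero = zero"
    "\<And>l x. x \<in> V \<Longrightarrow> D (l + t) (Y x) = Y (D l x)" "\<And>l. l \<in> \<Lambda> \<Longrightarrow> l + t \<in> \<Lambda>"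
  shows "Y x \<in> eigensum \<Lambda>"
  using assms(1)
proof (induction rule: eigensum.induct)
  case (shift x l)
  then show ?case using assms eigensum.shift[of "Y x" "l + t" \<Lambda>] by metis
qed (simp add: assms(3) eigensum.zero)

end

section \<open>Root vectors of the orthogonal Lie algebra\<close>

lemma so_carrier: "X \<in> so N \<Longrightarrow> X \<in> carrier_mat N N"
  by (simp add: so_def)

lemma so_iff: "X \<in> so N \<longleftrightarrow> X \<in> carrier_mat N N \<and> (\<forall>r<N. \<forall>c<N. X $$ (r, c) = - X $$ (c, r))"
proof -
  have "transpose_mat X = - X \<longleftrightarrow> (\<forall>r<N. \<forall>c<N. X $$ (r, c) = - X $$ (c, r))"
    if car: "X \<in> carrier_mat N N"
  proof
    assume eq: "transpose_mat X = - X"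
    show "\<forall>r<N. \<forall>c<N. X $$ (r, c) = - X $$ (c, r)"
    proof (intro allI impI)
      fix r c assume "r < N" "c < N"
      then show "X $$ (r, c) = - X $$ (c, r)"
        using arg_cong[OF eq, of "\<lambda>M. M $$ (c, r)"] car by auto
    qed
  next
    assume skew: "\<forall>r<N. \<forall>c<N. X $$ (r, c) = - X $$ (c, r)"
    show "transpose_mat X = - X"
    proof (rule eq_matI)
      fix r c assume "r < dim_row (- X)" "c < dim_col (- X)"
      with car have rc: "r < N" "c < N" by auto
      then have "X $$ (c, r) = - X $$ (r, c)" using skew by blast
      then show "transpose_mat X $$ (r, c) = (- X) $$ (r, c)" using rc car by simp
    qed (use car in simp_all)
  qed
  then show ?thesis by (auto simp: so_def)
qed

lemma so_add:
  assumes "X \<in> so N" "Y \<in> so N"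
  shows "X + Y \<in> so N"
  using assms transpose_add[of X N N Y] uminus_add_mat[of Y N N X] comm_add_mat[of X N N Y]
  by (simp add: so_def)

lemma so_smult:
  assumes "X \<in> so N"
  shows "c \<cdot>\<^sub>m X \<in> so N"
proof -
  have "transpose_mat (c \<cdot>\<^sub>m X) = c \<cdot>\<^sub>m transpose_mat X" by (intro eq_matI) auto
  also have "\<dots> = c \<cdot>\<^sub>m (- X)" using assms by (simp add: so_def)
  also have "\<dots> = - (c \<cdot>\<^sub>m X)" by (intro eq_matI) auto
  finally show ?thesis using assms by (simp add: so_def)
qed

lemma mat_sum_so:
  fixes f :: "'i \<Rightarrow> 'a::comm_ring_1 mat"
  assumes "finite S" "\<And>i. i \<in> S \<Longrightarrow> f i \<in> so N"
  shows "mat_sum N f S \<in> so N"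
proof -
  have car: "\<And>i. i \<in> S \<Longrightarrow> f i \<in> carrier_mat N N" using assms(2) by (rule so_carrier)
  have "mat_sum N f S $$ (r, c) = - mat_sum N f S $$ (c, r)" if "r < N" "c < N" for r c
  proof -
    have "mat_sum N f S $$ (r, c) = (\<Sum>i\<in>S. f i $$ (r, c))"
      by (intro mat_sum_index(2) assms(1) car that)
    also have "\<dots> = (\<Sum>i\<in>S. - f i $$ (c, r))"
      using assms(2) that unfolding so_iff by (intro sum.cong) blast+
    also have "\<dots> = - mat_sum N f S $$ (c, r)"
      unfolding sum_negf by (intro arg_cong[where f = uminus] mat_sum_index(2)[symmetric] assms(1) car that)
    finally show ?thesis .
  qed
  moreover have "mat_sum N f S \<in> carrier_mat N N" by (intro mat_sum_index(1) assms(1) car)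
  ultimately show ?thesis unfolding so_iff by blast
qed

lemma smult_smult_mat: "c \<cdot>\<^sub>m (d \<cdot>\<^sub>m X) = (c * d) \<cdot>\<^sub>m X"
  for X :: "'a::semigroup_mult mat"
  by (intro eq_matI) (auto simp: mult.assoc)

lemma mult_mat_vec_index:
  "\<lbrakk>X \<in> carrier_mat N N; v \<in> carrier_vec N; r < N\<rbrakk> \<Longrightarrow> (X *\<^sub>v v) $ r = (\<Sum>k<N. X $$ (r, k) * v $ k)"
  by (auto simp: scalar_prod_def row_def atLeast0LessThan intro!: sum.cong)

lemma mult_mat_index:
  "\<lbrakk>X \<in> carrier_mat N N; Y \<in> carrier_mat N N; r < N; c < N\<rbrakk> \<Longrightarrow>
     (X * Y) $$ (r, c) = (\<Sum>k<N. X $$ (r, k) * Y $$ (k, c))"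
  by (auto simp: scalar_prod_def row_def col_def atLeast0LessThan intro!: sum.cong)

lemma bracket_carrier: "\<lbrakk>X \<in> carrier_mat N N; Y \<in> carrier_mat N N\<rbrakk> \<Longrightarrow> bracket X Y \<in> carrier_mat N N"
  unfolding bracket_def by (intro minus_carrier_mat mult_carrier_mat)

lemma bracket_add:
  assumes "A \<in> carrier_mat N N" "X \<in> carrier_mat N N" "Y \<in> carrier_mat N N"
  shows "bracket A (X + Y) = bracket A X + bracket A Y"
  unfolding bracket_def mult_add_distrib_mat[OF assms] add_mult_distrib_mat[OF assms(2,3,1)]
  using assms by (intro eq_matI) auto

lemma bracket_smult:
  assumes "A \<in> carrier_mat N N" "X \<in> carrier_mat N N"
  shows "bracket A (c \<cdot>\<^sub>m X) = c \<cdot>\<^sub>m bracket A X"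
  unfolding bracket_def mult_smult_distrib[OF assms] mult_smult_assoc_mat[OF assms(2,1)]
  using assms by (intro eq_matI) (auto simp: algebra_simps)

lemma bracket_so: "\<lbrakk>X \<in> so N; Y \<in> so N\<rbrakk> \<Longrightarrow> bracket X Y \<in> so N" for X Y :: "complex mat"
proof -
  assume XY: "X \<in> so N" "Y \<in> so N"
  then have c: "X \<in> carrier_mat N N" "Y \<in> carrier_mat N N" and t: "transpose_mat X = - X" "transpose_mat Y = - Y"
    by (auto simp: so_def)
  have "transpose_mat (bracket X Y) = transpose_mat (X * Y) - transpose_mat (Y * X)"
    unfolding bracket_def using c by (intro eq_matI) auto
  also have "\<dots> = Y * X - X * Y"
    unfolding transpose_mult[OF c] transpose_mult[OF c(2,1)] t using c by simp
  also have "\<dots> = - bracket X Y" unfolding bracket_def using c by (intro eq_matI) auto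
  finally show ?thesis using bracket_carrier[OF c] by (simp add: so_def)
qed

text \<open>
  The skew-symmetric matrix \<open>a b\<^sup>T - b a\<^sup>T\<close>. Under this identification of the Lie algebra with the second
  exterior power, wedges of isotropic basis vectors are root vectors.
\<close>

definition wedge :: "complex vec \<Rightarrow> complex vec \<Rightarrow> complex mat" where
  "wedge a b = mat (dim_vec a) (dim_vec b) (\<lambda>(r, c). a $ r * b $ c - b $ r * a $ c)"

lemma wedge_carrier: "\<lbrakk>a \<in> carrier_vec N; b \<in> carrier_vec N\<rbrakk> \<Longrightarrow> wedge a b \<in> carrier_mat N N"
  by (auto simp: wedge_def)

lemma wedge_index:
  "\<lbrakk>a \<in> carrier_vec N; b \<in> carrier_vec N; r < N; c < N\<rbrakk> \<Longrightarrow>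
    wedge a b $$ (r, c) = a $ r * b $ c - b $ r * a $ c"
  by (simp add: wedge_def)

lemma wedge_so: "\<lbrakk>a \<in> carrier_vec N; b \<in> carrier_vec N\<rbrakk> \<Longrightarrow> wedge a b \<in> so N"
  by (auto simp: so_iff wedge_carrier wedge_index)

lemma bracket_wedge:
  assumes X: "X \<in> so N" and a: "a \<in> carrier_vec N" and b: "b \<in> carrier_vec N"
  shows "bracket X (wedge a b) = wedge (X *\<^sub>v a) b + wedge a (X *\<^sub>v b)"
proof (rule eq_matI)
  note Xc = so_carrier[OF X]
  note w = wedge_carrier[OF a b]
  have Xab: "X *\<^sub>v a \<in> carrier_vec N" "X *\<^sub>v b \<in> carrier_vec N" using Xc a b by auto
  fix r c assume "r < dim_row (wedge (X *\<^sub>v a) b + wedge a (X *\<^sub>v b))"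
    "c < dim_col (wedge (X *\<^sub>v a) b + wedge a (X *\<^sub>v b))"
  then have rc: "r < N" "c < N" using a b carrier_matD[OF Xc] by (auto simp: wedge_def)
  have "(X * wedge a b) $$ (r, c) = (\<Sum>k<N. X $$ (r, k) * a $ k * b $ c - X $$ (r, k) * b $ k * a $ c)"
    using rc by (simp add: mult_mat_index[OF Xc w] wedge_index[OF a b] algebra_simps)
  also have "\<dots> = (X *\<^sub>v a) $ r * b $ c - (X *\<^sub>v b) $ r * a $ c"
    using rc by (simp add: mult_mat_vec_index[OF Xc] a b sum_subtractf sum_distrib_right)
  finally have 1: "(X * wedge a b) $$ (r, c) = (X *\<^sub>v a) $ r * b $ c - (X *\<^sub>v b) $ r * a $ c" .
  have "(wedge a b * X) $$ (r, c) = (\<Sum>k<N. (a $ r * b $ k - b $ r * a $ k) * X $$ (k, c))"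
    using rc by (simp add: mult_mat_index[OF w Xc] wedge_index[OF a b])
  also have "\<dots> = (\<Sum>k<N. b $ r * (X $$ (c, k) * a $ k) - a $ r * (X $$ (c, k) * b $ k))"
  proof (intro sum.cong refl)
    fix k assume "k \<in> {..<N}"
    then have "X $$ (k, c) = - X $$ (c, k)" using X rc unfolding so_iff by blast
    then show "(a $ r * b $ k - b $ r * a $ k) * X $$ (k, c) =
        b $ r * (X $$ (c, k) * a $ k) - a $ r * (X $$ (c, k) * b $ k)"
      by (simp add: algebra_simps)
  qed
  also have "\<dots> = b $ r * (X *\<^sub>v a) $ c - a $ r * (X *\<^sub>v b) $ c"
    using rc by (simp add: mult_mat_vec_index[OF Xc] a b sum_subtractf sum_distrib_left)
  finally have 2: "(wedge a b * X) $$ (r, c) = b $ r * (X *\<^sub>v a) $ c - a $ r * (X *\<^sub>v b) $ c" .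
  have "bracket X (wedge a b) $$ (r, c) = (X * wedge a b) $$ (r, c) - (wedge a b * X) $$ (r, c)"
    using rc Xc w by (simp add: bracket_def)
  then show "bracket X (wedge a b) $$ (r, c) = (wedge (X *\<^sub>v a) b + wedge a (X *\<^sub>v b)) $$ (r, c)"
    unfolding 1 2 using rc a b Xab wedge_carrier[OF a Xab(2)]
    by (simp add: wedge_index[OF Xab(1) b] wedge_index[OF a Xab(2)])
qed (use assms in \<open>auto simp: bracket_def wedge_def so_iff\<close>)

lemma wedge_mult_vec:
  assumes "a \<in> carrier_vec N" "b \<in> carrier_vec N" "v \<in> carrier_vec N"
  shows "wedge a b *\<^sub>v v = (b \<bullet> v) \<cdot>\<^sub>v a + (- (a \<bullet> v)) \<cdot>\<^sub>v b"
proof (rule eq_vecI)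
  fix r assume "r < dim_vec ((b \<bullet> v) \<cdot>\<^sub>v a + (- (a \<bullet> v)) \<cdot>\<^sub>v b)"
  then have r: "r < N" using assms by simp
  have "(wedge a b *\<^sub>v v) $ r = (\<Sum>k<N. (a $ r * b $ k - b $ r * a $ k) * v $ k)"
    using r by (simp add: mult_mat_vec_index[OF wedge_carrier[OF assms(1,2)] assms(3)] wedge_index[OF assms(1,2)])
  also have "\<dots> = a $ r * (\<Sum>k<N. b $ k * v $ k) - b $ r * (\<Sum>k<N. a $ k * v $ k)"
    by (simp add: sum_distrib_left sum_subtractf algebra_simps)
  also have "\<dots> = ((b \<bullet> v) \<cdot>\<^sub>v a + (- (a \<bullet> v)) \<cdot>\<^sub>v b) $ r"
    using r assms by (simp add: scalar_prod_def atLeast0LessThan)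
  finally show "(wedge a b *\<^sub>v v) $ r = ((b \<bullet> v) \<cdot>\<^sub>v a + (- (a \<bullet> v)) \<cdot>\<^sub>v b) $ r" .
qed (use assms in \<open>simp add: wedge_def\<close>)

lemma wedge_add_left:
  "\<lbrakk>a \<in> carrier_vec N; b \<in> carrier_vec N; c \<in> carrier_vec N\<rbrakk> \<Longrightarrow> wedge (a + b) c = wedge a c + wedge b c"
  by (intro eq_matI) (auto simp: wedge_def algebra_simps)

lemma wedge_smult_left:
  "\<lbrakk>a \<in> carrier_vec N; b \<in> carrier_vec N\<rbrakk> \<Longrightarrow> wedge (s \<cdot>\<^sub>v a) b = s \<cdot>\<^sub>m wedge a b"
  by (intro eq_matI) (auto simp: wedge_def algebra_simps)

lemma wedge_smult_right:
  "\<lbrakk>a \<in> carrier_vec N; b \<in> carrier_vec N\<rbrakk> \<Longrightarrow> wedge a (s \<cdot>\<^sub>v b) = s \<cdot>\<^sub>m wedge a b"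
  by (intro eq_matI) (auto simp: wedge_def algebra_simps)

lemma wedge_swap:
  "\<lbrakk>a \<in> carrier_vec N; b \<in> carrier_vec N\<rbrakk> \<Longrightarrow> wedge b a = (- 1) \<cdot>\<^sub>m wedge a b"
  by (intro eq_matI) (auto simp: wedge_def algebra_simps)

lemma isotropic_basis_carrier [simp]: "isotropic_basis n k \<in> carrier_vec (2 * n + 1)"
  by (simp add: isotropic_basis_def Let_def)

lemma isotropic_basis_dim [simp]: "dim_vec (isotropic_basis n k) = 2 * n + 1"
  using isotropic_basis_carrier by (rule carrier_vecD)

lemma unit_vec_isotropic_basis:
  assumes "i < 2 * n + 1"
  obtains p q s t where "p \<in> {1..2 * n + 1}" "q \<in> {1..2 * n + 1}"
    "unit_vec (2 * n + 1) i = s \<cdot>\<^sub>v isotropic_basis n p + t \<cdot>\<^sub>v isotropic_basis n q"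
proof -
  let ?c = "complex_of_real (1 / sqrt 2)"
  have c: "?c * ?c = 1 / 2" by (simp flip: of_real_mult)
  have c': "?c * (?c * x) = x / 2" "2 * (?c * ?c) = 1" for x
    using c by (simp_all add: mult.assoc[symmetric])
  consider "i < n" | j where "i = n + j" "j < n" | "i = 2 * n"
    using assms by (metis add_diff_inverse_nat add_less_cancel_left less_Suc_eq mult_2 Suc_eq_plus1)
  then show thesis
  proof cases
    case 1
    then have "unit_vec (2 * n + 1) i = ?c \<cdot>\<^sub>v isotropic_basis n (i + 1) + ?c \<cdot>\<^sub>v isotropic_basis n (n + (i + 1))"
      by (intro eq_vecI) (auto simp: isotropic_basis_def Let_def c' unit_vec_def simp del: of_real_divide)
    then show thesis using 1 by (intro that[of "i + 1" "n + (i + 1)"]) auto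
  next
    case 2
    then have "unit_vec (2 * n + 1) i = (\<i> * ?c) \<cdot>\<^sub>v isotropic_basis n (j + 1) + (- \<i> * ?c) \<cdot>\<^sub>v isotropic_basis n (n + (j + 1))"
      by (intro eq_vecI) (auto simp: isotropic_basis_def Let_def c' unit_vec_def mult.left_commute[of \<i> ?c] simp del: of_real_divide)
    then show thesis using 2 by (intro that[of "j + 1" "n + (j + 1)"]) auto
  next
    case 3
    then have "unit_vec (2 * n + 1) i = 1 \<cdot>\<^sub>v isotropic_basis n (2 * n + 1) + 0 \<cdot>\<^sub>v isotropic_basis n (2 * n + 1)"
      by (intro eq_vecI) (auto simp: isotropic_basis_def Let_def)
    then show thesis by (rule that[rotated 2]) auto
  qed
qed

lemma skew_mat_sum:
  assumes "X \<in> so N"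
  shows "X = mat_sum N (\<lambda>(r, c). (X $$ (r, c) / 2) \<cdot>\<^sub>m wedge (unit_vec N r) (unit_vec N c)) ({..<N} \<times> {..<N})"
    (is "X = ?S")
proof (rule eq_matI)
  let ?f = "\<lambda>(r, c). (X $$ (r, c) / 2) \<cdot>\<^sub>m wedge (unit_vec N r) (unit_vec N c)"
  have car: "?f i \<in> carrier_mat N N" for i
    by (cases i) (simp add: wedge_carrier)
  have S: "?S \<in> carrier_mat N N" by (intro mat_sum_index(1) car) simp
  then show "dim_row X = dim_row ?S" "dim_col X = dim_col ?S" using assms by (auto simp: so_iff)
  fix r c assume "r < dim_row ?S" "c < dim_col ?S"
  then have rc: "r < N" "c < N" using S by auto
  have "?S $$ (r, c) = (\<Sum>i\<in>{..<N} \<times> {..<N}. ?f i $$ (r, c))"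
    by (intro mat_sum_index(2) car rc) simp
  also have "\<dots> = (\<Sum>p\<in>{..<N} \<times> {..<N}. (if p = (r, c) then X $$ p / 2 else 0) - (if p = (c, r) then X $$ p / 2 else 0))"
  proof (rule sum.cong[OF refl])
    fix p assume "p \<in> {..<N} \<times> {..<N}"
    then obtain i j where p: "p = (i, j)" "i < N" "j < N" by auto
    have "unit_vec N k $ l = (if k = l then 1 else 0 :: complex)" if "k < N" "l < N" for k l
      using that by (auto simp: unit_vec_def)
    then have L: "?f p $$ (r, c) = X $$ p / 2 * ((if i = r then 1 else 0) * (if j = c then 1 else 0) -
        (if j = r then 1 else 0) * (if i = c then 1 else 0))"
      using rc p wedge_carrier[of "unit_vec N i" N "unit_vec N j"]
      by (simp add: wedge_index[of _ N])
    show "?f p $$ (r, c) = (if p = (r, c) then X $$ p / 2 else 0) - (if p = (c, r) then X $$ p / 2 else 0)"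
      unfolding L unfolding p(1) prod.inject
      by (cases "i = r"; cases "j = c"; cases "j = r"; cases "i = c"; simp)
  qed
  also have "\<dots> = X $$ (r, c) / 2 - X $$ (c, r) / 2"
    unfolding sum_subtractf by (subst (1 2) sum.delta) (use rc in auto)
  also have "\<dots> = X $$ (r, c)"
  proof -
    have "X $$ (c, r) = - X $$ (r, c)" using assms rc unfolding so_iff by blast
    then show ?thesis by (simp only:) simp
  qed
  finally show "X $$ (r, c) = ?S $$ (r, c)" by simp
qed

text \<open>
  Every \<open>u\<^sub>i\<close> is a combination of two isotropic basis vectors, so the wedges of the latter span the
  Lie algebra.
\<close>

lemma so_induct [consumes 1, case_names add smult basis]:
  assumes X: "X \<in> so (2 * n + 1)"
    and add: "\<And>X Y. \<lbrakk>X \<in> so (2 * n + 1); Y \<in> so (2 * n + 1); P X; P Y\<rbrakk> \<Longrightarrow> P (X + Y)"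
    and smult: "\<And>X c. \<lbrakk>X \<in> so (2 * n + 1); P X\<rbrakk> \<Longrightarrow> P (c \<cdot>\<^sub>m X)"
    and basis: "\<And>p q. \<lbrakk>p \<in> {1..2 * n + 1}; q \<in> {1..2 * n + 1}\<rbrakk> \<Longrightarrow> P (wedge (isotropic_basis n p) (isotropic_basis n q))"
  shows "P X"
proof -
  let ?N = "2 * n + 1"
  let ?e = "isotropic_basis n"
  note ws = wedge_so[where N = "?N"]
  have P1: "P (wedge a (?e q))" if "a = unit_vec ?N i" "i < ?N" "q \<in> {1..?N}" for a i q
  proof -
    obtain p p' s t where p: "p \<in> {1..?N}" "p' \<in> {1..?N}"
      and a: "unit_vec ?N i = s \<cdot>\<^sub>v ?e p + t \<cdot>\<^sub>v ?e p'"
      using unit_vec_isotropic_basis[OF \<open>i < ?N\<close>] by blast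
    have "wedge a (?e q) = s \<cdot>\<^sub>m wedge (?e p) (?e q) + t \<cdot>\<^sub>m wedge (?e p') (?e q)"
      unfolding that(1) a by (simp add: wedge_add_left[of _ ?N] wedge_smult_left[of _ ?N])
    then show ?thesis using that p by (simp add: add smult basis ws so_smult)
  qed
  have P2: "P (wedge a b)" if a: "a = unit_vec ?N i" "i < ?N" and b: "b = unit_vec ?N j" "j < ?N" for a b i j
  proof -
    obtain q q' s t where q: "q \<in> {1..?N}" "q' \<in> {1..?N}"
      and b': "unit_vec ?N j = s \<cdot>\<^sub>v ?e q + t \<cdot>\<^sub>v ?e q'"
      using unit_vec_isotropic_basis[OF \<open>j < ?N\<close>] by blast
    have car: "a \<in> carrier_vec ?N" "b \<in> carrier_vec ?N" using a b by auto
    have "wedge a b = (- 1) \<cdot>\<^sub>m wedge b a" by (rule wedge_swap[OF car(2,1)])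
    also have "\<dots> = (- 1) \<cdot>\<^sub>m (s \<cdot>\<^sub>m wedge (?e q) a + t \<cdot>\<^sub>m wedge (?e q') a)"
      unfolding b(1) b' using car by (simp add: wedge_add_left[of _ ?N] wedge_smult_left[of _ ?N])
    also have "\<dots> = (- 1) \<cdot>\<^sub>m (s \<cdot>\<^sub>m ((- 1) \<cdot>\<^sub>m wedge a (?e q)) + t \<cdot>\<^sub>m ((- 1) \<cdot>\<^sub>m wedge a (?e q')))"
      using car by (simp add: wedge_swap[of a ?N "?e q"] wedge_swap[of a ?N "?e q'"])
    finally show ?thesis using q a car by (simp add: add smult P1 ws so_smult so_add)
  qed
  have P0: "P (0\<^sub>m ?N ?N)"
  proof -
    have "0\<^sub>m ?N ?N = 0 \<cdot>\<^sub>m wedge (?e 1) (?e 1)"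
      using wedge_carrier[of "?e 1" ?N "?e 1"] by (intro eq_matI) auto
    then show ?thesis by (simp add: smult basis ws)
  qed
  have *: "P (mat_sum ?N f S) \<and> mat_sum ?N f S \<in> so ?N"
    if "finite S" "\<And>i. i \<in> S \<Longrightarrow> P (f i) \<and> f i \<in> so ?N" for S and f :: "nat \<times> nat \<Rightarrow> complex mat"
    using that
  proof (induction S rule: finite_induct)
    case empty
    interpret abelian_group "module_mat TYPE(complex) ?N ?N" by (rule abelian_group_mat)
    have "mat_sum ?N f {} = 0\<^sub>m ?N ?N" by (simp add: module_mat_simps)
    then show ?case using P0 by (auto simp: so_iff)
  next
    case (insert i S)
    interpret abelian_group "module_mat TYPE(complex) ?N ?N" by (rule abelian_group_mat)
    have "mat_sum ?N f (insert i S) = f i + mat_sum ?N f S"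
      using insert by (subst finsum_insert) (auto simp: module_mat_simps so_carrier)
    with insert show ?case by (simp add: add so_add)
  qed
  show ?thesis
    by (subst skew_mat_sum[OF X], rule *[THEN conjunct1]) (auto simp: P2 smult ws so_smult)
qed

lemma cplx_tor_so: "cplx (tor n a) \<in> so (2 * n + 1)"
proof -
  have "cplx (tor n a) $$ (r, c) = - cplx (tor n a) $$ (c, r)" if "r < 2 * n + 1" "c < 2 * n + 1" for r c
    using that carrier_matD[OF tor_carrier[of n a]] by (auto simp: tor_index)
  moreover have "cplx (tor n a) \<in> carrier_mat (2 * n + 1) (2 * n + 1)" by simp
  ultimately show ?thesis unfolding so_iff by blast
qed

text \<open>
  The weights \<open>L\<^sub>k\<close>, \<open>- L\<^sub>k\<close> and \<open>0\<close> of the isotropic basis in the standard representation.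
\<close>

definition basis_weight :: "nat \<Rightarrow> nat \<Rightarrow> real mat \<Rightarrow> complex" where
  "basis_weight n k = (if k \<le> n then L n k else if k \<le> 2 * n then (\<lambda>\<xi>. - L n (k - n) \<xi>) else (\<lambda>_. 0))"

lemma tor_isotropic_basis:
  assumes k: "k \<in> {1..2 * n + 1}"
  shows "cplx (tor n a) *\<^sub>v isotropic_basis n k = basis_weight n k (tor n a) \<cdot>\<^sub>v isotropic_basis n k"
proof (rule eq_vecI)
  let ?N = "2 * n + 1" and ?e = "isotropic_basis n k"
  let ?\<nu> = "\<lambda>i. if k = i then \<i> else if k = n + i then - \<i> else 0"
  note tc = carrier_matD[OF tor_carrier[of n a]]
  note ec = isotropic_basis_carrier[of n k]
  fix r assume "r < dim_vec (basis_weight n k (tor n a) \<cdot>\<^sub>v ?e)"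
  then have r: "r < ?N" using carrier_vecD[OF ec] by simp
  have Ec: "E n i \<in> carrier_mat ?N ?N" for i by (simp add: E_def)
  have "(cplx (tor n a) *\<^sub>v ?e) $ r = (\<Sum>c<?N. of_real (tor n a $$ (r, c)) * ?e $ c)"
    using r tc by (subst mult_mat_vec_index[of _ ?N]) (auto intro!: sum.cong)
  also have "\<dots> = (\<Sum>c<?N. \<Sum>i=1..n. of_real (a i) * (of_real (E n i $$ (r, c)) * ?e $ c))"
  proof (intro sum.cong refl)
    fix c assume "c \<in> {..<?N}"
    then have "tor n a $$ (r, c) = (\<Sum>i=1..n. a i * E n i $$ (r, c))"
      unfolding tor_def using r carrier_matD[OF Ec] Ec
      by (subst mat_sum_index(2)) auto
    then show "of_real (tor n a $$ (r, c)) * ?e $ c = (\<Sum>i=1..n. of_real (a i) * (of_real (E n i $$ (r, c)) * ?e $ c))"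
      by (simp add: sum_distrib_right mult.assoc)
  qed
  also have "\<dots> = (\<Sum>i=1..n. of_real (a i) * (\<Sum>c<?N. of_real (E n i $$ (r, c)) * ?e $ c))"
    by (subst sum.swap) (simp add: sum_distrib_left)
  also have "\<dots> = (\<Sum>i=1..n. of_real (a i) * (?\<nu> i * ?e $ r))"
  proof (intro sum.cong refl)
    fix i assume i: "i \<in> {1..n}"
    have "(\<Sum>c<?N. of_real (E n i $$ (r, c)) * ?e $ c) = (cplx (E n i) *\<^sub>v ?e) $ r"
      using r carrier_matD[OF Ec] by (subst mult_mat_vec_index[of _ ?N]) (auto intro!: sum.cong)
    also have "\<dots> = ?\<nu> i * ?e $ r"
      unfolding E_isotropic_basis[OF i k] by (rule index_smult_vec(1)) (simp only: carrier_vecD[OF ec] r)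
    finally show "of_real (a i) * (\<Sum>c<?N. of_real (E n i $$ (r, c)) * ?e $ c) = of_real (a i) * (?\<nu> i * ?e $ r)"
      by simp
  qed
  also have "\<dots> = (\<Sum>i=1..n. of_real (a i) * ?\<nu> i) * ?e $ r"
    by (simp add: sum_distrib_right mult.assoc)
  also have "(\<Sum>i=1..n. of_real (a i) * ?\<nu> i) = basis_weight n k (tor n a)"
  proof -
    consider "k \<le> n" | j where "j \<in> {1..n}" "k = n + j" | "k = 2 * n + 1"
    proof (cases "k \<le> n \<or> k = 2 * n + 1")
      case False
      then show thesis using k that(2)[of "k - n"] by auto
    qed (use that in auto)
    then show ?thesis
    proof cases
      case 1
      then have "(\<Sum>i=1..n. of_real (a i) * ?\<nu> i) = (\<Sum>i=1..n. if i = k then of_real (a k) * \<i> else 0)"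
        by (intro sum.cong) auto
      then show ?thesis using 1 k by (simp add: basis_weight_def L_tor)
    next
      case 2
      then have "(\<Sum>i=1..n. of_real (a i) * ?\<nu> i) = (\<Sum>i=1..n. if i = j then - (of_real (a j) * \<i>) else 0)"
        by (intro sum.cong) auto
      then show ?thesis using 2 by (simp add: basis_weight_def L_tor)
    next
      case 3
      then have "(\<Sum>i=1..n. of_real (a i) * ?\<nu> i) = 0" by (intro sum.neutral) auto
      then show ?thesis using 3 by (simp add: basis_weight_def)
    qed
  qed
  finally show "(cplx (tor n a) *\<^sub>v ?e) $ r = (basis_weight n k (tor n a) \<cdot>\<^sub>v ?e) $ r"
    using r carrier_vecD[OF ec] by simp
qed (use carrier_matD[OF tor_carrier[of n a]] carrier_vecD[OF isotropic_basis_carrier[of n k]] in simp)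

abbreviation root_vector :: "nat \<Rightarrow> nat \<Rightarrow> nat \<Rightarrow> complex mat" where
  "root_vector n p q \<equiv> wedge (isotropic_basis n p) (isotropic_basis n q)"

lemma root_vector_so: "root_vector n p q \<in> so (2 * n + 1)"
  by (intro wedge_so isotropic_basis_carrier)

lemma bracket_root_vector:
  assumes "p \<in> {1..2 * n + 1}" "q \<in> {1..2 * n + 1}"
  shows "bracket (cplx (tor n a)) (root_vector n p q) =
    (basis_weight n p (tor n a) + basis_weight n q (tor n a)) \<cdot>\<^sub>m root_vector n p q"
  unfolding bracket_wedge[OF cplx_tor_so isotropic_basis_carrier isotropic_basis_carrier]
    tor_isotropic_basis[OF assms(1)] tor_isotropic_basis[OF assms(2)]
    wedge_smult_left[OF isotropic_basis_carrier isotropic_basis_carrier]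
    wedge_smult_right[OF isotropic_basis_carrier isotropic_basis_carrier]
  by (intro eq_matI) (auto simp: algebra_simps)

lemma root_vector_root_space:
  assumes "p \<in> {1..2 * n + 1}" "q \<in> {1..2 * n + 1}"
    "\<And>a. basis_weight n p (tor n a) + basis_weight n q (tor n a) = \<alpha> (tor n a)"
  shows "root_vector n p q \<in> root_space n \<alpha>"
  using assms by (auto simp: root_space_def torus_eq_range_tor root_vector_so bracket_root_vector)

lemma isotropic_basis_index:
  assumes "r < 2 * n + 1"
  shows "i \<in> {1..n} \<Longrightarrow> isotropic_basis n i $ r =
      of_real (1 / sqrt 2) * ((if r = i - 1 then 1 else 0) - \<i> * (if r = n + i - 1 then 1 else 0))"
    and "i \<in> {1..n} \<Longrightarrow> isotropic_basis n (n + i) $ r =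
      of_real (1 / sqrt 2) * ((if r = i - 1 then 1 else 0) + \<i> * (if r = n + i - 1 then 1 else 0))"
    and "isotropic_basis n (2 * n + 1) $ r = (if r = 2 * n then 1 else 0)"
  using assms by (auto simp: isotropic_basis_def Let_def unit_vec_def)

text \<open>
  Among the wedges of distinct basis vectors, these are the ones of weight zero. They account for the
  torus in the root space decomposition.
\<close>

lemma root_vector_conjugate:
  assumes i: "i \<in> {1..n}"
  shows "root_vector n i (n + i) = (- \<i>) \<cdot>\<^sub>m cplx (E n i)"
proof (rule eq_matI)
  let ?c = "complex_of_real (1 / sqrt 2)"
  have c: "?c * ?c = 1 / 2" by (simp flip: of_real_mult)
  let ?d = "\<lambda>r s. if r = s then 1 else 0 :: complex"
  fix r c assume "r < dim_row ((- \<i>) \<cdot>\<^sub>m cplx (E n i))" "c < dim_col ((- \<i>) \<cdot>\<^sub>m cplx (E n i))"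
  then have rc: "r < 2 * n + 1" "c < 2 * n + 1" by (auto simp: E_def)
  have "root_vector n i (n + i) $$ (r, c) =
    ?c * (?d r (i - 1) - \<i> * ?d r (n + i - 1)) * (?c * (?d c (i - 1) + \<i> * ?d c (n + i - 1))) -
    ?c * (?d r (i - 1) + \<i> * ?d r (n + i - 1)) * (?c * (?d c (i - 1) - \<i> * ?d c (n + i - 1)))"
    by (simp only: wedge_index[OF isotropic_basis_carrier isotropic_basis_carrier rc]
      isotropic_basis_index(1,2)[OF rc(1) i] isotropic_basis_index(1,2)[OF rc(2) i])
  also have "\<dots> = (?c * ?c) * (2 * \<i> * (?d r (i - 1) * ?d c (n + i - 1) - ?d r (n + i - 1) * ?d c (i - 1)))"
    by (simp only: algebra_simps) simp
  also have "\<dots> = \<i> * (?d r (i - 1) * ?d c (n + i - 1) - ?d r (n + i - 1) * ?d c (i - 1))"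
    unfolding c by simp
  also have "\<dots> = ((- \<i>) \<cdot>\<^sub>m cplx (E n i)) $$ (r, c)"
  proof -
    have "i - 1 \<noteq> n + i - 1" using i by auto
    then show ?thesis using rc
      by (cases "r = i - 1"; cases "c = i - 1"; cases "r = n + i - 1"; cases "c = n + i - 1") (simp_all add: E_def)
  qed
  finally show "root_vector n i (n + i) $$ (r, c) = ((- \<i>) \<cdot>\<^sub>m cplx (E n i)) $$ (r, c)" .
qed (use wedge_carrier[OF isotropic_basis_carrier isotropic_basis_carrier] in \<open>auto simp: E_def\<close>)

text \<open>
  The \<open>sl(2)\<close> of the short root \<open>L\<^sub>i\<close>: the two root vectors act on weights by adding and subtracting
  \<open>L\<^sub>i\<close>, and the normalisation makes their bracket act on a vector of weight \<open>\<mu>\<close> by the \<open>i\<close>-th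
  coordinate of \<open>\<mu>\<close>.
\<close>

lemma bracket_short_root_vectors:
  assumes i: "i \<in> {1..n}"
  shows "bracket (root_vector n i (2 * n + 1)) ((- 1) \<cdot>\<^sub>m root_vector n (n + i) (2 * n + 1)) = (- \<i>) \<cdot>\<^sub>m cplx (E n i)"
proof -
  let ?a = "isotropic_basis n i" and ?b = "isotropic_basis n (n + i)" and ?c = "isotropic_basis n (2 * n + 1)"
  let ?N = "2 * n + 1"
  note car = isotropic_basis_carrier[of n]
  have form: "?a \<bullet> ?b = 1" "?a \<bullet> ?c = 0" "?b \<bullet> ?c = 0" "?c \<bullet> ?c = 1"
    using i by (auto simp: isotropic_basis_form)
  have "?c \<bullet> ?b = 0" using form(3) comm_scalar_prod[OF car car, of "2 * n + 1" "n + i"] by simp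
  then have b: "wedge ?a ?c *\<^sub>v ?b = (- 1) \<cdot>\<^sub>v ?c" and c: "wedge ?a ?c *\<^sub>v ?c = ?a"
    using wedge_mult_vec[OF car car car, of i "2 * n + 1" "n + i"] wedge_mult_vec[OF car car car, of i "2 * n + 1" "2 * n + 1"]
    by (auto simp: form intro!: eq_vecI)
  have "bracket (wedge ?a ?c) ((- 1) \<cdot>\<^sub>m wedge ?b ?c) = (- 1) \<cdot>\<^sub>m bracket (wedge ?a ?c) (wedge ?b ?c)"
    by (rule bracket_smult) (rule wedge_carrier[OF car car])+
  also have "bracket (wedge ?a ?c) (wedge ?b ?c) = wedge ((- 1) \<cdot>\<^sub>v ?c) ?c + wedge ?b ?a"
    unfolding bracket_wedge[OF root_vector_so car car] b c ..
  also have "\<dots> = (- 1) \<cdot>\<^sub>m wedge ?a ?b"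
    by (intro eq_matI) (auto simp: wedge_def algebra_simps)
  also have "(- 1) \<cdot>\<^sub>m ((- 1) \<cdot>\<^sub>m wedge ?a ?b) = wedge ?a ?b" by (intro eq_matI) auto
  also have "\<dots> = (- \<i>) \<cdot>\<^sub>m cplx (E n i)" by (rule root_vector_conjugate[OF i])
  finally show ?thesis .
qed

text \<open>
  The trichotomy for wedges of isotropic basis vectors on which all arguments over a basis rest. In the
  last case the weight is recorded because \<open>ad\<close> needs it, and the torus element because a weight vector
  of a representation is only known to be scaled by the torus.
\<close>

definition root_or_torus_vector :: "nat \<Rightarrow> complex mat \<Rightarrow> bool" where
  "root_or_torus_vector n X \<longleftrightarrow> (\<exists>\<alpha>\<in>positive_roots n. X \<in> root_space n \<alpha>) \<or>
     (\<exists>\<alpha>\<in>positive_roots n. X \<in> root_space n (\<lambda>\<xi>. - \<alpha> \<xi>)) \<or>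
     X \<in> root_space n (\<lambda>_. 0) \<and> (\<exists>c a. X = c \<cdot>\<^sub>m cplx (tor n a))"

lemma root_space_smult: "X \<in> root_space n \<alpha> \<Longrightarrow> c \<cdot>\<^sub>m X \<in> root_space n \<alpha>"
proof -
  assume X: "X \<in> root_space n \<alpha>"
  have "bracket (cplx \<xi>) (c \<cdot>\<^sub>m X) = \<alpha> \<xi> \<cdot>\<^sub>m (c \<cdot>\<^sub>m X)" if \<xi>: "\<xi> \<in> torus n" for \<xi>
  proof -
    have car: "cplx \<xi> \<in> carrier_mat (2 * n + 1) (2 * n + 1)" "X \<in> carrier_mat (2 * n + 1) (2 * n + 1)"
      using \<xi> X by (auto simp: torus_eq_range_tor root_space_def so_def)
    have "bracket (cplx \<xi>) (c \<cdot>\<^sub>m X) = c \<cdot>\<^sub>m bracket (cplx \<xi>) X"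
      unfolding bracket_def mult_smult_distrib[OF car] mult_smult_assoc_mat[OF car(2,1)]
      using car by (intro eq_matI) (auto simp: algebra_simps)
    also have "\<dots> = \<alpha> \<xi> \<cdot>\<^sub>m (c \<cdot>\<^sub>m X)"
      using X \<xi> by (simp add: root_space_def smult_smult_mat mult.commute)
    finally show ?thesis .
  qed
  with X show ?thesis by (simp add: root_space_def so_smult)
qed

lemma root_or_torus_vector_smult: "root_or_torus_vector n X \<Longrightarrow> root_or_torus_vector n (c \<cdot>\<^sub>m X)"
  unfolding root_or_torus_vector_def using root_space_smult by (metis smult_smult_mat)

lemma root_or_torus_root_vector_less:
  assumes pq: "1 \<le> p" "p < q" "q \<le> 2 * n + 1"
  shows "root_or_torus_vector n (root_vector n p q)"
proof -
  have rs: "root_vector n p q \<in> root_space n \<alpha>"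
    if "\<And>a. basis_weight n p (tor n a) + basis_weight n q (tor n a) = \<alpha> (tor n a)" for \<alpha>
    using pq that by (intro root_vector_root_space) auto
  consider "q \<le> n" | "p \<le> n" "n < q" "q \<le> 2 * n" "p < q - n" | "p \<le> n" "n < q" "q \<le> 2 * n" "q - n < p"
    | "p \<le> n" "q = n + p" | "p \<le> n" "q = 2 * n + 1" | "n < p" "q \<le> 2 * n" | "n < p" "q = 2 * n + 1"
    using pq by linarith
  then show ?thesis
  proof cases
    case 1
    with pq show ?thesis unfolding root_or_torus_vector_def
      by (intro disjI1 bexI[OF rs positive_rootI(2)[of p q]]) (auto simp: basis_weight_def)
  next
    case 2
    with pq show ?thesis unfolding root_or_torus_vector_def
      by (intro disjI1 bexI[OF rs positive_rootI(1)[of p "q - n"]]) (auto simp: basis_weight_def)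
  next
    case 3
    with pq show ?thesis unfolding root_or_torus_vector_def
      by (intro disjI2[OF disjI1] bexI[OF rs positive_rootI(1)[of "q - n" p]]) (auto simp: basis_weight_def)
  next
    case 4
    with pq show ?thesis unfolding root_or_torus_vector_def
      using root_vector_conjugate[of p n] E_eq_tor[of p n] rs[of "\<lambda>_. 0"]
      by (auto simp: basis_weight_def)
  next
    case 5
    with pq show ?thesis unfolding root_or_torus_vector_def
      by (intro disjI1 bexI[OF rs positive_rootI(3)[of p]]) (auto simp: basis_weight_def)
  next
    case 6
    with pq show ?thesis unfolding root_or_torus_vector_def
      by (intro disjI2[OF disjI1] bexI[OF rs positive_rootI(2)[of "p - n" "q - n"]]) (auto simp: basis_weight_def)
  next
    case 7
    with pq show ?thesis unfolding root_or_torus_vector_def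
      by (intro disjI2[OF disjI1] bexI[OF rs positive_rootI(3)[of "p - n"]]) (auto simp: basis_weight_def)
  qed
qed

lemma root_or_torus_root_vector:
  assumes "p \<in> {1..2 * n + 1}" "q \<in> {1..2 * n + 1}"
  shows "root_or_torus_vector n (root_vector n p q)"
proof (cases p q rule: linorder_cases)
  case less
  then show ?thesis using assms by (intro root_or_torus_root_vector_less) auto
next
  case equal
  let ?Z = "0\<^sub>m (2 * n + 1) (2 * n + 1) :: complex mat"
  have "root_vector n p q = ?Z" using equal by (intro eq_matI) (auto simp: wedge_def)
  moreover have "?Z = 0 \<cdot>\<^sub>m cplx (tor n (\<lambda>_. 0))"
    using carrier_matD[OF tor_carrier[of n "\<lambda>_. 0"]] by (intro eq_matI) auto
  moreover have "A * ?Z - ?Z * A = ?Z" if "A \<in> carrier_mat (2 * n + 1) (2 * n + 1)" for A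
    using that by simp
  from this[of "cplx (tor n _)"] have "?Z \<in> root_space n (\<lambda>_. 0)"
    unfolding root_space_def torus_eq_range_tor by (auto simp: so_iff bracket_def)
  ultimately show ?thesis unfolding root_or_torus_vector_def by metis
next
  case greater
  then have "root_or_torus_vector n (root_vector n q p)" using assms by (intro root_or_torus_root_vector_less) auto
  then show ?thesis
    by (subst wedge_swap[OF isotropic_basis_carrier isotropic_basis_carrier]) (rule root_or_torus_vector_smult)
qed

lemma simple_root_vector:
  assumes k: "k \<in> {1..n}"
  obtains X where "X \<in> root_space n (simple_root n k)" "X \<noteq> 0\<^sub>m (2 * n + 1) (2 * n + 1)"
proof (cases "k < n")
  case True
  have "root_vector n k (n + (k + 1)) \<in> root_space n (simple_root n k)"
    using k True by (intro root_vector_root_space) (auto simp: basis_weight_def simple_root_def)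
  moreover have "root_vector n k (n + (k + 1)) $$ (k - 1, k) \<noteq> 0"
  proof -
    have i: "k - 1 < 2 * n + 1" "k < 2 * n + 1" "k + 1 \<in> {1..n}" "k - 1 \<noteq> k" "k \<noteq> n + k - 1" "k - 1 \<noteq> n + (k + 1) - 1"
       "k \<noteq> n + (k + 1) - 1" "k - 1 \<noteq> n + k - 1" using k True by auto
    show ?thesis
      unfolding wedge_index[OF isotropic_basis_carrier isotropic_basis_carrier i(1,2)]
        isotropic_basis_index(1)[OF i(1) k] isotropic_basis_index(1)[OF i(2) k]
        isotropic_basis_index(2)[OF i(1,3)] isotropic_basis_index(2)[OF i(2,3)]
      using i by simp
  qed
  ultimately show thesis using k True by (intro that) auto
next
  case False
  with k have kn: "k = n" "n \<in> {1..n}" by auto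
  have "root_vector n n (2 * n + 1) \<in> root_space n (simple_root n k)"
    using kn by (intro root_vector_root_space) (auto simp: basis_weight_def simple_root_def)
  moreover have "root_vector n n (2 * n + 1) $$ (n - 1, 2 * n) \<noteq> 0"
  proof -
    have i: "n - 1 < 2 * n + 1" "2 * n < 2 * n + 1" "2 * n \<noteq> n - 1" "2 * n \<noteq> n + n - 1" "n - 1 \<noteq> n + n - 1"
      using kn by auto
    show ?thesis
      unfolding wedge_index[OF isotropic_basis_carrier isotropic_basis_carrier i(1,2)]
        isotropic_basis_index(1)[OF i(1) kn(2)] isotropic_basis_index(1)[OF i(2) kn(2)]
        isotropic_basis_index(3)[OF i(1)] isotropic_basis_index(3)[OF i(2)]
      using i by simp
  qed
  ultimately show thesis using kn by (intro that) auto
qed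

section \<open>The order on the unit lattice\<close>

lemma ad_eigenvector_iff:
  assumes "A \<in> carrier_mat N N" "X \<in> carrier_mat N N"
  shows "bracket A X + (- c) \<cdot>\<^sub>m X = 0\<^sub>m N N \<longleftrightarrow> bracket A X = c \<cdot>\<^sub>m X"
proof
  note car = carrier_matD[OF bracket_carrier[OF assms]] carrier_matD[OF assms(2)]
  assume eq: "bracket A X + (- c) \<cdot>\<^sub>m X = 0\<^sub>m N N"
  show "bracket A X = c \<cdot>\<^sub>m X"
  proof (rule eq_matI)
    fix r s assume "r < dim_row (c \<cdot>\<^sub>m X)" "s < dim_col (c \<cdot>\<^sub>m X)"
    then show "bracket A X $$ (r, s) = (c \<cdot>\<^sub>m X) $$ (r, s)"
      using arg_cong[OF eq, of "\<lambda>M. M $$ (r, s)"] car by simp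
  qed (use car in auto)
next
  assume "bracket A X = c \<cdot>\<^sub>m X"
  then show "bracket A X + (- c) \<cdot>\<^sub>m X = 0\<^sub>m N N"
    using assms by (intro eq_matI) auto
qed

lemma shifted_operator_ad:
  assumes A: "A \<in> carrier_mat N N"
  shows "shifted_operator (carrier_mat N N) (+) (\<cdot>\<^sub>m) (0\<^sub>m N N) (\<lambda>c X. bracket A X + (- c) \<cdot>\<^sub>m X)"
proof
  note bc = bracket_carrier[OF A]
  show "bracket A (0\<^sub>m N N) + (- l) \<cdot>\<^sub>m (0\<^sub>m N N) = 0\<^sub>m N N" for l
    using A by (intro eq_matI) (auto simp: bracket_def)
  fix X Y :: "complex mat" assume X: "X \<in> carrier_mat N N"
  show "bracket A X + (- l) \<cdot>\<^sub>m X \<in> carrier_mat N N" for l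
    using bc[OF X] X by simp
  show "bracket A (c \<cdot>\<^sub>m X) + (- l) \<cdot>\<^sub>m (c \<cdot>\<^sub>m X) = c \<cdot>\<^sub>m (bracket A X + (- l) \<cdot>\<^sub>m X)" for c l
    unfolding bracket_smult[OF A X] using bc[OF X] X by (intro eq_matI) (auto simp: algebra_simps)
  show "bracket A (bracket A X + (- k) \<cdot>\<^sub>m X) + (- l) \<cdot>\<^sub>m (bracket A X + (- k) \<cdot>\<^sub>m X) =
      bracket A (bracket A X + (- l) \<cdot>\<^sub>m X) + (- k) \<cdot>\<^sub>m (bracket A X + (- l) \<cdot>\<^sub>m X)" for k l
  proof -
    have *: "bracket A (bracket A X + (- k) \<cdot>\<^sub>m X) = bracket A (bracket A X) + (- k) \<cdot>\<^sub>m bracket A X" for k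
      using bracket_add[OF A bc[OF X]] bracket_smult[OF A X] X by simp
    show ?thesis unfolding * using bc[OF bc[OF X]] bc[OF X] X
      by (intro eq_matI) (auto simp: algebra_simps)
  qed
  show "bracket A X + (- l) \<cdot>\<^sub>m X = (c - l) \<cdot>\<^sub>m X" if "bracket A X + (- c) \<cdot>\<^sub>m X = 0\<^sub>m N N" for c l
    using that X unfolding ad_eigenvector_iff[OF A X] by (intro eq_matI) (auto simp: algebra_simps)
  show "X = 0\<^sub>m N N" if "c \<cdot>\<^sub>m X = 0\<^sub>m N N" "c \<noteq> 0" for c
  proof (rule eq_matI)
    fix r s assume "r < dim_row (0\<^sub>m N N :: complex mat)" "s < dim_col (0\<^sub>m N N :: complex mat)"
    then show "X $$ (r, s) = 0\<^sub>m N N $$ (r, s)"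
      using arg_cong[OF that(1), of "\<lambda>M. M $$ (r, s)"] X that(2) by simp
  qed (use X in auto)
  assume Y: "Y \<in> carrier_mat N N"
  show "bracket A (X + Y) + (- l) \<cdot>\<^sub>m (X + Y) = (bracket A X + (- l) \<cdot>\<^sub>m X) + (bracket A Y + (- l) \<cdot>\<^sub>m Y)" for l
    unfolding bracket_add[OF A X Y] using bc[OF X] bc[OF Y] X Y by (intro eq_matI) (auto simp: algebra_simps)
qed auto

lemma eigenspace_ad_iff_ad_eigenvector:
  assumes "cplx \<xi> \<in> carrier_mat (2 * n + 1) (2 * n + 1)"
  shows "X \<in> eigenspace_ad n \<xi> j \<longleftrightarrow> X \<in> so (2 * n + 1) \<and>
    bracket (cplx \<xi>) X + (- (\<i> * of_int j)) \<cdot>\<^sub>m X = 0\<^sub>m (2 * n + 1) (2 * n + 1)"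
  using ad_eigenvector_iff[OF assms] by (auto simp: eigenspace_ad_def dest: so_carrier)

lemma eigenspace_ad_carrier: "X \<in> eigenspace_ad n \<xi> j \<Longrightarrow> X \<in> carrier_mat (2 * n + 1) (2 * n + 1)"
  by (simp add: eigenspace_ad_def so_def)

lemma eigenspace_ad_smult:
  assumes "cplx \<xi> \<in> carrier_mat (2 * n + 1) (2 * n + 1)" "X \<in> eigenspace_ad n \<xi> j"
  shows "c \<cdot>\<^sub>m X \<in> eigenspace_ad n \<xi> j"
  using assms bracket_smult[OF assms(1) eigenspace_ad_carrier[OF assms(2)]]
  by (simp add: eigenspace_ad_def so_smult smult_smult_mat mult.commute)

lemma eigenspace_ad_add:
  assumes "cplx \<xi> \<in> carrier_mat (2 * n + 1) (2 * n + 1)" "X \<in> eigenspace_ad n \<xi> j" "Y \<in> eigenspace_ad n \<xi> j"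
  shows "X + Y \<in> eigenspace_ad n \<xi> j"
  using assms bracket_add[OF assms(1) assms(2,3)[THEN eigenspace_ad_carrier]]
    add_smult_distrib_left_mat[OF assms(2,3)[THEN eigenspace_ad_carrier]]
  by (simp add: eigenspace_ad_def so_add)

lemma mat_sum_singleton: "X \<in> carrier_mat N N \<Longrightarrow> mat_sum N (\<lambda>_. X) {j} = X"
  using mat_sum_index[of "{j}" "\<lambda>_. X" N] by (intro eq_matI) auto

lemma eigenspace_ad_subset_parabolic:
  assumes "X \<in> eigenspace_ad n \<xi> j" "j \<le> i"
  shows "X \<in> parabolic n \<xi> i"
  unfolding parabolic_def using assms mat_sum_singleton[OF eigenspace_ad_carrier[OF assms(1)], of j]
  by (auto intro!: exI[of _ "\<lambda>_. X"] exI[of _ "{j}"])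

lemma zero_eigenspace_ad:
  assumes "cplx \<xi> \<in> carrier_mat (2 * n + 1) (2 * n + 1)"
  shows "0\<^sub>m (2 * n + 1) (2 * n + 1) \<in> eigenspace_ad n \<xi> j"
  using assms by (auto simp: eigenspace_ad_def bracket_def so_iff)

lemma parabolic_smult:
  assumes \<xi>: "cplx \<xi> \<in> carrier_mat (2 * n + 1) (2 * n + 1)" and "X \<in> parabolic n \<xi> i"
  shows "c \<cdot>\<^sub>m X \<in> parabolic n \<xi> i"
proof -
  let ?N = "2 * n + 1"
  obtain F J where F: "finite J" "J \<subseteq> {..i}" "\<And>j. j \<in> J \<Longrightarrow> F j \<in> eigenspace_ad n \<xi> j"
    "X = mat_sum ?N F J" using assms(2) unfolding parabolic_def by blast
  note Fc = F(3)[THEN eigenspace_ad_carrier]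
  have cF: "c \<cdot>\<^sub>m F j \<in> eigenspace_ad n \<xi> j" if "j \<in> J" for j
    using eigenspace_ad_smult[OF \<xi> F(3)[OF that]] .
  have cFc: "c \<cdot>\<^sub>m F j \<in> carrier_mat ?N ?N" if "j \<in> J" for j
    using Fc[OF that] by simp
  have cS: "mat_sum ?N (\<lambda>j. c \<cdot>\<^sub>m F j) J \<in> carrier_mat ?N ?N"
    by (intro mat_sum_index(1) F(1) cFc)
  have S: "mat_sum ?N F J \<in> carrier_mat ?N ?N"
    by (intro mat_sum_index(1) F(1) Fc)
  have "c \<cdot>\<^sub>m X = mat_sum ?N (\<lambda>j. c \<cdot>\<^sub>m F j) J"
  proof (rule eq_matI)
    fix r s assume "r < dim_row (mat_sum ?N (\<lambda>j. c \<cdot>\<^sub>m F j) J)" "s < dim_col (mat_sum ?N (\<lambda>j. c \<cdot>\<^sub>m F j) J)"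
    then have rs: "r < ?N" "s < ?N" using cS by auto
    have "mat_sum ?N (\<lambda>j. c \<cdot>\<^sub>m F j) J $$ (r, s) = (\<Sum>j\<in>J. (c \<cdot>\<^sub>m F j) $$ (r, s))"
      by (intro mat_sum_index(2) F(1) cFc rs)
    also have "\<dots> = (\<Sum>j\<in>J. c * F j $$ (r, s))"
      using rs carrier_matD[OF Fc] by (intro sum.cong refl index_smult_mat(1)) auto
    also have "\<dots> = c * mat_sum ?N F J $$ (r, s)"
      by (subst mat_sum_index(2)) (auto simp: F(1) Fc rs sum_distrib_left)
    finally show "(c \<cdot>\<^sub>m X) $$ (r, s) = mat_sum ?N (\<lambda>j. c \<cdot>\<^sub>m F j) J $$ (r, s)"
      using rs S F(4) by simp
  qed (use cS S F(4) in auto)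
  then show ?thesis unfolding parabolic_def using F cF by blast
qed

text \<open>
  Two families of eigenvectors are first extended by zero to a common finite set of eigenvalues.
\<close>

lemma parabolic_add:
  assumes \<xi>: "cplx \<xi> \<in> carrier_mat (2 * n + 1) (2 * n + 1)"
    and "X \<in> parabolic n \<xi> i" "Y \<in> parabolic n \<xi> i"
  shows "X + Y \<in> parabolic n \<xi> i"
proof -
  let ?N = "2 * n + 1"
  let ?ext = "\<lambda>F J j. if j \<in> J then F j else 0\<^sub>m ?N ?N"
  have ext: "X = mat_sum ?N (?ext F J) (J \<union> K) \<and> (\<forall>j. ?ext F J j \<in> eigenspace_ad n \<xi> j)"
    if F: "finite J" "\<And>j. j \<in> J \<Longrightarrow> F j \<in> eigenspace_ad n \<xi> j" "X = mat_sum ?N F J" and K: "finite K"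
    for F :: "int \<Rightarrow> complex mat" and J K X
  proof -
    note Fc = F(2)[THEN eigenspace_ad_carrier]
    have eF: "?ext F J j \<in> eigenspace_ad n \<xi> j" for j
      using F(2) zero_eigenspace_ad[OF \<xi>] by simp
    note eFc = eF[THEN eigenspace_ad_carrier]
    have fin: "finite (J \<union> K)" using F K by simp
    have S: "mat_sum ?N (?ext F J) (J \<union> K) \<in> carrier_mat ?N ?N" "mat_sum ?N F J \<in> carrier_mat ?N ?N"
      by (intro mat_sum_index(1) fin F(1) eFc Fc; assumption)+
    have "X = mat_sum ?N (?ext F J) (J \<union> K)"
    proof (rule eq_matI)
      fix r s assume "r < dim_row (mat_sum ?N (?ext F J) (J \<union> K))" "s < dim_col (mat_sum ?N (?ext F J) (J \<union> K))"
      then have rs: "r < ?N" "s < ?N" using S by auto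
      have "mat_sum ?N (?ext F J) (J \<union> K) $$ (r, s) = (\<Sum>j\<in>J \<union> K. ?ext F J j $$ (r, s))"
        by (intro mat_sum_index(2) fin eFc rs)
      also have "\<dots> = (\<Sum>j\<in>J. F j $$ (r, s))"
        using fin rs by (intro sum.mono_neutral_cong_right) auto
      also have "\<dots> = X $$ (r, s)"
        unfolding F(3) by (intro mat_sum_index(2)[symmetric] F(1) Fc rs)
      finally show "X $$ (r, s) = mat_sum ?N (?ext F J) (J \<union> K) $$ (r, s)" ..
    qed (use S F(3) in auto)
    with eF show ?thesis by blast
  qed
  obtain F J where F: "finite J" "J \<subseteq> {..i}" "\<And>j. j \<in> J \<Longrightarrow> F j \<in> eigenspace_ad n \<xi> j"
    "X = mat_sum ?N F J" using assms(2) unfolding parabolic_def by blast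
  obtain G K where G: "finite K" "K \<subseteq> {..i}" "\<And>j. j \<in> K \<Longrightarrow> G j \<in> eigenspace_ad n \<xi> j"
    "Y = mat_sum ?N G K" using assms(3) unfolding parabolic_def by blast
  let ?F = "?ext F J" and ?G = "?ext G K"
  have X: "X = mat_sum ?N ?F (J \<union> K)" and F': "?F j \<in> eigenspace_ad n \<xi> j" for j
    using ext[OF F(1,3,4) G(1)] by blast+
  have Y: "Y = mat_sum ?N ?G (J \<union> K)" and G': "?G j \<in> eigenspace_ad n \<xi> j" for j
    using ext[OF G(1,3,4) F(1)] by (simp_all add: Un_commute)
  note FG = eigenspace_ad_add[OF \<xi> F' G']
  note c = F'[THEN eigenspace_ad_carrier] G'[THEN eigenspace_ad_carrier] FG[THEN eigenspace_ad_carrier]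
  have fin: "finite (J \<union> K)" using F G by simp
  have S: "mat_sum ?N ?F (J \<union> K) \<in> carrier_mat ?N ?N" "mat_sum ?N ?G (J \<union> K) \<in> carrier_mat ?N ?N"
    "mat_sum ?N (\<lambda>j. ?F j + ?G j) (J \<union> K) \<in> carrier_mat ?N ?N"
    by (intro mat_sum_index(1)[OF fin] c)+
  have "X + Y = mat_sum ?N (\<lambda>j. ?F j + ?G j) (J \<union> K)"
  proof (rule eq_matI)
    fix r s assume "r < dim_row (mat_sum ?N (\<lambda>j. ?F j + ?G j) (J \<union> K))" "s < dim_col (mat_sum ?N (\<lambda>j. ?F j + ?G j) (J \<union> K))"
    then have rs: "r < ?N" "s < ?N" using S(3) by auto
    have "(?F j + ?G j) $$ (r, s) = ?F j $$ (r, s) + ?G j $$ (r, s)" for j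
      using rs carrier_matD[OF c(2)] by (intro index_add_mat(1)) simp_all
    moreover have "mat_sum ?N (\<lambda>j. ?F j + ?G j) (J \<union> K) $$ (r, s) = (\<Sum>j\<in>J \<union> K. (?F j + ?G j) $$ (r, s))"
      "mat_sum ?N ?F (J \<union> K) $$ (r, s) = (\<Sum>j\<in>J \<union> K. ?F j $$ (r, s))"
      "mat_sum ?N ?G (J \<union> K) $$ (r, s) = (\<Sum>j\<in>J \<union> K. ?G j $$ (r, s))"
      by (intro mat_sum_index(2) fin c rs)+
    moreover have "(X + Y) $$ (r, s) = X $$ (r, s) + Y $$ (r, s)"
      unfolding X Y using rs carrier_matD[OF S(2)] by (intro index_add_mat(1)) simp_all
    ultimately show "(X + Y) $$ (r, s) = mat_sum ?N (\<lambda>j. ?F j + ?G j) (J \<union> K) $$ (r, s)"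
      unfolding X Y by (simp only: sum.distrib)
  qed (use S X Y in \<open>auto simp del: Un_iff\<close>)
  moreover have "\<forall>j\<in>J \<union> K. ?F j + ?G j \<in> eigenspace_ad n \<xi> j" using FG by blast
  moreover have "J \<union> K \<subseteq> {..i}" using F G by blast
  ultimately show ?thesis unfolding parabolic_def using fin
    by (intro CollectI exI[of _ "\<lambda>j. ?F j + ?G j"] exI[of _ "J \<union> K"] conjI)
qed

lemma parabolic_so: "X \<in> parabolic n \<xi> i \<Longrightarrow> X \<in> so (2 * n + 1)"
  unfolding parabolic_def eigenspace_ad_def by (auto intro!: mat_sum_so)

lemma zero_parabolic:
  assumes "cplx \<xi> \<in> carrier_mat (2 * n + 1) (2 * n + 1)"
  shows "0\<^sub>m (2 * n + 1) (2 * n + 1) \<in> parabolic n \<xi> i"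
  using eigenspace_ad_subset_parabolic[OF zero_eigenspace_ad[OF assms] order_refl] .

lemma parabolic_subset_eigensum:
  fixes \<xi> :: "real mat" and n :: nat
  defines "N \<equiv> 2 * n + 1"
  assumes \<xi>: "cplx \<xi> \<in> carrier_mat N N" and X: "X \<in> parabolic n \<xi> i"
  shows "X \<in> shifted_operator.eigensum (carrier_mat N N) (0\<^sub>m N N) (\<lambda>c X. bracket (cplx \<xi>) X + (- c) \<cdot>\<^sub>m X)
    ((\<lambda>j. \<i> * of_int j) ` {..i})" (is "X \<in> ?K")
proof -
  interpret shifted_operator "carrier_mat N N" "(+)" "(\<cdot>\<^sub>m)" "0\<^sub>m N N" "\<lambda>c X. bracket (cplx \<xi>) X + (- c) \<cdot>\<^sub>m X"
    by (rule shifted_operator_ad[OF \<xi>])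
  obtain F J where F: "finite J" "J \<subseteq> {..i}" "\<And>j. j \<in> J \<Longrightarrow> F j \<in> eigenspace_ad n \<xi> j"
    "X = mat_sum N F J" using X unfolding parabolic_def N_def by blast
  have "mat_sum N F J \<in> ?K"
    using F(1-3)
  proof (induction J rule: finite_induct)
    case empty
    interpret abelian_group "module_mat TYPE(complex) N N" by (rule abelian_group_mat)
    have "mat_sum N F {} = 0\<^sub>m N N" by (simp add: module_mat_simps)
    then show ?case by (simp add: eigensum.zero)
  next
    case (insert j J)
    interpret abelian_group "module_mat TYPE(complex) N N" by (rule abelian_group_mat)
    have "F k \<in> carrier_mat N N" if "k \<in> insert j J" for k
      using insert.prems(2)[OF that] eigenspace_ad_carrier unfolding N_def by blast
    then have "mat_sum N F (insert j J) = F j + mat_sum N F J"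
      using insert.hyps by (subst finsum_insert) (auto simp: module_mat_simps)
    moreover have "F j \<in> ?K"
      using insert.prems(2)[of j] insert.prems(1) \<xi>
      by (intro eigensumI[of _ "\<i> * of_int j"]) (auto simp: eigenspace_ad_iff_ad_eigenvector N_def dest: so_carrier)
    moreover have "mat_sum N F J \<in> ?K" using insert by auto
    ultimately show ?case using eigensum_add by simp
  qed
  with F(4) show ?thesis by simp
qed

lemma cplx_simple_coords_carrier: "cplx (simple_coords n a) \<in> carrier_mat (2 * n + 1) (2 * n + 1)"
  by (simp add: simple_coords_def)

lemma eigenvalue_le_of_parabolic:
  assumes \<xi>: "cplx \<xi> \<in> carrier_mat (2 * n + 1) (2 * n + 1)"
    and X: "X \<in> eigenspace_ad n \<xi> j" "X \<in> parabolic n \<xi> i" "X \<noteq> 0\<^sub>m (2 * n + 1) (2 * n + 1)"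
  shows "j \<le> i"
proof -
  define N where "N = 2 * n + 1"
  interpret shifted_operator "carrier_mat N N" "(+)" "(\<cdot>\<^sub>m)" "0\<^sub>m N N" "\<lambda>c X. bracket (cplx \<xi>) X + (- c) \<cdot>\<^sub>m X"
    unfolding N_def by (rule shifted_operator_ad[OF \<xi>])
  have "\<i> * of_int j \<in> (\<lambda>j. \<i> * of_int j) ` {..i}"
    using X parabolic_subset_eigensum[OF \<xi> X(2)]
    by (intro eigenvalue_of_eigensum[of X]) (auto simp: eigenspace_ad_iff_ad_eigenvector[OF \<xi>] N_def)
  then show ?thesis by auto
qed

lemma root_space_eigenspace:
  assumes "X \<in> root_space n \<alpha>" "\<xi> \<in> torus n" "\<alpha> \<xi> = \<i> * of_int j"
  shows "X \<in> eigenspace_ad n \<xi> j"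
  using assms by (auto simp: root_space_def eigenspace_ad_def)

text \<open>
  Lowering the coordinates does not raise the eigenvalue at a positive root, and at other roots the
  eigenvalues are nonpositive before and after.
\<close>

lemma root_or_torus_vector_eigenvalues:
  assumes "root_or_torus_vector n X" and X: "X \<in> so (2 * n + 1)" and le: "\<And>k. k \<in> {1..n} \<Longrightarrow> m' k \<le> m k"
  obtains h h' where "X \<in> eigenspace_ad n (simple_coords n (\<lambda>k. real (m k))) h"
    "X \<in> eigenspace_ad n (simple_coords n (\<lambda>k. real (m' k))) h'" "h' \<le> h \<or> h' \<le> 0 \<and> h \<le> 0"
proof -
  have root: "\<exists>h h' :: nat. h' \<le> h \<and> \<alpha> (simple_coords n (\<lambda>k. real (m k))) = \<i> * of_int (int h) \<and>
      \<alpha> (simple_coords n (\<lambda>k. real (m' k))) = \<i> * of_int (int h')" if \<alpha>: "\<alpha> \<in> positive_roots n" for \<alpha>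
  proof -
    obtain c :: "nat \<Rightarrow> nat" where c: "\<And>a. \<alpha> (simple_coords n a) = \<i> * of_real (\<Sum>l=1..n. real (c l) * a l)"
      using positive_root_simple_coords[OF \<alpha>] by blast
    show ?thesis
      by (intro exI[of _ "\<Sum>l=1..n. c l * m l"] exI[of _ "\<Sum>l=1..n. c l * m' l"])
        (auto simp: c intro!: sum_mono le)
  qed
  from assms(1) consider \<alpha> where "\<alpha> \<in> positive_roots n" "X \<in> root_space n \<alpha>"
    | \<alpha> where "\<alpha> \<in> positive_roots n" "X \<in> root_space n (\<lambda>\<xi>. - \<alpha> \<xi>)"
    | "X \<in> root_space n (\<lambda>_. 0)"
    unfolding root_or_torus_vector_def by blast
  then show thesis
  proof cases
    case 1
    with root[OF 1(1)] obtain h h' :: nat where h: "h' \<le> h" "\<alpha> (simple_coords n (\<lambda>k. real (m k))) = \<i> * of_int (int h)"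
      "\<alpha> (simple_coords n (\<lambda>k. real (m' k))) = \<i> * of_int (int h')" by blast
    note h(2,3)[THEN root_space_eigenspace[OF 1(2) simple_coords_torus]]
    with h(1) show thesis by (intro that[of "int h" "int h'"]) auto
  next
    case 2
    with root[OF 2(1)] obtain h h' :: nat where h: "h' \<le> h" "\<alpha> (simple_coords n (\<lambda>k. real (m k))) = \<i> * of_int (int h)"
      "\<alpha> (simple_coords n (\<lambda>k. real (m' k))) = \<i> * of_int (int h')" by blast
    have "- \<alpha> (simple_coords n (\<lambda>k. real (m k))) = \<i> * of_int (- int h)"
      "- \<alpha> (simple_coords n (\<lambda>k. real (m' k))) = \<i> * of_int (- int h')"
      unfolding h(2,3) of_int_minus mult_minus_right by (rule refl)+
    note this[THEN root_space_eigenspace[OF 2(2) simple_coords_torus]]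
    then show thesis by (intro that[of "- int h" "- int h'"]) auto
  next
    case 3
    then have "X \<in> eigenspace_ad n (simple_coords n a') 0" for a'
      by (intro root_space_eigenspace simple_coords_torus) auto
    then show thesis by (intro that[of 0 0]) auto
  qed
qed

text \<open>
  In one direction, a root vector of the simple root \<open>\<alpha>\<^sub>k\<close> has eigenvalue \<open>\<i> m\<^sub>k\<close> and lies in the
  parabolic subalgebra of that index, which bounds its eigenvalue \<open>\<i> m'\<^sub>k\<close> for \<open>\<xi>'\<close>. In the other direction, each
  root vector in a parabolic subalgebra of \<open>\<xi>\<close> also lies in that of \<open>\<xi>'\<close>, and an element of the former
  has no component along the other root vectors.
\<close>

lemma lattice_le_simple_coords_iff:
  fixes m m' :: "nat \<Rightarrow> nat"
  shows "lattice_le n (simple_coords n (\<lambda>k. real (m k))) (simple_coords n (\<lambda>k. real (m' k))) \<longleftrightarrow>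
    (\<forall>k\<in>{1..n}. m' k \<le> m k)"
    (is "lattice_le n ?\<xi> ?\<xi>' \<longleftrightarrow> _")
proof
  assume le: "lattice_le n ?\<xi> ?\<xi>'"
  show "\<forall>k\<in>{1..n}. m' k \<le> m k"
  proof
    fix k assume k: "k \<in> {1..n}"
    then obtain X where X: "X \<in> root_space n (simple_root n k)" "X \<noteq> 0\<^sub>m (2 * n + 1) (2 * n + 1)"
      by (rule simple_root_vector)
    have e: "X \<in> eigenspace_ad n (simple_coords n (\<lambda>k. real (m k))) (int (m k))" for m :: "nat \<Rightarrow> nat"
      by (intro root_space_eigenspace[OF X(1) simple_coords_torus]) (simp add: simple_root_simple_coords[OF k])
    have "X \<in> parabolic n ?\<xi> (int (m k))" by (rule eigenspace_ad_subset_parabolic[OF e order_refl])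
    then have "X \<in> parabolic n ?\<xi>' (int (m k))" using le unfolding lattice_le_def
      by (metis of_nat_0_le_iff subsetD)
    with eigenvalue_le_of_parabolic[OF cplx_simple_coords_carrier e] X show "m' k \<le> m k" by fastforce
  qed
next
  assume le: "\<forall>k\<in>{1..n}. m' k \<le> m k"
  define N where "N = 2 * n + 1"
  note \<xi> = cplx_simple_coords_carrier[of n "\<lambda>k. real (m k)", folded N_def]
  note \<xi>' = cplx_simple_coords_carrier[of n "\<lambda>k. real (m' k)", folded N_def]
  interpret shifted_operator "carrier_mat N N" "(+)" "(\<cdot>\<^sub>m)" "0\<^sub>m N N"
      "\<lambda>c X. bracket (cplx ?\<xi>) X + (- c) \<cdot>\<^sub>m X"
    by (rule shifted_operator_ad[OF \<xi>])
  show "lattice_le n ?\<xi> ?\<xi>'"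
    unfolding lattice_le_def
  proof (intro allI impI subsetI)
    fix i :: int and X assume i: "0 \<le> i" and X: "X \<in> parabolic n ?\<xi> i"
    let ?low = "(\<lambda>j. \<i> * of_int j) ` {..i}" and ?high = "(\<lambda>j. \<i> * of_int j) ` {i<..}"
    have low: "Y \<in> eigensum ?low" if "Y \<in> parabolic n ?\<xi> i" for Y
      using parabolic_subset_eigensum[OF \<xi>[unfolded N_def] that] by (simp add: N_def)
    \<comment> \<open>split off the part on root vectors with \<open>ad \<xi>\<close>-eigenvalue beyond \<open>\<i> * of_int i\<close>\<close>
    define P where "P X \<longleftrightarrow> (\<exists>Y Z. X = Y + Z \<and> Y \<in> parabolic n ?\<xi> i \<and> Y \<in> parabolic n ?\<xi>' i \<and>
        Y \<in> carrier_mat N N \<and> Z \<in> eigensum ?high)" for X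
    have "X \<in> carrier_mat N N" using low[OF X] by (rule eigensum_closed)
    have zp: "0\<^sub>m N N \<in> parabolic n ?\<xi> i" "0\<^sub>m N N \<in> parabolic n ?\<xi>' i"
      using zero_parabolic \<xi> \<xi>' unfolding N_def by blast+
    have "P X" if "X \<in> so (2 * n + 1)" for X
      using that
    proof (induction rule: so_induct)
      case (add X X')
      then obtain Y Z Y' Z' where *: "X = Y + Z" "Y \<in> parabolic n ?\<xi> i" "Y \<in> parabolic n ?\<xi>' i"
        "Y \<in> carrier_mat N N" "Z \<in> eigensum ?high" "X' = Y' + Z'" "Y' \<in> parabolic n ?\<xi> i"
        "Y' \<in> parabolic n ?\<xi>' i" "Y' \<in> carrier_mat N N" "Z' \<in> eigensum ?high"
        unfolding P_def by blast
      then have Z: "Z \<in> carrier_mat N N" "Z' \<in> carrier_mat N N" by (auto dest: eigensum_closed)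
      have "X + X' = (Y + Y') + (Z + Z')"
        unfolding * using *(4,9) Z by (intro eq_matI) auto
      then show ?case unfolding P_def
        using * parabolic_add \<xi> \<xi>' eigensum_add unfolding N_def
        by (intro exI[of _ "Y + Y'"] exI[of _ "Z + Z'"]) simp
    next
      case (smult X c)
      then obtain Y Z where *: "X = Y + Z" "Y \<in> parabolic n ?\<xi> i" "Y \<in> parabolic n ?\<xi>' i"
        "Y \<in> carrier_mat N N" "Z \<in> eigensum ?high"
        unfolding P_def by blast
      then have Z: "Z \<in> carrier_mat N N" by (auto dest: eigensum_closed)
      have "c \<cdot>\<^sub>m X = c \<cdot>\<^sub>m Y + c \<cdot>\<^sub>m Z"
        unfolding * using *(4) Z by (intro eq_matI) (auto simp: algebra_simps)
      then show ?case unfolding P_def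
        using * parabolic_smult \<xi> \<xi>' eigensum_scale unfolding N_def
        by (intro exI[of _ "c \<cdot>\<^sub>m Y"] exI[of _ "c \<cdot>\<^sub>m Z"]) simp
    next
      case (basis p q)
      let ?X = "root_vector n p q"
      have car: "?X \<in> carrier_mat N N" using root_vector_so so_carrier unfolding N_def by blast
      from le obtain h h' where h: "?X \<in> eigenspace_ad n ?\<xi> h" "?X \<in> eigenspace_ad n ?\<xi>' h'"
        "h' \<le> h \<or> h' \<le> 0 \<and> h \<le> 0"
        using root_or_torus_vector_eigenvalues[OF root_or_torus_root_vector[OF basis] root_vector_so, of m' m] by metis
      show ?case
      proof (cases "h \<le> i")
        case True
        then have "?X \<in> parabolic n ?\<xi> i" "?X \<in> parabolic n ?\<xi>' i"
          using h i by (auto intro: eigenspace_ad_subset_parabolic)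
        moreover have "?X = ?X + 0\<^sub>m N N" using car by simp
        ultimately show ?thesis unfolding P_def using car eigensum.zero by blast
      next
        case False
        then have "?X \<in> eigensum ?high"
          using h(1) car \<xi> by (intro eigensumI[of _ "\<i> * of_int h"])
            (auto simp: eigenspace_ad_iff_ad_eigenvector N_def)
        moreover have "?X = 0\<^sub>m N N + ?X" using car by simp
        ultimately show ?thesis unfolding P_def using zp zero_closed by blast
      qed
    qed
    moreover have "X \<in> so (2 * n + 1)" by (rule parabolic_so[OF X])
    ultimately obtain Y Z where *: "X = Y + Z" "Y \<in> parabolic n ?\<xi> i" "Y \<in> parabolic n ?\<xi>' i"
        "Y \<in> carrier_mat N N" "Z \<in> eigensum ?high"
        unfolding P_def by blast
    then have Zc: "Z \<in> carrier_mat N N" by (auto dest: eigensum_closed)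
    \<comment> \<open>the part with large eigenvalues is also a sum of eigenvectors with small ones, so it vanishes\<close>
    have Z: "Z = X + (- 1) \<cdot>\<^sub>m Y" unfolding * using * Zc by (intro eq_matI) auto
    have "Z \<in> eigensum ?low" by (subst Z) (intro eigensum_add eigensum_scale low X *(2))
    moreover have "?low \<inter> ?high = {}" by auto
    ultimately have "Z = 0\<^sub>m N N" using * eigensum_disjoint by blast
    with * show "X \<in> parabolic n ?\<xi>' i" by simp
  qed
qed

section \<open>Canonical elements\<close>

text \<open>
  The coordinates of the dominant lattice points in the cone of \<open>I\<close>.
\<close>

definition lattice_coords :: "nat \<Rightarrow> nat set \<Rightarrow> (nat \<Rightarrow> nat) set" where
  "lattice_coords n I = {m. (\<forall>i\<in>{1..n}. m i = 0 \<longleftrightarrow> i \<notin> I) \<and> even (\<Sum>i=1..n. i * m i)}"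

text \<open>
  The sum of the coordinates \<open>a\<^sub>i\<close> of \<open>\<Sum> m\<^sub>j H\<^sub>j\<close>, because \<open>H\<^sub>j\<close> contributes to \<open>j\<close> of them.
\<close>

lemma sum_tails:
  fixes a :: "nat \<Rightarrow> real"
  shows "(\<Sum>i=1..n. \<Sum>j=i..n. a j) = (\<Sum>j=1..n. real j * a j)"
proof -
  have "(\<Sum>i=1..n. \<Sum>j=i..n. a j) = (\<Sum>i=1..n. \<Sum>j=1..n. if i \<le> j then a j else 0)"
  proof (rule sum.cong[OF refl])
    fix i assume "i \<in> {1..n}"
    then have "(\<Sum>j=i..n. a j) = (\<Sum>j\<in>{j \<in> {1..n}. i \<le> j}. a j)" by (intro sum.cong) auto
    also have "\<dots> = (\<Sum>j=1..n. if i \<le> j then a j else 0)" by (rule sum.inter_filter) simp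
    finally show "(\<Sum>j=i..n. a j) = (\<Sum>j=1..n. if i \<le> j then a j else 0)" .
  qed
  also have "\<dots> = (\<Sum>j=1..n. \<Sum>i=1..n. if i \<le> j then a j else 0)" by (rule sum.swap)
  also have "\<dots> = (\<Sum>j=1..n. real j * a j)"
  proof (rule sum.cong[OF refl])
    fix j assume j: "j \<in> {1..n}"
    have "(\<Sum>i=1..n. if i \<le> j then a j else 0) = (\<Sum>i\<in>{i \<in> {1..n}. i \<le> j}. a j)"
      by (rule sum.inter_filter[symmetric]) simp
    also have "{i \<in> {1..n}. i \<le> j} = {1..j}" using j by auto
    finally show "(\<Sum>i=1..n. if i \<le> j then a j else 0) = real j * a j" by simp
  qed
  finally show ?thesis .
qed

lemma tails_in_Ints_iff:
  fixes a :: "nat \<Rightarrow> real"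
  shows "(\<forall>i\<in>{1..n}. (\<Sum>j=i..n. a j) \<in> \<int>) \<longleftrightarrow> (\<forall>i\<in>{1..n}. a i \<in> \<int>)"
proof
  assume t: "\<forall>i\<in>{1..n}. (\<Sum>j=i..n. a j) \<in> \<int>"
  show "\<forall>i\<in>{1..n}. a i \<in> \<int>"
  proof
    fix i assume i: "i \<in> {1..n}"
    then have "{i..n} = insert i {i + 1..n}" by auto
    then have "a i = (\<Sum>j=i..n. a j) - (\<Sum>j=i + 1..n. a j)" by (simp del: Suc_eq_plus1)
    moreover have "(\<Sum>j=i + 1..n. a j) \<in> \<int>"
    proof (cases "i = n")
      case False
      with t i show ?thesis by (auto dest: bspec[of _ _ "i + 1"])
    qed simp
    ultimately show "a i \<in> \<int>" using t i by simp
  qed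
qed auto

lemma dominant_unit_lattice_cone:
  "dominant_unit_lattice n \<inter> cone n I = (\<lambda>m. simple_coords n (\<lambda>k. real (m k))) ` lattice_coords n I"
proof (intro equalityI subsetI)
  fix \<xi> assume "\<xi> \<in> dominant_unit_lattice n \<inter> cone n I"
  then obtain a where a: "\<xi> = simple_coords n a" "\<And>i. i \<in> {1..n} \<Longrightarrow> 0 \<le> a i \<and> (a i = 0 \<longleftrightarrow> i \<notin> I)"
    and u: "simple_coords n a \<in> unit_lattice n"
    unfolding cone_def mat_sum_H dominant_unit_lattice_def by auto
  from u obtain k :: int where int: "\<And>i. i \<in> {1..n} \<Longrightarrow> a i \<in> \<int>" and k: "(\<Sum>j=1..n. real j * a j) = 2 * of_int k"
    unfolding simple_coords_def tor_in_unit_lattice_iff tails_in_Ints_iff sum_tails by blast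
  define m where "m i = nat \<lfloor>a i\<rfloor>" for i
  have m: "real (m i) = a i" if "i \<in> {1..n}" for i
    using int[OF that] a(2)[OF that] by (auto simp: m_def elim!: Ints_cases)
  have "real (\<Sum>j=1..n. j * m j) = 2 * of_int k" using k m by simp
  then have "int (\<Sum>j=1..n. j * m j) = 2 * k" by linarith
  then have "even (\<Sum>j=1..n. j * m j)" by (metis dvd_triv_left even_of_nat)
  moreover have "m i = 0 \<longleftrightarrow> i \<notin> I" if "i \<in> {1..n}" for i
    using m[OF that] a(2)[OF that] by auto
  ultimately have "m \<in> lattice_coords n I" by (simp add: lattice_coords_def)
  moreover have "\<xi> = simple_coords n (\<lambda>k. real (m k))"
    unfolding a(1) simple_coords_eq_iff using m by auto
  ultimately show "\<xi> \<in> (\<lambda>m. simple_coords n (\<lambda>k. real (m k))) ` lattice_coords n I" by blast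
next
  fix \<xi> assume "\<xi> \<in> (\<lambda>m. simple_coords n (\<lambda>k. real (m k))) ` lattice_coords n I"
  then obtain m where m: "m \<in> lattice_coords n I" "\<xi> = simple_coords n (\<lambda>k. real (m k))" by blast
  from m(1) obtain k where "(\<Sum>i=1..n. i * m i) = 2 * k" by (auto simp: lattice_coords_def)
  then have "(\<Sum>i=1..n. real i * real (m i)) = 2 * of_int (int k)"
    by (metis (mono_tags, lifting) of_int_of_nat_eq of_nat_mult of_nat_numeral of_nat_sum sum.cong)
  then have "\<xi> \<in> unit_lattice n"
    unfolding m(2) simple_coords_def tor_in_unit_lattice_iff tails_in_Ints_iff sum_tails
    by (intro conjI exI[of _ "int k"]) auto
  moreover have "\<alpha> \<xi> / \<i> \<in> \<real>\<^sub>\<ge>\<^sub>0" if \<alpha>: "\<alpha> \<in> positive_roots n" for \<alpha>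
  proof -
    obtain c :: "nat \<Rightarrow> nat" where c: "\<And>a. \<alpha> (simple_coords n a) = \<i> * of_real (\<Sum>l=1..n. real (c l) * a l)"
      using positive_root_simple_coords[OF \<alpha>] by blast
    have "\<alpha> \<xi> / \<i> = of_real (\<Sum>l=1..n. real (c l) * real (m l))" unfolding m(2) c by simp
    moreover have "(\<Sum>l=1..n. real (c l) * real (m l)) \<ge> 0" by (simp add: sum_nonneg)
    ultimately show ?thesis by (simp only: nonneg_Reals_of_real_iff)
  qed
  moreover have "\<xi> \<in> cone n I"
    unfolding cone_def mat_sum_H m(2) using m(1)
    by (intro CollectI exI[of _ "\<lambda>k. real (m k)"]) (auto simp: lattice_coords_def)
  ultimately show "\<xi> \<in> dominant_unit_lattice n \<inter> cone n I" by (simp add: dominant_unit_lattice_def)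
qed

lemma canonical_iff:
  "canonical n I \<xi> \<longleftrightarrow> (\<exists>m\<in>lattice_coords n I. \<xi> = simple_coords n (\<lambda>k. real (m k)) \<and>
     (\<forall>m'\<in>lattice_coords n I. (\<forall>k\<in>{1..n}. m' k \<le> m k) \<longrightarrow> (\<forall>k\<in>{1..n}. m' k = m k)))"
proof -
  have "(\<xi> \<in> f ` S \<and> (\<forall>\<xi>'\<in>f ` S. R \<xi> \<xi>' \<longrightarrow> \<xi>' = \<xi>)) \<longleftrightarrow>
      (\<exists>m\<in>S. \<xi> = f m \<and> (\<forall>m'\<in>S. R (f m) (f m') \<longrightarrow> f m' = f m))"
    for f :: "(nat \<Rightarrow> nat) \<Rightarrow> real mat" and S R by blast
  then show ?thesis
    unfolding canonical_def dominant_unit_lattice_cone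
    by (simp only: lattice_le_simple_coords_iff simple_coords_eq_iff of_nat_eq_iff)
qed

lemma sum_of_bool: "(I :: nat set) \<subseteq> {1..n} \<Longrightarrow> (\<Sum>i=1..n. i * of_bool (i \<in> I)) = (\<Sum>i\<in>I. i)"
  by (rule sum.mono_neutral_cong_right) auto

text \<open>
  The indicator of \<open>I\<close> is below every vector of natural numbers with support \<open>I\<close>, hence it is the
  least admissible vector.
\<close>

lemma canonical_even:
  assumes I: "I \<subseteq> {1..n}" and even: "even (\<Sum>i\<in>I. i)"
  shows "{\<xi>. canonical n I \<xi>} = {xi n I}"
proof -
  let ?m = "\<lambda>k. of_bool (k \<in> I) :: nat"
  have m: "?m \<in> lattice_coords n I"
    using even unfolding lattice_coords_def by (auto simp: sum_of_bool[OF I] cong: sum.cong)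
  have min: "?m k \<le> m' k" if "m' \<in> lattice_coords n I" "k \<in> {1..n}" for m' k
    using that by (cases "k \<in> I") (auto simp: lattice_coords_def Suc_le_eq)
  have "canonical n I (xi n I)"
    unfolding canonical_iff
  proof (intro bexI[OF _ m] conjI xi_eq_simple_coords[OF I] ballI impI)
    fix m' k assume "m' \<in> lattice_coords n I" "\<forall>k\<in>{1..n}. m' k \<le> ?m k" "k \<in> {1..n}"
    then show "m' k = ?m k" using min[of m' k] by (intro antisym) blast+
  qed
  moreover have "\<xi> = xi n I" if c: "canonical n I \<xi>" for \<xi>
  proof -
    from c obtain m' where m': "m' \<in> lattice_coords n I" "\<xi> = simple_coords n (\<lambda>k. real (m' k))"
      and max: "\<And>m''. \<lbrakk>m'' \<in> lattice_coords n I; \<forall>k\<in>{1..n}. m'' k \<le> m' k\<rbrakk> \<Longrightarrow> \<forall>k\<in>{1..n}. m'' k = m' k"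
      unfolding canonical_iff by blast
    from max[OF m] min[OF m'(1)] have "\<forall>k\<in>{1..n}. ?m k = m' k" by blast
    then show ?thesis unfolding m'(2) xi_eq_simple_coords[OF I] simple_coords_eq_iff by simp
  qed
  ultimately show ?thesis by blast
qed

text \<open>
  By parity every admissible vector exceeds the indicator of \<open>I\<close> at an odd place of \<open>I\<close>, so it lies above
  one of the vectors that add \<open>1\<close> to the indicator at such a place. These are admissible and pairwise
  incomparable.
\<close>

lemma canonical_odd:
  assumes I: "I \<subseteq> {1..n}" and odd: "odd (\<Sum>i\<in>I. i)"
  shows "{\<xi>. canonical n I \<xi>} = {H n j + xi n I | j. j \<in> I \<and> odd j}"
proof -
  let ?m = "\<lambda>j k. of_bool (k = j) + of_bool (k \<in> I) :: nat"
  have fin: "finite I" using I finite_subset by blast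
  have m: "?m j \<in> lattice_coords n I" if j: "j \<in> I" "odd j" for j
  proof -
    have "(\<Sum>i=1..n. i * ?m j i) = (\<Sum>i=1..n. if i = j then j else 0) + (\<Sum>i=1..n. i * of_bool (i \<in> I))"
      unfolding sum.distrib[symmetric] by (intro sum.cong) auto
    also have "\<dots> = j + (\<Sum>i\<in>I. i)" using j I by (subst sum.delta) (auto simp: sum_of_bool[OF I])
    finally show ?thesis using j odd by (auto simp: lattice_coords_def)
  qed
  have le: "of_bool (k \<in> I) \<le> m' k" if "m' \<in> lattice_coords n I" "k \<in> {1..n}" for m' k
    using that by (cases "k \<in> I") (auto simp: lattice_coords_def Suc_le_eq)
  have exc: "\<exists>j\<in>I. odd j \<and> (\<forall>k\<in>{1..n}. ?m j k \<le> m' k)" if m': "m' \<in> lattice_coords n I" for m'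
  proof -
    have "(\<Sum>i=1..n. i * m' i) = (\<Sum>i=1..n. i * of_bool (i \<in> I)) + (\<Sum>i=1..n. i * (m' i - of_bool (i \<in> I)))"
      unfolding sum.distrib[symmetric] using le[OF m'] by (intro sum.cong) (auto simp flip: distrib_left)
    \<comment> \<open>the left-hand side is even and the sum over \<open>I\<close> is odd\<close>
    then have "odd (\<Sum>i=1..n. i * (m' i - of_bool (i \<in> I)))"
      using m' odd sum_of_bool[OF I] by (simp add: lattice_coords_def)
    then obtain j where j: "j \<in> {1..n}" "odd (j * (m' j - of_bool (j \<in> I)))"
      by (meson dvd_sum)
    have "m' j = 0" if "j \<notin> I" using m' j(1) that unfolding lattice_coords_def by blast
    with j(2) have "j \<in> I" by (cases "j \<in> I") auto
    moreover have "?m j k \<le> m' k" if "k \<in> {1..n}" for k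
    proof (cases "k = j")
      case True
      with j(2) show ?thesis by (cases "m' j - of_bool (j \<in> I)") auto
    qed (use le[OF m' that] in simp)
    moreover have "odd j" using j(2) by simp
    ultimately show ?thesis by blast
  qed
  have "canonical n I (H n j + xi n I)" if j: "j \<in> I" "odd j" for j
    unfolding canonical_iff
  proof (intro bexI[OF _ m[OF j]] conjI ballI impI)
    show "H n j + xi n I = simple_coords n (\<lambda>k. real (?m j k))"
      using j I by (intro H_add_xi_eq_simple_coords) auto
    fix m' k assume m': "m' \<in> lattice_coords n I" "\<forall>k\<in>{1..n}. m' k \<le> ?m j k" and k: "k \<in> {1..n}"
    \<comment> \<open>then \<open>?m j'\<close> is below \<open>?m j\<close>, and comparing the entries at \<open>j'\<close> gives \<open>j' = j\<close>\<close>
    obtain j' where j': "j' \<in> I" "\<forall>k\<in>{1..n}. ?m j' k \<le> m' k" using exc[OF m'(1)] by blast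
    have "j' = j"
    proof (rule ccontr)
      assume "j' \<noteq> j"
      have "j' \<in> {1..n}" using j' I by blast
      then have "?m j' j' \<le> m' j'" "m' j' \<le> ?m j j'" using j'(2) m'(2) by blast+
      with \<open>j' \<noteq> j\<close> j'(1) show False by simp
    qed
    with j'(2) m'(2) k show "m' k = ?m j k" by (intro antisym) blast+
  qed
  moreover have "\<exists>j. \<xi> = H n j + xi n I \<and> j \<in> I \<and> odd j" if c: "canonical n I \<xi>" for \<xi>
  proof -
    from c obtain m' where m': "m' \<in> lattice_coords n I" "\<xi> = simple_coords n (\<lambda>k. real (m' k))"
      and max: "\<And>m''. \<lbrakk>m'' \<in> lattice_coords n I; \<forall>k\<in>{1..n}. m'' k \<le> m' k\<rbrakk> \<Longrightarrow> \<forall>k\<in>{1..n}. m'' k = m' k"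
      unfolding canonical_iff by blast
    from exc[OF m'(1)] obtain j where j: "j \<in> I" "odd j" "\<forall>k\<in>{1..n}. ?m j k \<le> m' k" by blast
    then have "\<forall>k\<in>{1..n}. ?m j k = m' k" using max[OF m[OF j(1,2)]] by blast
    then have "simple_coords n (\<lambda>k. real (?m j k)) = \<xi>"
      unfolding m'(2) simple_coords_eq_iff of_nat_eq_iff .
    moreover have "H n j + xi n I = simple_coords n (\<lambda>k. real (?m j k))"
      using j I by (intro H_add_xi_eq_simple_coords) auto
    ultimately have "\<xi> = H n j + xi n I" by (simp only:)
    with j show ?thesis by blast
  qed
  ultimately show ?thesis by blast
qed

section \<open>Symmetry of the weights of sl(2)\<close>

lemma shifted_operator_mult_vec:
  assumes A: "A \<in> carrier_mat d d"
  shows "shifted_operator (carrier_vec d) (+) (\<cdot>\<^sub>v) (0\<^sub>v d) (\<lambda>c v. A *\<^sub>v v + (- c) \<cdot>\<^sub>v v)"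
proof
  note Ac = mult_mat_vec_carrier[OF A]
  show "A *\<^sub>v 0\<^sub>v d + (- l) \<cdot>\<^sub>v 0\<^sub>v d = 0\<^sub>v d" for l
    using A by (intro eq_vecI) auto
  fix v w :: "complex vec" assume v: "v \<in> carrier_vec d"
  show "A *\<^sub>v v + (- l) \<cdot>\<^sub>v v \<in> carrier_vec d" for l using Ac[OF v] v by simp
  show "A *\<^sub>v (c \<cdot>\<^sub>v v) + (- l) \<cdot>\<^sub>v (c \<cdot>\<^sub>v v) = c \<cdot>\<^sub>v (A *\<^sub>v v + (- l) \<cdot>\<^sub>v v)" for c l
    unfolding mult_mat_vec[OF A v] using carrier_vecD[OF Ac[OF v]] carrier_vecD[OF v]
    by (intro eq_vecI) (auto simp: algebra_simps simp del: index_mult_mat_vec)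
  show "A *\<^sub>v (A *\<^sub>v v + (- k) \<cdot>\<^sub>v v) + (- l) \<cdot>\<^sub>v (A *\<^sub>v v + (- k) \<cdot>\<^sub>v v) =
      A *\<^sub>v (A *\<^sub>v v + (- l) \<cdot>\<^sub>v v) + (- k) \<cdot>\<^sub>v (A *\<^sub>v v + (- l) \<cdot>\<^sub>v v)" for k l
  proof -
    have *: "A *\<^sub>v (A *\<^sub>v v + (- k) \<cdot>\<^sub>v v) = A *\<^sub>v (A *\<^sub>v v) + (- k) \<cdot>\<^sub>v (A *\<^sub>v v)" for k
      using mult_add_distrib_mat_vec[OF A Ac[OF v]] mult_mat_vec[OF A v] v by simp
    show ?thesis unfolding * using carrier_vecD[OF Ac[OF Ac[OF v]]] carrier_vecD[OF Ac[OF v]] carrier_vecD[OF v]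
      by (intro eq_vecI) (auto simp: algebra_simps simp del: index_mult_mat_vec)
  qed
  show "A *\<^sub>v v + (- l) \<cdot>\<^sub>v v = (c - l) \<cdot>\<^sub>v v" if eq: "A *\<^sub>v v + (- c) \<cdot>\<^sub>v v = 0\<^sub>v d" for c l
  proof (rule eq_vecI)
    fix r assume "r < dim_vec ((c - l) \<cdot>\<^sub>v v)"
    then show "(A *\<^sub>v v + (- l) \<cdot>\<^sub>v v) $ r = ((c - l) \<cdot>\<^sub>v v) $ r"
      using arg_cong[OF eq, of "\<lambda>u. u $ r"] carrier_vecD[OF Ac[OF v]] carrier_vecD[OF v]
      by (simp add: algebra_simps del: index_mult_mat_vec)
  qed (use A v in auto)
  show "v = 0\<^sub>v d" if "c \<cdot>\<^sub>v v = 0\<^sub>v d" "c \<noteq> 0" for c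
  proof (rule eq_vecI)
    fix r assume "r < dim_vec (0\<^sub>v d :: complex vec)"
    then show "v $ r = 0\<^sub>v d $ r"
      using arg_cong[OF that(1), of "\<lambda>u. u $ r"] v that(2) by simp
  qed (use v in auto)
  assume w: "w \<in> carrier_vec d"
  show "A *\<^sub>v (v + w) + (- l) \<cdot>\<^sub>v (v + w) = (A *\<^sub>v v + (- l) \<cdot>\<^sub>v v) + (A *\<^sub>v w + (- l) \<cdot>\<^sub>v w)" for l
    unfolding mult_add_distrib_mat_vec[OF A v w]
    using carrier_vecD[OF Ac[OF v]] carrier_vecD[OF v] carrier_vecD[OF Ac[OF w]] carrier_vecD[OF w]
    by (intro eq_vecI) (auto simp: algebra_simps simp del: index_mult_mat_vec)
qed auto

lemma mult_vec_eigenvector_iff: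
  fixes A :: "complex mat"
  assumes "A \<in> carrier_mat d d" "v \<in> carrier_vec d"
  shows "A *\<^sub>v v + (- c) \<cdot>\<^sub>v v = 0\<^sub>v d \<longleftrightarrow> A *\<^sub>v v = c \<cdot>\<^sub>v v"
proof
  note car = carrier_vecD[OF mult_mat_vec_carrier[OF assms]] carrier_vecD[OF assms(2)]
  assume eq: "A *\<^sub>v v + (- c) \<cdot>\<^sub>v v = 0\<^sub>v d"
  show "A *\<^sub>v v = c \<cdot>\<^sub>v v"
  proof (rule eq_vecI)
    fix r assume "r < dim_vec (c \<cdot>\<^sub>v v)"
    then show "(A *\<^sub>v v) $ r = (c \<cdot>\<^sub>v v) $ r"
      using arg_cong[OF eq, of "\<lambda>u. u $ r"] car by (simp del: index_mult_mat_vec)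
  qed (use car in simp)
next
  assume "A *\<^sub>v v = c \<cdot>\<^sub>v v"
  then show "A *\<^sub>v v + (- c) \<cdot>\<^sub>v v = 0\<^sub>v d"
    using assms by (intro eq_vecI) auto
qed

lemma finite_eigenvalues:
  fixes A :: "complex mat"
  assumes "A \<in> carrier_mat d d"
  shows "finite {c. \<exists>v\<in>carrier_vec d. v \<noteq> 0\<^sub>v d \<and> A *\<^sub>v v = c \<cdot>\<^sub>v v}"
proof (rule finite_subset)
  show "{c. \<exists>v\<in>carrier_vec d. v \<noteq> 0\<^sub>v d \<and> A *\<^sub>v v = c \<cdot>\<^sub>v v} \<subseteq> {c. poly (char_poly A) c = 0}"
    using assms by (auto simp: eigenvalue_root_char_poly[symmetric] eigenvalue_def eigenvector_def)
  show "finite {c. poly (char_poly A) c = 0}"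
    using degree_monic_char_poly[OF assms] by (intro poly_roots_finite) auto
qed

lemma zero_smult_vec: "v \<in> carrier_vec d \<Longrightarrow> 0 \<cdot>\<^sub>v v = 0\<^sub>v d" for v :: "complex vec"
  by (intro eq_vecI) auto

lemma smult_vec_eq_0:
  fixes v :: "complex vec"
  assumes "c \<cdot>\<^sub>v v = 0\<^sub>v d" "c \<noteq> 0" "v \<in> carrier_vec d"
  shows "v = 0\<^sub>v d"
proof (rule eq_vecI)
  fix r assume "r < dim_vec (0\<^sub>v d :: complex vec)"
  then show "v $ r = 0\<^sub>v d $ r"
    using arg_cong[OF assms(1), of "\<lambda>u. u $ r"] assms(2,3) by simp
qed (use assms in auto)

text \<open>
  Iterating a raising or lowering operator produces vectors for infinitely many different eigenvalues
  unless one of them vanishes.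
\<close>

lemma finite_eigenvalue_chain_stops:
  fixes W :: "complex \<Rightarrow> 'a set"
  assumes fin: "finite {c. \<exists>w\<in>W c. w \<noteq> z}" and inj: "inj h"
    and chain: "\<And>k :: nat. (F ^^ k) w \<in> W (h k)" and w: "w \<noteq> z"
  obtains k where "(F ^^ k) w \<noteq> z" "F ((F ^^ k) w) = z"
proof -
  have "\<exists>k. (F ^^ k) w = z"
  proof (rule ccontr)
    assume "\<nexists>k. (F ^^ k) w = z"
    then have "range h \<subseteq> {c. \<exists>w\<in>W c. w \<noteq> z}" using chain by blast
    with fin inj show False using finite_subset range_inj_infinite by blast
  qed
  then have k: "(F ^^ (LEAST k. (F ^^ k) w = z)) w = z" by (rule LeastI_ex)
  obtain j where j: "(LEAST k. (F ^^ k) w = z) = Suc j" using k w by (cases "LEAST k. (F ^^ k) w = z") auto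
  then have "(F ^^ j) w \<noteq> z" using not_less_Least[of j "\<lambda>k. (F ^^ k) w = z"] by auto
  then show thesis using k that[of j] by (simp add: j)
qed

text \<open>
  The set of weights of a finite-dimensional representation of \<open>sl(2)\<close> is symmetric. Here \<open>A\<close> raises and
  \<open>B\<close> lowers the weight by 1, and their commutator acts on weight \<open>c\<close> by \<open>c\<close>, so weights are half
  integers. From a vector of weight \<open>c\<close>, \<open>q\<close> applications of \<open>B\<close> lead to a lowest vector \<open>z\<close>. The
  formula for \<open>B A\<^sup>k\<^sup>+\<^sup>1 z\<close> shows that \<open>z\<close> has weight \<open>- p / 2\<close>, where \<open>p\<close> is the last power of \<open>A\<close>
  that does not kill \<open>z\<close>; so \<open>c = q - p / 2\<close> and \<open>A\<^sup>p\<^sup>-\<^sup>q z\<close> has weight \<open>- c\<close>. The assumption on \<open>c\<close>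
  ensures \<open>q \<le> p\<close>.
\<close>

lemma sl2_reflection_nonpos:
  fixes W :: "complex \<Rightarrow> complex vec set"
  assumes sub: "\<And>c. W c \<subseteq> carrier_vec d"
    and A: "\<And>c w. w \<in> W c \<Longrightarrow> A w \<in> W (c + 1)" and B: "\<And>c w. w \<in> W c \<Longrightarrow> B w \<in> W (c - 1)"
    and linA: "\<And>k w. w \<in> carrier_vec d \<Longrightarrow> A (k \<cdot>\<^sub>v w) = k \<cdot>\<^sub>v A w"
    and linB: "\<And>k w. w \<in> carrier_vec d \<Longrightarrow> B (k \<cdot>\<^sub>v w) = k \<cdot>\<^sub>v B w"
    and comm: "\<And>c w. w \<in> W c \<Longrightarrow> B (A w) = A (B w) + (- c) \<cdot>\<^sub>v w"
    and fin: "finite {c. \<exists>w\<in>W c. w \<noteq> 0\<^sub>v d}"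
    and w: "w \<in> W c" "w \<noteq> 0\<^sub>v d" and c: "Re c \<le> 0"
  shows "\<exists>w'\<in>W (- c). w' \<noteq> 0\<^sub>v d"
proof -
  have Bk: "(B ^^ k) w \<in> W (c - of_nat k)" for k
    using w(1) B by (induction k) (auto simp: algebra_simps, metis diff_diff_eq add.commute)
  have "inj (\<lambda>k. c - of_nat k)" by (auto simp: inj_def)
  then obtain q where q: "(B ^^ q) w \<noteq> 0\<^sub>v d" "B ((B ^^ q) w) = 0\<^sub>v d"
    using finite_eigenvalue_chain_stops[OF fin _ Bk w(2)] by blast
  define z e where "z = (B ^^ q) w" and "e = c - of_nat q"
  have z: "z \<in> W e" "z \<noteq> 0\<^sub>v d" "B z = 0\<^sub>v d" using Bk q by (auto simp: z_def e_def)
  have Ak: "(A ^^ k) z \<in> W (e + of_nat k)" for k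
    using z(1) A by (induction k) (auto simp: algebra_simps, metis add.assoc add.commute)
  have "inj (\<lambda>k. e + of_nat k)" by (auto simp: inj_def)
  then obtain p where p: "(A ^^ p) z \<noteq> 0\<^sub>v d" "A ((A ^^ p) z) = 0\<^sub>v d"
    using finite_eigenvalue_chain_stops[OF fin _ Ak z(2)] by blast
  have F0: "F (0\<^sub>v d) = 0\<^sub>v d"
    if lin: "\<And>k w. w \<in> carrier_vec d \<Longrightarrow> F (k \<cdot>\<^sub>v w) = k \<cdot>\<^sub>v F w" and car: "F z \<in> carrier_vec d" for F
  proof -
    have zc: "z \<in> carrier_vec d" using sub z(1) by blast
    then have "F (0 \<cdot>\<^sub>v z) = 0 \<cdot>\<^sub>v F z" by (rule lin)
    moreover have "0 \<cdot>\<^sub>v z = 0\<^sub>v d" "0 \<cdot>\<^sub>v F z = 0\<^sub>v d" using zc car by (auto intro!: eq_vecI)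
    ultimately show ?thesis by simp
  qed
  have A0: "A (0\<^sub>v d) = 0\<^sub>v d" and B0: "B (0\<^sub>v d) = 0\<^sub>v d"
    using A[OF z(1)] B[OF z(1)] sub by (blast intro: F0 linA linB)+
  have BA: "B (A ((A ^^ k) z)) = (- (of_nat (Suc k) * (e + of_nat k / 2))) \<cdot>\<^sub>v (A ^^ k) z" for k
  proof (induction k)
    case 0
    have "z \<in> carrier_vec d" using sub z(1) by blast
    then show ?case using comm[OF z(1)] by (simp add: z(3) A0)
  next
    case (Suc k)
    let ?x = "A ((A ^^ k) z)"
    have x: "?x \<in> W (e + of_nat (Suc k))" "?x \<in> carrier_vec d" using Ak[of "Suc k"] sub by auto
    have y: "(A ^^ k) z \<in> carrier_vec d" using Ak sub by blast
    have "B (A ?x) = A (B ?x) + (- (e + of_nat (Suc k))) \<cdot>\<^sub>v ?x" using comm[OF x(1)] .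
    also have "\<dots> = (- (of_nat (Suc k) * (e + of_nat k / 2))) \<cdot>\<^sub>v ?x + (- (e + of_nat (Suc k))) \<cdot>\<^sub>v ?x"
      unfolding Suc linA[OF y] ..
    also have "\<dots> = (- (of_nat (Suc (Suc k)) * (e + of_nat (Suc k) / 2))) \<cdot>\<^sub>v ?x"
      unfolding add_smult_distrib_vec[symmetric] by (rule arg_cong[where f = "\<lambda>t. t \<cdot>\<^sub>v ?x"]) (simp add: field_simps)
    finally show ?case by simp
  qed
  have "- (of_nat (Suc p) * (e + of_nat p / 2)) = 0"
  proof (rule ccontr)
    assume "- (of_nat (Suc p) * (e + of_nat p / 2)) \<noteq> 0"
    moreover have "(- (of_nat (Suc p) * (e + of_nat p / 2))) \<cdot>\<^sub>v (A ^^ p) z = 0\<^sub>v d"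
      using BA[of p] p(2) B0 by simp
    ultimately show False using smult_vec_eq_0 p(1) Ak sub by blast
  qed
  then have "of_nat (Suc p) * (e + of_nat p / 2) = 0" by simp
  then have e: "e = - of_nat p / 2" using of_nat_neq_0[of p, where ?'a = complex] by (auto simp: eq_neg_iff_add_eq_0)
  then have "Re c = of_nat q - of_nat p / 2" by (simp add: e_def complex_eq_iff)
  with c have "2 * q \<le> p" by linarith
  then obtain k where k: "p = q + k" by (metis add_leD1 le_iff_add mult_2)
  have "(A ^^ k) z \<noteq> 0\<^sub>v d"
  proof
    assume *: "(A ^^ k) z = 0\<^sub>v d"
    have "(A ^^ j) (0\<^sub>v d) = 0\<^sub>v d" for j by (induction j) (simp_all add: A0)
    then have "(A ^^ p) z = 0\<^sub>v d" unfolding k funpow_add o_apply * .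
    with p(1) show False ..
  qed
  moreover have "e + of_nat k = - c" using e k by (simp add: e_def field_simps)
  ultimately show ?thesis using Ak[of k] by auto
qed

lemma sl2_reflection:
  fixes W :: "complex \<Rightarrow> complex vec set"
  assumes sub: "\<And>c. W c \<subseteq> carrier_vec d"
    and A: "\<And>c w. w \<in> W c \<Longrightarrow> A w \<in> W (c + 1)" and B: "\<And>c w. w \<in> W c \<Longrightarrow> B w \<in> W (c - 1)"
    and linA: "\<And>k w. w \<in> carrier_vec d \<Longrightarrow> A (k \<cdot>\<^sub>v w) = k \<cdot>\<^sub>v A w"
    and linB: "\<And>k w. w \<in> carrier_vec d \<Longrightarrow> B (k \<cdot>\<^sub>v w) = k \<cdot>\<^sub>v B w"
    and comm: "\<And>c w. w \<in> W c \<Longrightarrow> A (B w) = B (A w) + c \<cdot>\<^sub>v w"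
    and fin: "finite {c. \<exists>w\<in>W c. w \<noteq> 0\<^sub>v d}"
    and w: "w \<in> W c" "w \<noteq> 0\<^sub>v d"
  shows "\<exists>w'\<in>W (- c). w' \<noteq> 0\<^sub>v d"
proof (cases "Re c \<le> 0")
  case True
  have comm': "B (A x) = A (B x) + (- e) \<cdot>\<^sub>v x" if x: "x \<in> W e" for e x
  proof -
    have "B (A x) \<in> carrier_vec d" "x \<in> carrier_vec d" using B[OF A[OF x]] x sub by (auto simp del: add_diff_cancel_right')
    then show ?thesis unfolding comm[OF x] by (intro eq_vecI) auto
  qed
  show ?thesis by (rule sl2_reflection_nonpos[OF sub A B linA linB comm' fin w True])
next
  case False
  have fin': "finite {c. \<exists>w\<in>W (- c). w \<noteq> 0\<^sub>v d}"
  proof -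
    have "{c. \<exists>w\<in>W (- c). w \<noteq> 0\<^sub>v d} = uminus ` {c. \<exists>w\<in>W c. w \<noteq> 0\<^sub>v d}"
      by (auto simp: image_iff) (metis add.inverse_inverse)
    with fin show ?thesis by simp
  qed
  have "\<exists>w'\<in>(\<lambda>c. W (- c)) (- (- c)). w' \<noteq> 0\<^sub>v d"
  proof (rule sl2_reflection_nonpos[where W = "\<lambda>c. W (- c)" and A = B and B = A and c = "- c" and w = w])
    show "B x \<in> W (- (e + 1))" if "x \<in> W (- e)" for e x
      using B[OF that] unfolding minus_add_distrib diff_conv_add_uminus .
    show "A x \<in> W (- (e - 1))" if "x \<in> W (- e)" for e x
      using A[OF that] unfolding minus_diff_eq uminus_add_conv_diff .
    show "A (B x) = B (A x) + (- e) \<cdot>\<^sub>v x" if "x \<in> W (- e)" for e x using comm[OF that] .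
  qed (use sub linA linB fin' w False in auto)
  then show ?thesis by simp
qed

section \<open>Weights of representations of the orthogonal Lie algebra\<close>

locale lie_representation =
  fixes n d :: nat and \<rho> :: "complex mat \<Rightarrow> complex mat"
  assumes rep: "lie_rep n d \<rho>"
begin

lemma act_carrier: "\<lbrakk>X \<in> so (2 * n + 1); v \<in> carrier_vec d\<rbrakk> \<Longrightarrow> \<rho> X *\<^sub>v v \<in> carrier_vec d"
  using rep by (auto simp: lie_rep_def)

lemma rho_carrier: "X \<in> so (2 * n + 1) \<Longrightarrow> \<rho> X \<in> carrier_mat d d"
  using rep by (simp add: lie_rep_def)

lemma act_add_left:
  "\<lbrakk>X \<in> so (2 * n + 1); Y \<in> so (2 * n + 1); v \<in> carrier_vec d\<rbrakk> \<Longrightarrow> \<rho> (X + Y) *\<^sub>v v = \<rho> X *\<^sub>v v + \<rho> Y *\<^sub>v v"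
  using rep by (simp add: lie_rep_def add_mult_distrib_mat_vec[of _ d d])

lemma act_smult_left:
  "\<lbrakk>X \<in> so (2 * n + 1); v \<in> carrier_vec d\<rbrakk> \<Longrightarrow> \<rho> (c \<cdot>\<^sub>m X) *\<^sub>v v = c \<cdot>\<^sub>v (\<rho> X *\<^sub>v v)"
proof -
  assume X: "X \<in> so (2 * n + 1)" and v: "v \<in> carrier_vec d"
  have "\<rho> (c \<cdot>\<^sub>m X) = c \<cdot>\<^sub>m \<rho> X" using rep X by (simp add: lie_rep_def)
  then show ?thesis using rho_carrier[OF X] v by (intro eq_vecI) auto
qed

lemma act_add_right:
  "\<lbrakk>X \<in> so (2 * n + 1); v \<in> carrier_vec d; w \<in> carrier_vec d\<rbrakk> \<Longrightarrow> \<rho> X *\<^sub>v (v + w) = \<rho> X *\<^sub>v v + \<rho> X *\<^sub>v w"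
  by (rule mult_add_distrib_mat_vec[OF rho_carrier])

lemma act_smult_right:
  "\<lbrakk>X \<in> so (2 * n + 1); v \<in> carrier_vec d\<rbrakk> \<Longrightarrow> \<rho> X *\<^sub>v (c \<cdot>\<^sub>v v) = c \<cdot>\<^sub>v (\<rho> X *\<^sub>v v)"
  by (rule mult_mat_vec[OF rho_carrier])

lemma act_act:
  assumes "X \<in> so (2 * n + 1)" "Y \<in> so (2 * n + 1)" "v \<in> carrier_vec d"
  shows "\<rho> X *\<^sub>v (\<rho> Y *\<^sub>v v) = \<rho> (bracket X Y) *\<^sub>v v + \<rho> Y *\<^sub>v (\<rho> X *\<^sub>v v)"
proof -
  note c = rho_carrier[OF assms(1)] rho_carrier[OF assms(2)]
  have "\<rho> (bracket X Y) = \<rho> X * \<rho> Y - \<rho> Y * \<rho> X"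
    using rep assms by (simp add: lie_rep_def bracket_def)
  then have "\<rho> (bracket X Y) *\<^sub>v v = (\<rho> X * \<rho> Y) *\<^sub>v v - (\<rho> Y * \<rho> X) *\<^sub>v v"
    using minus_mult_distrib_mat_vec[OF mult_carrier_mat[OF c] mult_carrier_mat[OF c(2,1)] assms(3)] by simp
  also have "\<dots> = \<rho> X *\<^sub>v (\<rho> Y *\<^sub>v v) - \<rho> Y *\<^sub>v (\<rho> X *\<^sub>v v)"
    using c assms(3) by simp
  finally show ?thesis
    using carrier_vecD[OF act_carrier[OF assms(1) act_carrier[OF assms(2,3)]]]
      carrier_vecD[OF act_carrier[OF assms(2) act_carrier[OF assms(1,3)]]]
    by (intro eq_vecI) (auto simp del: index_mult_mat_vec assoc_mult_mat_vec)
qed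

text \<open>
  The weight space for the weight \<open>\<Sum> m\<^sub>j L\<^sub>j\<close>.
\<close>

definition weight_space :: "(nat \<Rightarrow> complex) \<Rightarrow> complex vec set" where
  "weight_space m = {v \<in> carrier_vec d. \<forall>j\<in>{1..n}. \<rho> (cplx (E n j)) *\<^sub>v v = (\<i> * m j) \<cdot>\<^sub>v v}"

lemma weight_space_carrier: "weight_space m \<subseteq> carrier_vec d"
  by (auto simp: weight_space_def)

lemma cplx_E_so: "j \<in> {1..n} \<Longrightarrow> cplx (E n j) \<in> so (2 * n + 1)"
  by (simp add: E_eq_tor cplx_tor_so)

lemma weight_space_tor:
  assumes v: "v \<in> weight_space m"
  shows "\<rho> (cplx (tor n a)) *\<^sub>v v = (\<i> * (\<Sum>j=1..n. of_real (a j) * m j)) \<cdot>\<^sub>v v"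
proof -
  have vc: "v \<in> carrier_vec d" using v weight_space_carrier by blast
  have "k \<le> n \<Longrightarrow> \<rho> (cplx (tor n (\<lambda>j. if j \<le> k then a j else 0))) *\<^sub>v v = (\<i> * (\<Sum>j=1..k. of_real (a j) * m j)) \<cdot>\<^sub>v v" for k
  proof (induction k)
    case 0
    have "tor n (\<lambda>j. if j \<le> 0 then a j else 0) = tor n (\<lambda>_. 0)" by (intro tor_cong) auto
    moreover have "cplx (tor n (\<lambda>_. 0)) = 0 \<cdot>\<^sub>m cplx (tor n (\<lambda>_. 0))"
      using carrier_matD[OF tor_carrier[of n "\<lambda>_. 0"]] by (intro eq_matI) (auto simp: tor_index)
    ultimately have "\<rho> (cplx (tor n (\<lambda>j. if j \<le> 0 then a j else 0))) *\<^sub>v v = 0 \<cdot>\<^sub>v (\<rho> (cplx (tor n (\<lambda>_. 0))) *\<^sub>v v)"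
      by (metis act_smult_left cplx_tor_so vc)
    also have "\<dots> = 0\<^sub>v d" by (rule zero_smult_vec[OF act_carrier[OF cplx_tor_so vc]])
    also have "\<dots> = (\<i> * (\<Sum>j=1..0. of_real (a j) * m j)) \<cdot>\<^sub>v v" using zero_smult_vec[OF vc] by simp
    finally show ?case .
  next
    case (Suc k)
    let ?t = "\<lambda>k. cplx (tor n (\<lambda>j. if j \<le> k then a j else 0))" and ?E = "cplx (E n (Suc k))"
    have k: "Suc k \<in> {1..n}" using Suc.prems by simp
    have "tor n (\<lambda>j. if j \<le> Suc k then a j else 0) = tor n (\<lambda>j. if j \<le> k then a j else 0) + a (Suc k) \<cdot>\<^sub>m E n (Suc k)"
      unfolding E_eq_tor[OF k] smult_tor tor_add by (intro tor_cong) (auto simp: le_Suc_eq)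
    then have t: "?t (Suc k) = ?t k + of_real (a (Suc k)) \<cdot>\<^sub>m ?E"
      using carrier_matD[OF tor_carrier[of n "\<lambda>j. if j \<le> k then a j else 0"]]
      by (intro eq_matI) (auto simp: E_def)
    have "\<rho> (?t (Suc k)) *\<^sub>v v = \<rho> (?t k) *\<^sub>v v + of_real (a (Suc k)) \<cdot>\<^sub>v (\<rho> ?E *\<^sub>v v)"
      unfolding t by (simp add: act_add_left[OF cplx_tor_so so_smult[OF cplx_E_so[OF k]] vc] act_smult_left[OF cplx_E_so[OF k] vc])
    also have "\<rho> ?E *\<^sub>v v = (\<i> * m (Suc k)) \<cdot>\<^sub>v v" using v k unfolding weight_space_def by blast
    also have "\<rho> (?t k) *\<^sub>v v = (\<i> * (\<Sum>j=1..k. of_real (a j) * m j)) \<cdot>\<^sub>v v"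
      using Suc by simp
    finally show ?case using vc by (auto simp: algebra_simps smult_smult_assoc add_smult_distrib_vec)
  qed
  from this[of n] have "\<rho> (cplx (tor n (\<lambda>j. if j \<le> n then a j else 0))) *\<^sub>v v = (\<i> * (\<Sum>j=1..n. of_real (a j) * m j)) \<cdot>\<^sub>v v"
    by simp
  moreover have "tor n (\<lambda>j. if j \<le> n then a j else 0) = tor n a" by (intro tor_cong) auto
  ultimately show ?thesis by simp
qed

lemma weight_space_cong: "(\<And>j. j \<in> {1..n} \<Longrightarrow> m j = m' j) \<Longrightarrow> weight_space m = weight_space m'"
  by (auto simp: weight_space_def)

lemma weight_space_root_vector:
  assumes X: "X \<in> root_space n \<alpha>" and v: "v \<in> weight_space m"
  shows "\<rho> X *\<^sub>v v \<in> weight_space (\<lambda>j. m j + \<alpha> (E n j) / \<i>)"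
proof -
  have vc: "v \<in> carrier_vec d" using v weight_space_carrier by blast
  have Xs: "X \<in> so (2 * n + 1)" using X by (simp add: root_space_def)
  note Xv = act_carrier[OF Xs vc]
  have "\<rho> (cplx (E n j)) *\<^sub>v (\<rho> X *\<^sub>v v) = (\<i> * (m j + \<alpha> (E n j) / \<i>)) \<cdot>\<^sub>v (\<rho> X *\<^sub>v v)" if j: "j \<in> {1..n}" for j
  proof -
    have "bracket (cplx (E n j)) X = \<alpha> (E n j) \<cdot>\<^sub>m X"
      using X E_eq_tor[OF j] by (auto simp: root_space_def torus_eq_range_tor)
    moreover have "\<rho> (cplx (E n j)) *\<^sub>v v = (\<i> * m j) \<cdot>\<^sub>v v"
      using v j unfolding weight_space_def by blast
    ultimately have "\<rho> (cplx (E n j)) *\<^sub>v (\<rho> X *\<^sub>v v) = \<alpha> (E n j) \<cdot>\<^sub>v (\<rho> X *\<^sub>v v) + (\<i> * m j) \<cdot>\<^sub>v (\<rho> X *\<^sub>v v)"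
      unfolding act_act[OF cplx_E_so[OF j] Xs vc] by (simp add: act_smult_left[OF Xs vc] act_smult_right[OF Xs vc])
    then show ?thesis by (simp add: add_smult_distrib_vec[symmetric] algebra_simps)
  qed
  with Xv show ?thesis by (simp add: weight_space_def)
qed

lemma weight_space_reflection:
  assumes i: "i \<in> {1..n}" and v: "v \<in> weight_space m" "v \<noteq> 0\<^sub>v d"
  shows "\<exists>w\<in>weight_space (m(i := - m i)). w \<noteq> 0\<^sub>v d"
proof -
  let ?N = "2 * n + 1"
  define X where "X = root_vector n i ?N"
  define Y where "Y = (- 1) \<cdot>\<^sub>m root_vector n (n + i) ?N"
  have LE: "basis_weight n i (E n j) + basis_weight n ?N (E n j) = (if j = i then \<i> else 0)"
    "basis_weight n (n + i) (E n j) + basis_weight n ?N (E n j) = (if j = i then - \<i> else 0)" if "j \<in> {1..n}" for j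
    using i that L_E[of i n j] by (auto simp: basis_weight_def)
  have X: "X \<in> root_space n (\<lambda>\<xi>. basis_weight n i \<xi> + basis_weight n ?N \<xi>)"
    unfolding X_def using i by (intro root_vector_root_space) auto
  have Y: "Y \<in> root_space n (\<lambda>\<xi>. basis_weight n (n + i) \<xi> + basis_weight n ?N \<xi>)"
    unfolding Y_def using i by (intro root_space_smult root_vector_root_space) auto
  have so: "X \<in> so ?N" "Y \<in> so ?N" using X Y by (auto simp: root_space_def)
  define W where "W c = weight_space (m(i := c))" for c
  have Wc: "W c \<subseteq> carrier_vec d" for c unfolding W_def by (rule weight_space_carrier)
  have "\<exists>w\<in>W (- m i). w \<noteq> 0\<^sub>v d"
  proof (rule sl2_reflection[where A = "\<lambda>v. \<rho> X *\<^sub>v v" and B = "\<lambda>v. \<rho> Y *\<^sub>v v" and w = v, OF Wc])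
    fix c w assume w: "w \<in> W c"
    have "weight_space (\<lambda>j. (m(i := c)) j + (basis_weight n i (E n j) + basis_weight n ?N (E n j)) / \<i>) = W (c + 1)"
      unfolding W_def by (intro weight_space_cong) (simp add: LE)
    with weight_space_root_vector[OF X w[unfolded W_def]] show "\<rho> X *\<^sub>v w \<in> W (c + 1)" by simp
    have "weight_space (\<lambda>j. (m(i := c)) j + (basis_weight n (n + i) (E n j) + basis_weight n ?N (E n j)) / \<i>) = W (c - 1)"
      unfolding W_def by (intro weight_space_cong) (simp add: LE)
    with weight_space_root_vector[OF Y w[unfolded W_def]] show "\<rho> Y *\<^sub>v w \<in> W (c - 1)" by simp
    have wc: "w \<in> carrier_vec d" using w Wc by blast
    have "\<rho> (bracket X Y) *\<^sub>v w = (- \<i>) \<cdot>\<^sub>v (\<rho> (cplx (E n i)) *\<^sub>v w)"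
      unfolding X_def Y_def bracket_short_root_vectors[OF i] by (rule act_smult_left[OF cplx_E_so[OF i] wc])
    also have "\<rho> (cplx (E n i)) *\<^sub>v w = (\<i> * c) \<cdot>\<^sub>v w"
      using w i by (auto simp: W_def weight_space_def)
    finally have "\<rho> (bracket X Y) *\<^sub>v w = c \<cdot>\<^sub>v w" by (simp add: smult_smult_assoc)
    then have "\<rho> X *\<^sub>v (\<rho> Y *\<^sub>v w) = c \<cdot>\<^sub>v w + \<rho> Y *\<^sub>v (\<rho> X *\<^sub>v w)"
      unfolding act_act[OF so wc] by simp
    also have "\<dots> = \<rho> Y *\<^sub>v (\<rho> X *\<^sub>v w) + c \<cdot>\<^sub>v w"
      using wc act_carrier so by (intro comm_add_vec[of _ d]) auto
    finally show "\<rho> X *\<^sub>v (\<rho> Y *\<^sub>v w) = \<rho> Y *\<^sub>v (\<rho> X *\<^sub>v w) + c \<cdot>\<^sub>v w" .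
  next
    have "{c. \<exists>w\<in>W c. w \<noteq> 0\<^sub>v d} \<subseteq> (\<lambda>c. c / \<i>) ` {c. \<exists>v\<in>carrier_vec d. v \<noteq> 0\<^sub>v d \<and> \<rho> (cplx (E n i)) *\<^sub>v v = c \<cdot>\<^sub>v v}"
    proof
      fix c assume "c \<in> {c. \<exists>w\<in>W c. w \<noteq> 0\<^sub>v d}"
      then obtain w where w: "w \<in> W c" "w \<noteq> 0\<^sub>v d" by blast
      then have "\<rho> (cplx (E n i)) *\<^sub>v w = (\<i> * c) \<cdot>\<^sub>v w" "w \<in> carrier_vec d"
        using i by (auto simp: W_def weight_space_def)
      with w(2) have "\<i> * c \<in> {c. \<exists>v\<in>carrier_vec d. v \<noteq> 0\<^sub>v d \<and> \<rho> (cplx (E n i)) *\<^sub>v v = c \<cdot>\<^sub>v v}" by blast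
      then show "c \<in> (\<lambda>c. c / \<i>) ` {c. \<exists>v\<in>carrier_vec d. v \<noteq> 0\<^sub>v d \<and> \<rho> (cplx (E n i)) *\<^sub>v v = c \<cdot>\<^sub>v v}"
        by (rule rev_image_eqI) simp
    qed
    then show "finite {c. \<exists>w\<in>W c. w \<noteq> 0\<^sub>v d}"
      by (rule finite_subset) (intro finite_imageI finite_eigenvalues rho_carrier cplx_E_so i)
  next
    show "v \<in> W (m i)" using v by (simp add: W_def)
  qed (use v so in \<open>simp_all add: act_smult_right\<close>)
  then show ?thesis by (simp add: W_def)
qed

text \<open>
  The product of all coordinate reflections is the element \<open>- 1\<close> of the Weyl group.
\<close>

lemma weight_space_negation:
  assumes v: "v \<in> weight_space m" "v \<noteq> 0\<^sub>v d"
  shows "\<exists>w\<in>weight_space (\<lambda>j. - m j). w \<noteq> 0\<^sub>v d"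
proof -
  have "\<exists>w\<in>weight_space (\<lambda>j. if j \<in> J then - m j else m j). w \<noteq> 0\<^sub>v d" if "finite J" "J \<subseteq> {1..n}" for J
    using that
  proof (induction J rule: finite_induct)
    case empty
    then show ?case using v by auto
  next
    case (insert i J)
    then obtain w where w: "w \<in> weight_space (\<lambda>j. if j \<in> J then - m j else m j)" "w \<noteq> 0\<^sub>v d" by auto
    have "(\<lambda>j. if j \<in> J then - m j else m j)(i := - (if i \<in> J then - m i else m i)) = (\<lambda>j. if j \<in> insert i J then - m j else m j)"
      using insert by auto
    with weight_space_reflection[OF _ w, of i] insert.prems show ?case by auto
  qed
  from this[of "{1..n}"] obtain w where "w \<in> weight_space (\<lambda>j. if j \<in> {1..n} then - m j else m j)" "w \<noteq> 0\<^sub>v d" by auto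
  moreover have "weight_space (\<lambda>j. if j \<in> {1..n} then - m j else m j) = weight_space (\<lambda>j. - m j)"
    by (rule weight_space_cong) auto
  ultimately show ?thesis by auto
qed

inductive_set generated :: "complex mat set \<Rightarrow> complex vec \<Rightarrow> complex vec set" for S v where
  start: "v \<in> generated S v"
| add: "\<lbrakk>x \<in> generated S v; y \<in> generated S v\<rbrakk> \<Longrightarrow> x + y \<in> generated S v"
| smult: "x \<in> generated S v \<Longrightarrow> c \<cdot>\<^sub>v x \<in> generated S v"
| act: "\<lbrakk>X \<in> S; x \<in> generated S v\<rbrakk> \<Longrightarrow> \<rho> X *\<^sub>v x \<in> generated S v"

text \<open>
  If the Lie algebra maps \<open>v\<close> into the subspace generated by \<open>S\<close>, then this subspace is stable under the
  whole Lie algebra, because \<open>X Y w = [X, Y] w + Y X w\<close> moves \<open>X\<close> past a generator \<open>Y\<close>.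
\<close>

lemma generated_eq_carrier:
  assumes irr: "irreducible_rep n d \<rho>" and S: "S \<subseteq> so (2 * n + 1)" and v: "v \<in> carrier_vec d" "v \<noteq> 0\<^sub>v d"
    and base: "\<And>X. X \<in> so (2 * n + 1) \<Longrightarrow> \<rho> X *\<^sub>v v \<in> generated S v"
  shows "generated S v = carrier_vec d"
proof -
  have sub: "w \<in> carrier_vec d" if "w \<in> generated S v" for w
    using that by (induction rule: generated.induct) (use v S act_carrier in auto)
  have inv: "\<rho> X *\<^sub>v w \<in> generated S v" if "w \<in> generated S v" "X \<in> so (2 * n + 1)" for w X
    using that
  proof (induction arbitrary: X rule: generated.induct)
    case start
    then show ?case by (rule base)
  next
    case (add x y)
    then show ?case by (simp add: act_add_right sub generated.add)
  next
    case (smult x c)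
    then show ?case by (simp add: act_smult_right sub generated.smult)
  next
    case (act Y x)
    then have Y: "Y \<in> so (2 * n + 1)" using S by blast
    show ?case
      unfolding act_act[OF act.prems Y sub[OF act.hyps(2)]]
      by (intro generated.add generated.act act.IH act.hyps bracket_so act.prems Y)
  qed
  have "subspace class_ring (generated S v) (module_vec TYPE(complex) d)"
  proof (intro VectorSpace.subspace.intro submodule.intro)
    show "vectorspace class_ring (module_vec TYPE(complex) d)" by (rule vec_vs)
    then show "module class_ring (module_vec TYPE(complex) d)" by (rule vectorspace.axioms)
    have "0 \<cdot>\<^sub>v v \<in> generated S v" by (intro generated.smult generated.start)
    then show "\<zero>\<^bsub>module_vec TYPE(complex) d\<^esub> \<in> generated S v"
      unfolding module_vec_simps zero_smult_vec[OF v(1)] .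
  qed (auto simp: module_vec_simps sub intro: generated.add generated.smult)
  then have "generated S v = {0\<^sub>v d} \<or> generated S v = carrier_vec d"
    using irr inv unfolding irreducible_rep_def by blast
  with v generated.start[of v S] show ?thesis by auto
qed

text \<open>
  Highest (\<open>s = 1\<close>) and lowest (\<open>s = - 1\<close>) weight vectors, treated together.
\<close>

definition extremal :: "complex \<Rightarrow> (real mat \<Rightarrow> complex) \<Rightarrow> complex vec \<Rightarrow> bool" where
  "extremal s \<mu> v \<longleftrightarrow> weight_vector n d \<rho> \<mu> v \<and>
     (\<forall>\<alpha>\<in>positive_roots n. \<forall>X\<in>root_space n (\<lambda>\<xi>. s * \<alpha> \<xi>). \<rho> X *\<^sub>v v = 0\<^sub>v d)"

lemma highest_weight_iff_extremal:
  "highest_weight n d \<rho> \<mu> \<longleftrightarrow> \<mu> \<in> extensional (torus n) \<and> (\<exists>v. extremal 1 \<mu> v)"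
  by (simp add: highest_weight_def extremal_def)

lemma lowest_weight_iff_extremal:
  "lowest_weight n d \<rho> \<mu> \<longleftrightarrow> \<mu> \<in> extensional (torus n) \<and> (\<exists>v. extremal (- 1) \<mu> v)"
  by (simp add: lowest_weight_def extremal_def)

definition opposite_root_vectors :: "complex \<Rightarrow> complex mat set" where
  "opposite_root_vectors s = {X. \<exists>\<alpha>\<in>positive_roots n. X \<in> root_space n (\<lambda>\<xi>. - s * \<alpha> \<xi>)}"

text \<open>
  Root vectors of one sign kill \<open>v\<close>, the torus scales it, and root vectors of the other sign are the
  generators.
\<close>

lemma extremal_generates:
  assumes irr: "irreducible_rep n d \<rho>" and s: "s = 1 \<or> s = - 1" and ex: "extremal s \<mu> v"
  shows "generated (opposite_root_vectors s) v = carrier_vec d"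
proof (rule generated_eq_carrier[OF irr])
  let ?G = "generated (opposite_root_vectors s) v"
  show vc: "v \<in> carrier_vec d" "v \<noteq> 0\<^sub>v d" using ex by (auto simp: extremal_def weight_vector_def)
  show "opposite_root_vectors s \<subseteq> so (2 * n + 1)" by (auto simp: opposite_root_vectors_def root_space_def)
  fix X :: "complex mat" assume "X \<in> so (2 * n + 1)"
  then show "\<rho> X *\<^sub>v v \<in> ?G"
  proof (induction rule: so_induct)
    case (add X Y)
    then show ?case by (simp add: act_add_left vc generated.add)
  next
    case (smult X c)
    then show ?case by (simp add: act_smult_left vc generated.smult)
  next
    case (basis p q)
    let ?X = "root_vector n p q"
    have root: "\<rho> ?X *\<^sub>v v \<in> ?G"
      if "\<alpha> \<in> positive_roots n" "?X \<in> root_space n (\<lambda>\<xi>. s * \<alpha> \<xi>) \<or> ?X \<in> root_space n (\<lambda>\<xi>. - s * \<alpha> \<xi>)" for \<alpha>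
      using that(2)
    proof
      assume "?X \<in> root_space n (\<lambda>\<xi>. s * \<alpha> \<xi>)"
      then have "\<rho> ?X *\<^sub>v v = 0 \<cdot>\<^sub>v v" using ex that(1) zero_smult_vec[OF vc(1)] by (simp add: extremal_def)
      then show ?thesis using generated.smult[OF generated.start] by simp
    next
      assume "?X \<in> root_space n (\<lambda>\<xi>. - s * \<alpha> \<xi>)"
      with that(1) show ?thesis by (intro generated.act generated.start) (auto simp: opposite_root_vectors_def)
    qed
    from root_or_torus_root_vector[OF basis] consider
        \<alpha> where "\<alpha> \<in> positive_roots n" "?X \<in> root_space n \<alpha>"
      | \<alpha> where "\<alpha> \<in> positive_roots n" "?X \<in> root_space n (\<lambda>\<xi>. - \<alpha> \<xi>)"
      | c a where "?X = c \<cdot>\<^sub>m cplx (tor n a)"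
      unfolding root_or_torus_vector_def by blast
    then show ?case
    proof cases
      case 3
      have "\<rho> (cplx (tor n a)) *\<^sub>v v = \<mu> (tor n a) \<cdot>\<^sub>v v"
        using ex by (auto simp: extremal_def weight_vector_def torus_eq_range_tor)
      then show ?thesis unfolding 3
        by (simp add: act_smult_left[OF cplx_tor_so vc(1)] generated.smult generated.start)
    qed (use s root in auto)
  qed
qed

text \<open>
  Starting from \<open>v\<close>, every generator moves the eigenvalue of a dominant \<open>\<eta>\<close> in the same direction, and
  the vectors obtained in this way span the representation.
\<close>

lemma extremal_weight_bound:
  assumes irr: "irreducible_rep n d \<rho>" and s: "s = 1 \<or> s = - 1" and ex: "extremal s \<mu> v"
    and \<eta>: "\<eta> \<in> torus n" and dom: "\<And>\<alpha>. \<alpha> \<in> positive_roots n \<Longrightarrow> \<exists>t\<ge>0. \<alpha> \<eta> = \<i> * of_real t"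
    and x: "x \<in> carrier_vec d" "x \<noteq> 0\<^sub>v d" "\<rho> (cplx \<eta>) *\<^sub>v x = c \<cdot>\<^sub>v x"
  shows "\<exists>t\<ge>0. c = \<mu> \<eta> - s * (\<i> * of_real t)"
proof -
  let ?\<Lambda> = "{\<mu> \<eta> - s * (\<i> * of_real t) | t. t \<ge> 0}"
  have \<eta>so: "cplx \<eta> \<in> so (2 * n + 1)" using \<eta> cplx_tor_so by (auto simp: torus_eq_range_tor)
  note A = rho_carrier[OF \<eta>so]
  interpret shifted_operator "carrier_vec d" "(+)" "(\<cdot>\<^sub>v)" "0\<^sub>v d" "\<lambda>c v. \<rho> (cplx \<eta>) *\<^sub>v v + (- c) \<cdot>\<^sub>v v"
    by (rule shifted_operator_mult_vec[OF A])
  have vc: "v \<in> carrier_vec d" "\<rho> (cplx \<eta>) *\<^sub>v v = \<mu> \<eta> \<cdot>\<^sub>v v"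
    using ex \<eta> by (auto simp: extremal_def weight_vector_def)
  have "w \<in> eigensum ?\<Lambda>" if "w \<in> generated (opposite_root_vectors s) v" for w
    using that
  proof (induction rule: generated.induct)
    case start
    have "\<mu> \<eta> \<in> ?\<Lambda>" by (intro CollectI exI[of _ 0]) simp
    then show ?case
      using vc by (intro eigensumI[of _ "\<mu> \<eta>"]) (auto simp: mult_vec_eigenvector_iff[OF A vc(1)])
  next
    case (act X w)
    then obtain \<alpha> where \<alpha>: "\<alpha> \<in> positive_roots n" "X \<in> root_space n (\<lambda>\<xi>. - s * \<alpha> \<xi>)"
      by (auto simp: opposite_root_vectors_def)
    obtain t where t: "t \<ge> 0" "\<alpha> \<eta> = \<i> * of_real t" using dom[OF \<alpha>(1)] by blast
    have X: "X \<in> so (2 * n + 1)" "bracket (cplx \<eta>) X = (- s * \<alpha> \<eta>) \<cdot>\<^sub>m X"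
      using \<alpha>(2) \<eta> by (auto simp: root_space_def)
    show ?case
    proof (rule eigensum_shifting[OF act.IH, where t = "- s * \<alpha> \<eta>"])
      show "\<rho> X *\<^sub>v x \<in> carrier_vec d" if "x \<in> carrier_vec d" for x by (rule act_carrier[OF X(1) that])
      show "\<rho> X *\<^sub>v 0\<^sub>v d = 0\<^sub>v d" using rho_carrier[OF X(1)] by (intro eq_vecI) auto
      show "l + - s * \<alpha> \<eta> \<in> ?\<Lambda>" if "l \<in> ?\<Lambda>" for l
      proof -
        from that obtain t' where t': "t' \<ge> 0" "l = \<mu> \<eta> - s * (\<i> * of_real t')"
          unfolding mem_Collect_eq by (elim exE conjE)
        have "l + - s * \<alpha> \<eta> = \<mu> \<eta> - s * (\<i> * of_real (t' + t))"
          unfolding t'(2) t(2) of_real_add by (simp only: distrib_left) simp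
        moreover have "t' + t \<ge> 0" using t(1) t'(1) by simp
        ultimately show ?thesis unfolding mem_Collect_eq by (intro exI[of _ "t' + t"] conjI)
      qed
      show "\<rho> (cplx \<eta>) *\<^sub>v (\<rho> X *\<^sub>v y) + (- (l + - s * \<alpha> \<eta>)) \<cdot>\<^sub>v (\<rho> X *\<^sub>v y) =
          \<rho> X *\<^sub>v (\<rho> (cplx \<eta>) *\<^sub>v y + (- l) \<cdot>\<^sub>v y)" if y: "y \<in> carrier_vec d" for l y
      proof -
        note c = act_carrier[OF X(1) y] act_carrier[OF X(1) act_carrier[OF \<eta>so y]]
        have "\<rho> (cplx \<eta>) *\<^sub>v (\<rho> X *\<^sub>v y) = (- s * \<alpha> \<eta>) \<cdot>\<^sub>v (\<rho> X *\<^sub>v y) + \<rho> X *\<^sub>v (\<rho> (cplx \<eta>) *\<^sub>v y)"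
          unfolding act_act[OF \<eta>so X(1) y] X(2) by (simp only: act_smult_left[OF X(1) y])
        moreover have "\<rho> X *\<^sub>v (\<rho> (cplx \<eta>) *\<^sub>v y + (- l) \<cdot>\<^sub>v y) = \<rho> X *\<^sub>v (\<rho> (cplx \<eta>) *\<^sub>v y) + (- l) \<cdot>\<^sub>v (\<rho> X *\<^sub>v y)"
          using act_add_right[OF X(1) act_carrier[OF \<eta>so y]] act_smult_right[OF X(1) y] y by simp
        moreover have "(k \<cdot>\<^sub>v u + w) + (- (l + k)) \<cdot>\<^sub>v u = w + (- l) \<cdot>\<^sub>v u"
          if "u \<in> carrier_vec d" "w \<in> carrier_vec d" for k and u w :: "complex vec"
          using that by (intro eq_vecI) (auto simp: algebra_simps)
        ultimately show ?thesis using c by (simp only:)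
      qed
    qed
  qed (auto intro: eigensum_add eigensum_scale)
  then have "x \<in> eigensum ?\<Lambda>" using extremal_generates[OF irr s ex] x(1) by simp
  then have "c \<in> ?\<Lambda>"
    by (rule eigenvalue_of_eigensum) (use x mult_vec_eigenvector_iff[OF A x(1)] in auto)
  then show ?thesis by blast
qed

text \<open>
  A weight is given as an arbitrary function on the torus; additivity comes from its eigenvector.
\<close>

lemma weight_vector_tor_add:
  assumes "weight_vector n d \<rho> \<mu> v"
  shows "\<mu> (tor n (\<lambda>i. a i + b i)) = \<mu> (tor n a) + \<mu> (tor n b)"
proof -
  have v: "v \<in> carrier_vec d" "v \<noteq> 0\<^sub>v d" and \<mu>: "\<rho> (cplx (tor n a)) *\<^sub>v v = \<mu> (tor n a) \<cdot>\<^sub>v v" for a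
    using assms by (auto simp: weight_vector_def torus_eq_range_tor)
  have "cplx (tor n (\<lambda>i. a i + b i)) = cplx (tor n a) + cplx (tor n b)"
    unfolding tor_add[symmetric] using carrier_matD[OF tor_carrier[of n a]] carrier_matD[OF tor_carrier[of n b]]
    by (intro eq_matI) auto
  then have "\<rho> (cplx (tor n (\<lambda>i. a i + b i))) *\<^sub>v v = \<rho> (cplx (tor n a)) *\<^sub>v v + \<rho> (cplx (tor n b)) *\<^sub>v v"
    by (simp only: act_add_left[OF cplx_tor_so cplx_tor_so v(1)])
  then have "\<mu> (tor n (\<lambda>i. a i + b i)) \<cdot>\<^sub>v v = (\<mu> (tor n a) + \<mu> (tor n b)) \<cdot>\<^sub>v v"
    unfolding \<mu> by (simp only: add_smult_distrib_vec)
  then have "(\<mu> (tor n (\<lambda>i. a i + b i)) + - (\<mu> (tor n a) + \<mu> (tor n b))) \<cdot>\<^sub>v v = 0\<^sub>v d"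
    unfolding add_smult_distrib_vec using v by (intro eq_vecI) (auto simp: algebra_simps)
  then have "\<mu> (tor n (\<lambda>i. a i + b i)) + - (\<mu> (tor n a) + \<mu> (tor n b)) = 0"
    using smult_vec_eq_0 v by blast
  then show ?thesis by (simp add: eq_neg_iff_add_eq_0[symmetric])
qed

text \<open>
  Two weights that bound each other agree on dominant torus elements, and every torus element is a
  difference of two dominant ones.
\<close>

lemma extremal_unique:
  assumes irr: "irreducible_rep n d \<rho>" and s: "s = 1 \<or> s = - 1"
    and ex: "extremal s \<mu> v" "extremal s \<mu>' v'" and \<xi>: "\<xi> \<in> torus n"
  shows "\<mu> \<xi> = \<mu>' \<xi>"
proof -
  have dominant: "\<mu> (tor n b) = \<mu>' (tor n b)"
    if b: "\<And>i j. \<lbrakk>i \<in> {1..n}; j \<in> {1..n}; i < j\<rbrakk> \<Longrightarrow> b j \<le> b i" "\<And>i. i \<in> {1..n} \<Longrightarrow> 0 \<le> b i" for b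
  proof -
    have dom: "\<exists>t\<ge>0. \<alpha> (tor n b) = \<i> * of_real t" if "\<alpha> \<in> positive_roots n" for \<alpha>
      using that
    proof (cases rule: positive_root_cases)
      case (1 i j)
      then show ?thesis using b(1)[of i j] by (intro exI[of _ "b i - b j"]) (simp add: L_tor algebra_simps)
    next
      case (2 i j)
      then show ?thesis using b(2)[of i] b(2)[of j] by (intro exI[of _ "b i + b j"]) (simp add: L_tor algebra_simps)
    next
      case (3 i)
      then show ?thesis using b(2)[of i] by (intro exI[of _ "b i"]) (simp add: L_tor)
    qed
    have t: "tor n b \<in> torus n" by (simp add: torus_eq_range_tor)
    have *: "\<exists>t\<ge>0. \<mu>' (tor n b) = \<mu> (tor n b) - s * (\<i> * of_real t)"
      if "extremal s \<mu> v" "extremal s \<mu>' v'" for \<mu> \<mu>' v v'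
      using that(2) t by (intro extremal_weight_bound[OF irr s that(1) t, of v'] dom)
        (auto simp: extremal_def weight_vector_def)
    obtain t t' where "t \<ge> 0" "\<mu>' (tor n b) = \<mu> (tor n b) - s * (\<i> * of_real t)"
      "t' \<ge> 0" "\<mu> (tor n b) = \<mu>' (tor n b) - s * (\<i> * of_real t')"
      using *[OF ex] *[OF ex(2,1)] by blast
    moreover from this have "s * (\<i> * of_real (t + t')) = 0" by (simp add: algebra_simps)
    then have "complex_of_real (t + t') = 0" using s by (auto simp del: of_real_add)
    then have "t + t' = 0" by (simp only: of_real_eq_0_iff)
    ultimately show ?thesis by simp
  qed
  obtain a where a: "\<xi> = tor n a" using \<xi> by (auto simp: torus_eq_range_tor)
  define T where "T = (\<Sum>i=1..n. \<bar>a i\<bar>)"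
  have T: "\<bar>a i\<bar> \<le> T" if "i \<in> {1..n}" for i
    unfolding T_def using that by (intro member_le_sum) auto
  \<comment> \<open>\<open>c\<close> is so strictly decreasing and positive that both \<open>c\<close> and \<open>a + c\<close> are dominant\<close>
  define c where "c i = 2 * T * (real n + 1 - real i)" for i
  have T0: "T \<ge> 0" by (simp add: T_def sum_nonneg)
  have c: "c j + 2 * T \<le> c i" if "i < j" for i j
  proof -
    have "2 * T * 1 \<le> 2 * T * (real j - real i)" using that T0 by (intro mult_left_mono) auto
    then show ?thesis by (simp add: c_def algebra_simps)
  qed
  have c0: "2 * T \<le> c i" if "i \<in> {1..n}" for i
  proof -
    have "2 * T * 1 \<le> 2 * T * (real n + 1 - real i)" using that T0 by (intro mult_left_mono) auto
    then show ?thesis by (simp add: c_def)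
  qed
  have "\<mu> (tor n c) = \<mu>' (tor n c)"
    using c c0 T0 by (intro dominant) (smt (verit))+
  moreover have "\<mu> (tor n (\<lambda>i. a i + c i)) = \<mu>' (tor n (\<lambda>i. a i + c i))"
  proof (rule dominant)
    show "a j + c j \<le> a i + c i" if "i \<in> {1..n}" "j \<in> {1..n}" "i < j" for i j
      using T[OF that(1)] T[OF that(2)] c[OF that(3)] by linarith
    show "0 \<le> a i + c i" if "i \<in> {1..n}" for i using T[OF that] c0[OF that] T0 by linarith
  qed
  ultimately show ?thesis
    unfolding a using weight_vector_tor_add[of \<mu> v a c] weight_vector_tor_add[of \<mu>' v' a c] ex
    by (simp add: extremal_def)
qed

end

section \<open>Uniton numbers\<close>

context lie_representation
begin

text \<open>
  The negative of the highest weight is a weight by symmetry. A root vector of a negative root must kill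
  its weight vectors, since otherwise, by symmetry again, some weight would lie above the highest one.
\<close>

lemma lowest_extremal_exists:
  assumes irr: "irreducible_rep n d \<rho>" and ex: "extremal 1 \<mu> v"
  shows "\<exists>w. extremal (- 1) (\<lambda>\<xi>. - \<mu> \<xi>) w"
proof -
  define m where "m j = \<mu> (E n j) / \<i>" for j
  have v: "v \<in> carrier_vec d" "v \<noteq> 0\<^sub>v d" and \<mu>: "\<rho> (cplx (tor n a)) *\<^sub>v v = \<mu> (tor n a) \<cdot>\<^sub>v v" for a
    using ex by (auto simp: extremal_def weight_vector_def torus_eq_range_tor)
  have vm: "v \<in> weight_space m"
    using v \<mu> by (auto simp: weight_space_def m_def E_eq_tor)
  have smult_cancel: "c = c'" if eq: "c \<cdot>\<^sub>v v = c' \<cdot>\<^sub>v v" for c c'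
  proof -
    have "(c + - c') \<cdot>\<^sub>v v = c \<cdot>\<^sub>v v + (- c') \<cdot>\<^sub>v v" by (rule add_smult_distrib_vec)
    also have "\<dots> = 0\<^sub>v d" unfolding eq using v by (intro eq_vecI) auto
    finally have "c + - c' = 0" using smult_vec_eq_0 v by blast
    then show ?thesis by simp
  qed
  have \<mu>_tor: "\<mu> (tor n a) = \<i> * (\<Sum>j=1..n. of_real (a j) * m j)" for a
    using \<mu>[of a] weight_space_tor[OF vm, of a] smult_cancel by metis
  obtain w where w: "w \<in> weight_space (\<lambda>j. - m j)" "w \<noteq> 0\<^sub>v d"
    using weight_space_negation[OF vm v(2)] by blast
  have wc: "w \<in> carrier_vec d" using w(1) weight_space_carrier by blast
  have "weight_vector n d \<rho> (\<lambda>\<xi>. - \<mu> \<xi>) w"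
    unfolding weight_vector_def torus_eq_range_tor
    using wc w(2) by (auto simp: weight_space_tor[OF w(1)] \<mu>_tor sum_negf)
  moreover have "\<rho> X *\<^sub>v w = 0\<^sub>v d" if \<alpha>: "\<alpha> \<in> positive_roots n" and X: "X \<in> root_space n (\<lambda>\<xi>. - 1 * \<alpha> \<xi>)" for \<alpha> X
  proof (rule ccontr)
    assume nz: "\<rho> X *\<^sub>v w \<noteq> 0\<^sub>v d"
    have "\<exists>x\<in>weight_space (\<lambda>j. - (- m j + (- 1 * \<alpha> (E n j)) / \<i>)). x \<noteq> 0\<^sub>v d"
      by (rule weight_space_negation[OF weight_space_root_vector[OF X w(1)] nz])
    then obtain x where x: "x \<in> weight_space (\<lambda>j. m j + \<alpha> (E n j) / \<i>)" "x \<noteq> 0\<^sub>v d" by auto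
    \<comment> \<open>\<open>x\<close> has weight \<open>\<mu> + \<alpha>\<close>, which violates the bound at a torus element where all positive roots are positive\<close>
    define b where "b i = real n + 1 - real i" for i
    have dom: "\<exists>t>0. \<beta> (tor n b) = \<i> * of_real t" if "\<beta> \<in> positive_roots n" for \<beta>
      using that
    proof (cases rule: positive_root_cases)
      case (1 i j)
      then show ?thesis by (intro exI[of _ "b i - b j"]) (auto simp: L_tor algebra_simps b_def)
    next
      case (2 i j)
      then show ?thesis by (intro exI[of _ "b i + b j"]) (auto simp: L_tor algebra_simps b_def)
    next
      case (3 i)
      then show ?thesis by (intro exI[of _ "b i"]) (auto simp: L_tor b_def)
    qed
    have "\<i> * (\<Sum>j=1..n. of_real (b j) * (m j + \<alpha> (E n j) / \<i>)) = \<mu> (tor n b) + \<alpha> (tor n b)"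
      unfolding \<mu>_tor positive_root_tor[OF \<alpha>] sum_distrib_left sum.distrib[symmetric]
    proof (intro sum.cong refl)
      fix j
      have "\<i> * (of_real (b j) * (m j + \<alpha> (E n j) / \<i>)) = \<i> * (of_real (b j) * m j) + of_real (b j) * (\<i> * (\<alpha> (E n j) / \<i>))"
        by (simp only: distrib_left mult.left_commute)
      then show "\<i> * (of_real (b j) * (m j + \<alpha> (E n j) / \<i>)) = \<i> * (of_real (b j) * m j) + of_real (b j) * \<alpha> (E n j)"
        by simp
    qed
    then have "\<rho> (cplx (tor n b)) *\<^sub>v x = (\<mu> (tor n b) + \<alpha> (tor n b)) \<cdot>\<^sub>v x"
      using weight_space_tor[OF x(1), of b] by simp
    then have "\<exists>t\<ge>0. \<mu> (tor n b) + \<alpha> (tor n b) = \<mu> (tor n b) - 1 * (\<i> * of_real t)"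
      using x(2) subsetD[OF weight_space_carrier x(1)] dom
      by (intro extremal_weight_bound[OF irr _ ex, of "tor n b" x]) (auto simp: torus_eq_range_tor intro: less_imp_le)
    then obtain t where t: "t \<ge> 0" "\<alpha> (tor n b) = - (\<i> * of_real t)" by auto
    obtain t' where t': "t' > 0" "\<alpha> (tor n b) = \<i> * of_real t'" using dom[OF \<alpha>] by blast
    have "\<i> * of_real (t' + t) = 0" using t(2) t'(2) by (simp add: distrib_left)
    then have "complex_of_real (t' + t) = 0" by (simp del: of_real_add)
    then have "t' + t = 0" by (simp only: of_real_eq_0_iff)
    with t(1) t'(1) show False by simp
  qed
  ultimately show ?thesis by (auto simp: extremal_def)
qed

lemma uniton_number_eq:
  assumes irr: "irreducible_rep n d \<rho>" and hw: "highest_weight n d \<rho> \<omega>" and \<xi>: "\<xi> \<in> torus n"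
  shows "uniton_number n d \<rho> \<xi> = 2 * \<omega> \<xi> / \<i>"
proof -
  obtain v where v: "extremal 1 \<omega> v" and \<omega>: "\<omega> \<in> extensional (torus n)"
    using hw by (auto simp: highest_weight_iff_extremal)
  obtain w where w: "extremal (- 1) (\<lambda>\<xi>. - \<omega> \<xi>) w" using lowest_extremal_exists[OF irr v] by blast
  have ext: "extremal s \<mu> u \<Longrightarrow> extremal s (restrict \<mu> (torus n)) u" for s \<mu> u
    by (auto simp: extremal_def weight_vector_def)
  have "(THE \<omega>. highest_weight n d \<rho> \<omega>) = \<omega>"
  proof (rule the_equality)
    show "highest_weight n d \<rho> \<omega>" by (rule hw)
    fix \<mu> assume "highest_weight n d \<rho> \<mu>"
    then show "\<mu> = \<omega>"
      using extremal_unique[OF irr _ _ v] \<omega> by (auto simp: highest_weight_iff_extremal intro: extensionalityI)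
  qed
  moreover have "(THE \<omega>. lowest_weight n d \<rho> \<omega>) = (\<lambda>\<xi>\<in>torus n. - \<omega> \<xi>)"
  proof (rule the_equality)
    show "lowest_weight n d \<rho> (\<lambda>\<xi>\<in>torus n. - \<omega> \<xi>)"
      using ext[OF w] by (auto simp: lowest_weight_iff_extremal)
    fix \<mu> assume "lowest_weight n d \<rho> \<mu>"
    then show "\<mu> = (\<lambda>\<xi>\<in>torus n. - \<omega> \<xi>)"
      using extremal_unique[OF irr _ _ ext[OF w]]
      by (auto simp: lowest_weight_iff_extremal intro!: extensionalityI[of _ "torus n"])
  qed
  ultimately show ?thesis using \<xi> by (simp add: uniton_number_def)
qed

end

lemma uniton_number_fundamental_rep:
  assumes "fundamental_rep n k d \<rho>"
  shows "k < n \<Longrightarrow> uniton_number n d \<rho> (tor n a) = of_real (2 * (\<Sum>i=1..k. a i))"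
    and "k = n \<Longrightarrow> uniton_number n d \<rho> (tor n a) = of_real (\<Sum>i=1..n. a i)"
proof -
  interpret lie_representation n d \<rho>
    using assms by unfold_locales (simp add: fundamental_rep_def irreducible_rep_def)
  have t: "tor n a \<in> torus n" by (simp add: torus_eq_range_tor)
  have u: "uniton_number n d \<rho> (tor n a) = 2 * fundamental_weight n k (tor n a) / \<i>"
    using assms t by (intro uniton_number_eq) (auto simp: fundamental_rep_def)
  have L: "(\<Sum>i=1..l. L n i (tor n a)) = \<i> * of_real (\<Sum>i=1..l. a i)" if "l \<le> n" for l
    unfolding of_real_sum sum_distrib_left using that by (intro sum.cong) (auto simp: L_tor)
  have cancel: "2 * (\<i> * x) / \<i> = 2 * x" "2 * (1 / 2 * (\<i> * x)) / \<i> = x" for x :: complex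
    by simp_all
  show "uniton_number n d \<rho> (tor n a) = of_real (2 * (\<Sum>i=1..k. a i))" if "k < n"
  proof -
    have "fundamental_weight n k (tor n a) = \<i> * of_real (\<Sum>i=1..k. a i)"
      unfolding fundamental_weight_def restrict_apply'[OF t] using that L[of k] by simp
    then have "uniton_number n d \<rho> (tor n a) = 2 * (\<i> * of_real (\<Sum>i=1..k. a i)) / \<i>"
      by (simp only: u)
    also have "\<dots> = of_real (2 * (\<Sum>i=1..k. a i))" unfolding of_real_mult cancel by simp
    finally show ?thesis .
  qed
  show "uniton_number n d \<rho> (tor n a) = of_real (\<Sum>i=1..n. a i)" if "k = n"
  proof -
    have "fundamental_weight n k (tor n a) = 1 / 2 * (\<i> * of_real (\<Sum>i=1..n. a i))"
      unfolding fundamental_weight_def restrict_apply'[OF t] by (simp only: that less_irrefl if_False L[OF order_refl])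
    then have "uniton_number n d \<rho> (tor n a) = 2 * (1 / 2 * (\<i> * of_real (\<Sum>i=1..n. a i))) / \<i>"
      by (simp only: u)
    also have "\<dots> = of_real (\<Sum>i=1..n. a i)" unfolding of_real_mult cancel by simp
    finally show ?thesis .
  qed
qed

lemma sum_of_bool_eq_card:
  assumes "I \<subseteq> {1..n :: nat}" "i \<in> {1..n}"
  shows "(\<Sum>l=i..n. of_bool (l \<in> I)) = card (I \<inter> {i..n})"
proof -
  have "(\<Sum>l=i..n. of_bool (l \<in> I) :: nat) = (\<Sum>l\<in>I \<inter> {i..n}. 1)"
    by (rule sum.mono_neutral_cong_right) auto
  then show ?thesis by simp
qed

lemma xi_eq_tor: "I \<subseteq> {1..n} \<Longrightarrow> xi n I = tor n (\<lambda>i. real (card (I \<inter> {i..n})))"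
  unfolding xi_eq_simple_coords simple_coords_def
  by (intro tor_cong) (simp only: of_nat_sum[symmetric] sum_of_bool_eq_card)

lemma H_add_xi_eq_tor:
  assumes "I \<subseteq> {1..n}" "j \<in> {1..n}"
  shows "H n j + xi n I = tor n (\<lambda>i. real (card (I \<inter> {i..n}) + of_bool (i \<le> j)))"
  unfolding xi_eq_tor[OF assms(1)] H_eq_tor[OF assms(2)] tor_add by (intro tor_cong) auto

lemma sum_of_bool_le: "(\<Sum>i=1..k. of_bool (i \<le> j)) = (min j k :: nat)"
proof -
  have "(\<Sum>i=1..k. of_bool (i \<le> j) :: nat) = (\<Sum>i\<in>{1..min j k}. 1)"
    by (rule sum.mono_neutral_cong_right) auto
  then show ?thesis by simp
qed

theorem theorem6p1:
  fixes n :: nat and I :: "nat set"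
  assumes "n \<ge> 1" and "I \<subseteq> {1..n}"
  shows
    "(even (\<Sum>i\<in>I. i) \<longrightarrow>
        {\<xi>. canonical n I \<xi>} = {xi n I} \<and>
        (\<forall>k\<in>{1..<n}. \<forall>d \<rho>. fundamental_rep n k d \<rho> \<longrightarrow>
           uniton_number n d \<rho> (xi n I) = of_nat (\<Sum>l=1..k. 2 * card (I \<inter> {l..n})))) \<and>
     (odd (\<Sum>i\<in>I. i) \<longrightarrow>
        {\<xi>. canonical n I \<xi>} = {H n j + xi n I | j. j \<in> I \<and> odd j} \<and>
        (\<forall>j\<in>I. odd j \<longrightarrow> (\<forall>k\<in>{1..<n}. \<forall>d \<rho>. fundamental_rep n k d \<rho> \<longrightarrow>
           uniton_number n d \<rho> (H n j + xi n I) =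
             of_nat ((\<Sum>l=1..k. 2 * card (I \<inter> {l..n})) + 2 * min j k)))) \<and>
     (\<forall>d \<rho>. fundamental_rep n n d \<rho> \<longrightarrow>
        (even (\<Sum>i\<in>I. i) \<longrightarrow>
           uniton_number n d \<rho> (xi n I) = of_nat (\<Sum>l=1..n. card (I \<inter> {l..n}))) \<and>
        (odd (\<Sum>i\<in>I. i) \<longrightarrow> (\<forall>j\<in>I. odd j \<longrightarrow>
           uniton_number n d \<rho> (H n j + xi n I) =
             of_nat ((\<Sum>l=1..n. card (I \<inter> {l..n})) + j))))"
proof -
  have xi: "uniton_number n d \<rho> (xi n I) = of_nat (\<Sum>l=1..k. 2 * card (I \<inter> {l..n}))"
    if "k \<in> {1..<n}" "fundamental_rep n k d \<rho>" for k d \<rho>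
    unfolding xi_eq_tor[OF assms(2)] using that uniton_number_fundamental_rep(1)[OF that(2)]
    by (simp add: sum_distrib_left)
  have xi_n: "uniton_number n d \<rho> (xi n I) = of_nat (\<Sum>l=1..n. card (I \<inter> {l..n}))"
    if "fundamental_rep n n d \<rho>" for d \<rho>
    unfolding xi_eq_tor[OF assms(2)] uniton_number_fundamental_rep(2)[OF that refl] by simp
  have Hxi: "uniton_number n d \<rho> (H n j + xi n I) = of_nat ((\<Sum>l=1..k. 2 * card (I \<inter> {l..n})) + 2 * min j k)"
    if "j \<in> I" "k \<in> {1..<n}" "fundamental_rep n k d \<rho>" for j k d \<rho>
  proof -
    have j: "j \<in> {1..n}" and k: "k < n" using that assms(2) by auto
    have "uniton_number n d \<rho> (H n j + xi n I) = of_real (2 * (\<Sum>i=1..k. real (card (I \<inter> {i..n}) + of_bool (i \<le> j))))"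
      unfolding H_add_xi_eq_tor[OF assms(2) j] by (rule uniton_number_fundamental_rep(1)[OF that(3) k])
    also have "\<dots> = of_nat (2 * ((\<Sum>i=1..k. card (I \<inter> {i..n})) + (\<Sum>i=1..k. of_bool (i \<le> j))))"
      unfolding sum.distrib[symmetric] by simp
    finally show ?thesis unfolding sum_of_bool_le by (simp add: sum_distrib_left)
  qed
  have Hxi_n: "uniton_number n d \<rho> (H n j + xi n I) = of_nat ((\<Sum>l=1..n. card (I \<inter> {l..n})) + j)"
    if "j \<in> I" "fundamental_rep n n d \<rho>" for j d \<rho>
  proof -
    have j: "j \<in> {1..n}" using that assms(2) by blast
    have "uniton_number n d \<rho> (H n j + xi n I) = of_real (\<Sum>i=1..n. real (card (I \<inter> {i..n}) + of_bool (i \<le> j)))"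
      unfolding H_add_xi_eq_tor[OF assms(2) j] by (rule uniton_number_fundamental_rep(2)[OF that(2) refl])
    also have "\<dots> = of_nat ((\<Sum>i=1..n. card (I \<inter> {i..n})) + (\<Sum>i=1..n. of_bool (i \<le> j)))"
      unfolding sum.distrib[symmetric] by simp
    finally show ?thesis unfolding sum_of_bool_le using j by simp
  qed
  show ?thesis
    by (intro conjI impI allI ballI)
      (assumption | rule canonical_even[OF assms(2)] canonical_odd[OF assms(2)] xi xi_n Hxi Hxi_n)+
qed

end
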